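(* Let $d\ge2$ and, if $d\ge3$, let $p,q\in(1,\infty]$ be such that $\frac1p+\frac1q<\frac2{d-1}$. There exists a continuous and monotonically increasing function $\theta_{\rm E}:[1,\infty)\to(0,1)$ such that the following holds: Let $\omega\in\Omega$, $x_0\in\mathbb Z^d$, $n\in\mathbb N$, and let $u$ solve $\mathcal L^\omega u=0$ in $B(x_0,4n)$. Then $$\operatorname{osc}(u,B(x_0,n))\le\theta_{\rm E}\,\operatorname{osc}(u,B(x_0,4n)),$$ where $$\theta_{\rm E}=\begin{cases}\theta_{\rm E}\bigl(\|\omega\|_{\underline L^1(B(x_0,4n))}\|\omega^{-1}\|_{\underline L^1(B(x_0,4n))}\bigr)&\text{if }d=2,\\ \theta_{\rm E}\bigl(\|\omega\|_{\underline L^p(B(x_0,4n))}\|\omega^{-1}\|_{\underline L^q(B(x_0,4n))}\bigr)&\text{if }d\ge3.\end{cases}$$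
   Context: $\mathbb B^d=\{\{x,y\}: x,y\in\mathbb Z^d,\ |x-y|=1\}$ is the set of nearest-neighbour bonds and $\Omega=(0,\infty)^{\mathbb B^d}$ the set of conductances; $\omega(x,y)=\omega(y,x):=\omega(\{x,y\})$ if $\{x,y\}\in\mathbb B^d$ and $\omega(x,y):=0$ otherwise. The operator $\mathcal L^\omega$ acts on $u:\mathbb Z^d\to\mathbb R$ by $(\mathcal L^\omega u)(x)=\sum_{y\in\mathbb Z^d}\omega(x,y)(u(y)-u(x))$; "$\mathcal L^\omega u=0$ in $V$" means that it holds at every $x\in V$. For $y\in\mathbb Z^d$ and real $r\ge0$, $B(y,r)=y+([-r,r]\cap\mathbb Z)^d$. For finite $S\subset\mathbb Z^d$, let $S_{\mathbb B^d}$ be the set of bonds with both endpoints in $S$; for $F:\mathbb B^d\to\mathbb R$ and $r\in(0,\infty)$, $\|F\|_{\underline L^r(S)}:=\bigl(\frac1{|S_{\mathbb B^d}|}\sum_{e\in S_{\mathbb B^d}}|F(e)|^r\bigr)^{1/r}$, and $\|F\|_{\underline L^\infty(S)}:=\sup_{e\in S_{\mathbb B^d}}|F(e)|$. $\omega^{-1}$ is the pointwise reciprocal. $\operatorname{osc}(u,S):=\max_Su-\min_Su$. *)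

theory Defs
  imports "HOL-Analysis.Analysis"
begin

type_synonym 'd lattice = "int ^ 'd"
type_synonym 'd bond = "'d lattice set"

definition bonds :: "('d::finite) bond set" where
  "bonds = {{x, y} | x y. norm (\<chi> i. real_of_int ((x - y) $ i)) = 1}"

text \<open>Functions on bonds are total functions on sets of lattice points;
  only their values on \<^const>\<open>bonds\<close> are ever used.\<close>

definition conductances :: "(('d::finite) bond \<Rightarrow> real) set" where
  "conductances = bonds \<rightarrow> {0<..}"

definition conductance :: "(('d::finite) bond \<Rightarrow> real) \<Rightarrow> 'd lattice \<Rightarrow> 'd lattice \<Rightarrow> real" where
  "conductance \<omega> x y = (if {x, y} \<in> bonds then \<omega> {x, y} else 0)"

definition generator ::
    "(('d::finite) bond \<Rightarrow> real) \<Rightarrow> ('d lattice \<Rightarrow> real) \<Rightarrow> 'd lattice \<Rightarrow> real" where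
  "generator \<omega> u x = (\<Sum>\<^sub>\<infinity>y\<in>UNIV. conductance \<omega> x y * (u y - u x))"

definition lattice_box :: "('d::finite) lattice \<Rightarrow> real \<Rightarrow> 'd lattice set" where
  "lattice_box y r = {x. \<forall>i. real_of_int ((x - y) $ i) \<in> {-r..r}}"

definition bonds_in :: "('d::finite) lattice set \<Rightarrow> 'd bond set" where
  "bonds_in S = {e \<in> bonds. e \<subseteq> S}"

text \<open>The exponent ranges over \<open>(0, \<infinity>]\<close> and \<open>S\<close> is a finite set containing a bond.\<close>

definition avg_norm :: "ereal \<Rightarrow> ('d::finite) lattice set \<Rightarrow> ('d bond \<Rightarrow> real) \<Rightarrow> real" where
  "avg_norm r S F =
     (if r = \<infinity> then (SUP e\<in>bonds_in S. \<bar>F e\<bar>)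
      else (1 / real (card (bonds_in S)) * (\<Sum>e\<in>bonds_in S. \<bar>F e\<bar> powr real_of_ereal r))
             powr (1 / real_of_ereal r))"

definition osc :: "('d lattice \<Rightarrow> real) \<Rightarrow> ('d::finite) lattice set \<Rightarrow> real" where
  "osc u S = Max (u ` S) - Min (u ` S)"

lemma finite_lattice_box: "finite (lattice_box y r)"
proof -
  have "lattice_box y r \<subseteq> vec_lambda ` (PiE UNIV (\<lambda>i. {y $ i - \<lfloor>r\<rfloor>..y $ i + \<lfloor>r\<rfloor>}))"
  proof
    fix x assume x: "x \<in> lattice_box y r"
    have "x $ i \<in> {y $ i - \<lfloor>r\<rfloor>..y $ i + \<lfloor>r\<rfloor>}" for i
    proof -
      have a: "real_of_int (x $ i - y $ i) \<le> r" "real_of_int (y $ i - x $ i) \<le> r"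
        using x by (auto simp: lattice_box_def dest!: spec[of _ i])
      show ?thesis using a[folded le_floor_iff] by auto
    qed
    then have "x = vec_lambda (vec_nth x)" "vec_nth x \<in> PiE UNIV (\<lambda>i. {y $ i - \<lfloor>r\<rfloor>..y $ i + \<lfloor>r\<rfloor>})"
      by (auto simp: PiE_def)
    then show "x \<in> vec_lambda ` (PiE UNIV (\<lambda>i. {y $ i - \<lfloor>r\<rfloor>..y $ i + \<lfloor>r\<rfloor>}))"
      by blast
  qed
  then show ?thesis
    by (rule finite_subset) (intro finite_imageI finite_PiE finite_UNIV; simp)
qed

lemma bond_in_iff:
  "{x, y} \<in> bonds \<longleftrightarrow> norm (\<chi> i. real_of_int ((x - y) $ i)) = 1"
proof -
  have "norm (\<chi> i. real_of_int ((a - b) $ i)) = norm (\<chi> i. real_of_int ((b - a) $ i))"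
    for a b :: "'a lattice"
    by (simp add: norm_vec_def L2_set_def power2_commute)
  then show ?thesis
    by (auto simp: bonds_def doubleton_eq_iff)
qed

lemma bond_subset_lattice_box: "{x, y} \<in> bonds \<Longrightarrow> y \<in> lattice_box x 1"
proof -
  assume "{x, y} \<in> bonds"
  then have n: "norm (\<chi> i. real_of_int ((x - y) $ i)) = 1" by (simp add: bond_in_iff)
  have "real_of_int ((y - x) $ i) \<in> {-1..1}" for i
    using component_le_norm_cart[of "\<chi> i. real_of_int ((x - y) $ i)" i] n
    by (auto simp: abs_le_iff)
  then show "y \<in> lattice_box x 1" unfolding lattice_box_def by blast
qed

lemma generator_eq_sum:
  "generator \<omega> u x = (\<Sum>y | {x, y} \<in> bonds. \<omega> {x, y} * (u y - u x))"
proof -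
  have fin: "finite {y. {x, y} \<in> bonds}"
    by (rule finite_subset[OF _ finite_lattice_box[of x 1]]) (use bond_subset_lattice_box in blast)
  have "generator \<omega> u x = (\<Sum>\<^sub>\<infinity>y\<in>{y. {x, y} \<in> bonds}. \<omega> {x, y} * (u y - u x))"
    unfolding generator_def by (rule infsum_cong_neutral) (auto simp: conductance_def)
  then show ?thesis using fin by simp
qed

end

theory Submission
  imports Defs
begin

text \<open>
  Normalise a harmonic function on the box of radius \<open>4n\<close> to \<open>0 \<le> u \<le> 1\<close>; replacing \<open>u\<close> by \<open>1 - u\<close> if
  necessary, \<open>u \<ge> 1/2\<close> on at least half of the box of radius \<open>n\<close>. For \<open>f = u + \<epsilon>\<close> the function
  \<open>v = - ln (2 f)\<close> is subharmonic, its positive part vanishes on half of the box, and testing the equation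
  with \<open>\<eta>\<^sup>2 / f\<close> bounds its energy by a multiple of \<open>n\<^sup>-\<^sup>2 \<Sum>\<omega>\<close>. An upper bound \<open>v \<le> V\<close>
  on the small box says \<open>f \<ge> exp (- V) / 2\<close> there, which is the decay of oscillation with factor
  \<open>1 - exp (- V) / 2\<close>.

  For \<open>d \<ge> 3\<close> the bound on \<open>v\<close> comes from a De Giorgi iteration for the energies of \<open>(v - l)\<^sub>+\<close>. The cutoff
  functions decrease only across layers on which \<open>\<omega>\<^sup>p\<close> and \<open>|\<nabla>v|\<^sup>s\<close>, \<open>s = 2q / (q + 1)\<close>, are not much larger
  than on average; hence only the Sobolev inequality on \<open>(d - 1)\<close>-dimensional slices is needed,
  and its exponent is sufficient exactly if \<open>1/p + 1/q < 2/(d - 1)\<close>. For \<open>d = 2\<close> the slices are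
  lines, on which \<open>\<Sum>|\<nabla>v|\<close> controls the supremum, and a single good layer suffices.
\<close>

section \<open>Hoelder and Loomis-Whitney inequalities\<close>

text \<open>The logarithm is what frees the estimate from \<open>u\<close>: the energy of
  \<open>v\<close> is bounded by the conductances alone, so the bound on \<open>v\<close> can depend
  only on averages of \<open>\<omega>\<close> and its inverse. The half of the box on which the
  positive part vanishes serves every later truncation as well, and Poincare then absorbs the
  zero-order terms that Sobolev on a bounded slice produces.

  The exponents are forced. \<open>s\<close> is the power for which Hoelder against the weighted
  energy leaves \<open>\<omega> powr (- q)\<close>; \<open>t\<close> is its Sobolev exponent in
  dimension \<open>d - 1\<close>; and \<open>\<beta> = t * (1 - 1 / p) / 2\<close> makes
  \<open>w powr (2 * \<beta>)\<close> summable to the exponent dual to \<open>p\<close>. The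
  hypothesis on \<open>p\<close> and \<open>q\<close> says \<open>\<beta> > 1\<close>, which makes
  the energy recursion superlinear.

  The lattice is the obstacle: radii are integers, so the iteration has about log n steps and must
  end with a crude bound instead of a limit. Infinite exponents are replaced by finite ones, since
  the condition on the exponents is open and averaged norms are largest at infinity.\<close>

lemma sum_powr_Holder:
  fixes f g :: "'a \<Rightarrow> real"
  assumes "\<alpha> \<ge> 0" "\<beta> \<ge> 0" "\<alpha> + \<beta> = 1"
    and f: "\<And>x. x \<in> A \<Longrightarrow> f x \<ge> 0" and g: "\<And>x. x \<in> A \<Longrightarrow> g x \<ge> 0"
  shows "(\<Sum>x\<in>A. f x powr \<alpha> * g x powr \<beta>) \<le> (\<Sum>x\<in>A. f x) powr \<alpha> * (\<Sum>x\<in>A. g x) powr \<beta>"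
proof (cases "finite A \<and> sum f A > 0 \<and> sum g A > 0")
  case False
  \<comment> \<open>This holds also for exponent 0, since \<open>0 powr 0 = 0\<close>.\<close>
  then have "(\<Sum>x\<in>A. f x powr \<alpha> * g x powr \<beta>) = 0"
  proof (cases "finite A")
    case True
    have "sum f A \<ge> 0" "sum g A \<ge> 0" by (auto intro: sum_nonneg f g)
    then have "sum f A = 0 \<or> sum g A = 0"
      using False True by auto
    then have "(\<forall>x\<in>A. f x = 0) \<or> (\<forall>x\<in>A. g x = 0)"
      using True f g by (simp add: sum_nonneg_eq_0_iff)
    then show ?thesis by (intro sum.neutral) auto
  qed simp
  then show ?thesis by simp
next
  case True
  define F where "F = sum f A"
  define G where "G = sum g A"
  have F: "F > 0" "G > 0" "finite A" using True by (auto simp: F_def G_def)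
  have "f x powr \<alpha> * g x powr \<beta> \<le> F powr \<alpha> * G powr \<beta> * (\<alpha> * (f x / F) + \<beta> * (g x / G))" if "x \<in> A" for x
  proof (cases "f x = 0 \<or> g x = 0")
    case True
    then show ?thesis using assms F f[OF that] g[OF that] by auto
  next
    case False
    then have "(f x / F) powr \<alpha> * (g x / G) powr \<beta> \<le> \<alpha> * (f x / F) + \<beta> * (g x / G)"
      using assms F f[OF that] g[OF that] by (intro Youngs_inequality_0) auto
    then show ?thesis using F by (simp add: powr_divide field_simps)
  qed
  then have "(\<Sum>x\<in>A. f x powr \<alpha> * g x powr \<beta>) \<le> (\<Sum>x\<in>A. F powr \<alpha> * G powr \<beta> * (\<alpha> * (f x / F) + \<beta> * (g x / G)))"
    by (rule sum_mono)
  also have "\<dots> = F powr \<alpha> * G powr \<beta> * (\<alpha> * (F / F) + \<beta> * (G / G))"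
    unfolding sum_distrib_left[symmetric] sum.distrib sum_divide_distrib[symmetric] F_def G_def ..
  also have "\<dots> = F powr \<alpha> * G powr \<beta>" using F assms by simp
  finally show ?thesis by (simp add: F_def G_def)
qed

lemma sum_Holder:
  fixes f g :: "'a \<Rightarrow> real"
  assumes "p > 1" "1/p + 1/q = 1"
    and f: "\<And>x. x \<in> A \<Longrightarrow> f x \<ge> 0" and g: "\<And>x. x \<in> A \<Longrightarrow> g x \<ge> 0"
  shows "(\<Sum>x\<in>A. f x * g x) \<le> (\<Sum>x\<in>A. f x powr p) powr (1/p) * (\<Sum>x\<in>A. g x powr q) powr (1/q)"
proof -
  have q: "q > 0" using assms(1,2)
    by (smt (verit) divide_less_eq_1_pos zero_less_divide_1_iff)
  have "(\<Sum>x\<in>A. f x * g x) = (\<Sum>x\<in>A. (f x powr p) powr (1/p) * (g x powr q) powr (1/q))"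
    using f g assms q by (intro sum.cong) (auto simp: powr_powr)
  also have "\<dots> \<le> (\<Sum>x\<in>A. f x powr p) powr (1/p) * (\<Sum>x\<in>A. g x powr q) powr (1/q)"
    using assms q by (intro sum_powr_Holder) auto
  finally show ?thesis .
qed

text \<open>Hoelder for \<open>card I\<close> factors with equal exponents. Each factor is divided
  by its own sum; then the arithmetic-geometric mean inequality applies term by term, and the means
  sum to 1.\<close>

lemma sum_prod_Holder:
  fixes h :: "'i \<Rightarrow> 'a \<Rightarrow> real"
  assumes I: "finite I" "I \<noteq> {}" and A: "finite A"
    and h: "\<And>i x. i \<in> I \<Longrightarrow> x \<in> A \<Longrightarrow> h i x \<ge> 0"
  shows "(\<Sum>x\<in>A. \<Prod>i\<in>I. h i x powr (1 / card I)) \<le> (\<Prod>i\<in>I. (\<Sum>x\<in>A. h i x) powr (1 / card I))"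
proof (cases "\<exists>i\<in>I. (\<Sum>x\<in>A. h i x) = 0")
  case True
  then obtain i where i: "i \<in> I" "\<forall>x\<in>A. h i x = 0"
    using A h by (auto simp: sum_nonneg_eq_0_iff)
  have "(\<Sum>x\<in>A. \<Prod>i\<in>I. h i x powr (1 / card I)) = 0"
    using i I by (intro sum.neutral ballI prod_zero) auto
  then show ?thesis by (simp add: prod_nonneg)
next
  case False
  define H where "H i = (\<Sum>x\<in>A. h i x)" for i
  have H: "H i > 0" if "i \<in> I" for i
    using False that h[OF that] unfolding H_def
    by (metis less_eq_real_def sum_nonneg)
  define P where "P = (\<Prod>i\<in>I. H i powr (1 / card I))"
  have P: "P \<ge> 0" unfolding P_def by (simp add: prod_nonneg)
  have c: "card I > 0" using I by (simp add: card_gt_0_iff)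
  have "(\<Prod>i\<in>I. h i x powr (1 / card I)) \<le> P * (\<Sum>i\<in>I. (h i x / H i) / card I)" if "x \<in> A" for x
  proof -
    have "(\<Prod>i\<in>I. h i x powr (1 / card I)) = P * (\<Prod>i\<in>I. (h i x / H i) powr (1 / card I))"
      unfolding P_def prod.distrib[symmetric] 
      by (rule prod.cong) (use H in \<open>auto simp: powr_divide dest!: H\<close>)
    also have "\<dots> \<le> P * (\<Sum>i\<in>I. (h i x / H i) / card I)"
      unfolding prod_powr_distrib[symmetric] using P I h[OF _ that] H
      by (intro mult_left_mono arith_geom_mean divide_nonneg_pos) auto
    finally show ?thesis .
  qed
  then have "(\<Sum>x\<in>A. \<Prod>i\<in>I. h i x powr (1 / card I)) \<le> (\<Sum>x\<in>A. P * (\<Sum>i\<in>I. (h i x / H i) / card I))"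
    by (rule sum_mono)
  also have "\<dots> = P * (\<Sum>i\<in>I. (H i / H i) / card I)"
    unfolding sum_distrib_left[symmetric]
    by (subst sum.swap) (simp only: sum_divide_distrib[symmetric] H_def)
  also have "(\<Sum>i\<in>I. (H i / H i) / card I) = (\<Sum>i\<in>I. 1 / card I)"
    using H by (intro sum.cong) (auto dest!: H)
  finally show ?thesis using c by (simp add: P_def H_def)
qed

text \<open>The coordinates in \<open>I\<close> range over \<open>{-R..R}\<close>, the others are frozen at their values in \<open>z\<close>.\<close>

definition fib :: "nat \<Rightarrow> 'd set \<Rightarrow> ('d \<Rightarrow> int) \<Rightarrow> ('d \<Rightarrow> int) set" where
  "fib R I z = {x. (\<forall>i\<in>I. \<bar>x i\<bar> \<le> int R) \<and> (\<forall>i. i \<notin> I \<longrightarrow> x i = z i)}"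

lemma fib_empty [simp]: "fib R {} z = {z}"
  by (auto simp: fib_def)

lemma bij_betw_fib_insert:
  assumes "k \<notin> J"
  shows "bij_betw (\<lambda>(c, x). x(k := c)) ({- int R..int R} \<times> fib R J z) (fib R (insert k J) z)"
proof (rule bij_betw_byWitness[where f' = "\<lambda>y. (y k, y(k := z k))"])
  show "\<forall>a\<in>{- int R..int R} \<times> fib R J z. (\<lambda>y. (y k, y(k := z k))) ((\<lambda>(c, x). x(k := c)) a) = a"
    using assms by (auto simp: fib_def fun_eq_iff)
qed (use assms in \<open>auto simp: fib_def fun_eq_iff abs_le_iff split: if_splits\<close>)

lemma sum_fib_insert:
  assumes "k \<notin> J"
  shows "(\<Sum>x\<in>fib R (insert k J) z. F x) = (\<Sum>c\<in>{- int R..int R}. \<Sum>x\<in>fib R J z. F (x(k := c)))"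
  using sum.reindex_bij_betw[OF bij_betw_fib_insert[OF assms], of F R z, symmetric]
  by (simp add: sum.cartesian_product case_prod_beta)

lemma sum_fib_remove:
  assumes "k \<in> I"
  shows "(\<Sum>x\<in>fib R I z. F x) = (\<Sum>c\<in>{- int R..int R}. \<Sum>x\<in>fib R (I - {k}) z. F (x(k := c)))"
  using sum_fib_insert[of k "I - {k}"] assms by (simp add: insert_absorb)

lemma card_fib:
  assumes "finite I"
  shows "finite (fib R I z) \<and> card (fib R I z) = (2 * R + 1) ^ card I"
  using assms
proof (induction I)
  case (insert k J)
  note bij = bij_betw_fib_insert[OF insert(2), of R z]
  have "finite (fib R (insert k J) z)"
    using bij_betw_finite[OF bij] insert by simp
  moreover have "card (fib R (insert k J) z) = nat (2 * int R + 1) * (2 * R + 1) ^ card J"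
    using bij_betw_same_card[OF bij] insert by (simp add: card_cartesian_product)
  moreover have "nat (2 * int R + 1) = 2 * R + 1" by arith
  ultimately show ?case using insert by simp
qed simp

lemma finite_fib: "finite I \<Longrightarrow> finite (fib R I z)"
  by (simp add: card_fib)

text \<open>Induction on the dimension. With the coordinate \<open>k\<close> fixed at
  \<open>c\<close>, Hoelder with exponents 1/m and (m-1)/m splits off \<open>g k\<close>, which does
  not see \<open>c\<close>; the induction hypothesis handles the other factors inside the slice, and
  \<open>sum_prod_Holder\<close> sums their product over \<open>c\<close>. The induction starts at
  two coordinates, where the sum factorises.\<close>

lemma Loomis_Whitney:
  fixes g :: "'d \<Rightarrow> ('d \<Rightarrow> int) \<Rightarrow> real"
  assumes "finite I" "card I \<ge> 2" "\<And>k x. k \<in> I \<Longrightarrow> g k x \<ge> 0"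
    and "\<And>k x c. k \<in> I \<Longrightarrow> g k (x(k := c)) = g k x"
  shows "(\<Sum>x\<in>fib R I z. \<Prod>k\<in>I. g k x powr (1 / (card I - 1)))
    \<le> (\<Prod>k\<in>I. (\<Sum>x\<in>fib R (I - {k}) z. g k x) powr (1 / (card I - 1)))"
  using assms
proof (induction I arbitrary: g)
  case empty
  then show ?case by simp
next
  case (insert k J)
  define m where "m = card J"
  have m: "m \<ge> 1" "card (insert k J) - 1 = m" using insert by (auto simp: m_def)
  have gk: "g k x \<ge> 0" "g k (x(k := c)) = g k x" for x c by (rule insert.prems, rule insertI1)+
  have gi: "g i x \<ge> 0" "g i (x(i := c)) = g i x" if "i \<in> J" for i x c by (rule insert.prems, rule insertI2, rule that)+
  have ne: "i \<noteq> k" if "i \<in> J" for i using that insert by auto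
  have split: "(\<Sum>x\<in>fib R (insert k J) z. \<Prod>i\<in>insert k J. g i x powr (1 / m)) =
    (\<Sum>c\<in>{- int R..int R}. \<Sum>x\<in>fib R J z. g k x powr (1 / m) * (\<Prod>i\<in>J. g i (x(k := c)) powr (1 / m)))"
    using insert(1,2) by (simp add: sum_fib_insert gk)
  have rem: "(\<Sum>x\<in>fib R (insert k J - {i}) z. g i x) = (\<Sum>c\<in>{- int R..int R}. \<Sum>x\<in>fib R (J - {i}) z. g i (x(k := c)))" if "i \<in> J" for i
  proof -
    have "insert k J - {i} = insert k (J - {i})" using ne[OF that] by auto
    then show ?thesis using insert(2) by (simp add: sum_fib_insert)
  qed
  have fk: "insert k J - {k} = J" using insert by auto
  show ?case
  proof (cases "m = 1")
    case True
    then obtain j where j: "J = {j}" unfolding m_def by (auto simp: card_1_singleton_iff)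
    have jk: "j \<noteq> k" using j insert by auto
    have eq: "g j (x(k := c)) = g j (z(k := c))" if "x \<in> fib R J z" for x c
    proof -
      have "x(k := c) = (z(k := c))(j := x j)" using that jk by (auto simp: fib_def j fun_eq_iff)
      then show ?thesis using gi(2)[of j "z(k := c)"] j by simp
    qed
    have "(\<Sum>c\<in>{- int R..int R}. \<Sum>x\<in>fib R J z. g k x * g j (x(k := c))) =
       (\<Sum>c\<in>{- int R..int R}. \<Sum>x\<in>fib R J z. g k x * g j (z(k := c)))"
      by (intro sum.cong refl) (simp add: eq)
    also have "\<dots> = (\<Sum>x\<in>fib R J z. g k x) * (\<Sum>c\<in>{- int R..int R}. g j (z(k := c)))"
      by (subst sum.swap) (simp only: sum_product)
    finally have e: "(\<Sum>c\<in>{- int R..int R}. \<Sum>x\<in>fib R J z. g k x * g j (x(k := c))) = \<dots>" .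
    have "(\<Sum>c\<in>{- int R..int R}. \<Sum>x\<in>fib R (J - {j}) z. g j (x(k := c))) = (\<Sum>c\<in>{- int R..int R}. g j (z(k := c)))"
      by (simp add: j)
    then have r: "(\<Sum>x\<in>fib R (insert k J - {j}) z. g j x) = (\<Sum>c\<in>{- int R..int R}. g j (z(k := c)))"
      using rem[of j] j by simp
    have gj: "g j x \<ge> 0" for x using gi(1)[of j] j by simp
    have "(\<Sum>x\<in>fib R (insert k J) z. \<Prod>i\<in>insert k J. g i x powr (1 / m)) =
      (\<Sum>c\<in>{- int R..int R}. \<Sum>x\<in>fib R J z. g k x * g j (x(k := c)))"
      unfolding split unfolding True j using gk(1) gj by simp
    also have "\<dots> = (\<Sum>x\<in>fib R J z. g k x) * (\<Sum>c\<in>{- int R..int R}. g j (z(k := c)))" by (rule e)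
    also have "\<dots> = (\<Prod>i\<in>{k, j}. (\<Sum>x\<in>fib R (insert k J - {i}) z. g i x) powr (1 / m))"
      using jk gk(1) gj r unfolding True by (simp add: fk sum_nonneg)
    finally show ?thesis unfolding m(2) by (simp add: j)
  next
    case False
    then have m2: "m \<ge> 2" using m by simp
    have step: "(\<Sum>x\<in>fib R J z. g k x powr (1 / m) * (\<Prod>i\<in>J. g i (x(k := c)) powr (1 / m)))
      \<le> (\<Sum>x\<in>fib R J z. g k x) powr (1 / m) * (\<Prod>i\<in>J. (\<Sum>x\<in>fib R (J - {i}) z. g i (x(k := c))) powr (1 / m))" for c
    proof -
      have r: "(y powr (1 / real (m - 1))) powr (real (m - 1) / m) = y powr (1 / m)" for y :: real
        using m2 by (simp add: powr_powr)
      have "(\<Sum>x\<in>fib R J z. g k x powr (1 / m) * (\<Prod>i\<in>J. g i (x(k := c)) powr (1 / m)))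
        = (\<Sum>x\<in>fib R J z. g k x powr (1 / m) * (\<Prod>i\<in>J. g i (x(k := c)) powr (1 / (m - 1))) powr (real (m - 1) / m))"
        by (simp only: prod_powr_distrib r)
      also have "\<dots> \<le> (\<Sum>x\<in>fib R J z. g k x) powr (1 / m) * (\<Sum>x\<in>fib R J z. \<Prod>i\<in>J. g i (x(k := c)) powr (1 / (m - 1))) powr (real (m - 1) / m)"
        using m2 gk by (intro sum_powr_Holder) (auto simp: field_simps of_nat_diff intro!: prod_nonneg)
      also have "\<dots> \<le> (\<Sum>x\<in>fib R J z. g k x) powr (1 / m) * (\<Prod>i\<in>J. (\<Sum>x\<in>fib R (J - {i}) z. g i (x(k := c))) powr (1 / (m - 1))) powr (real (m - 1) / m)"
      proof (intro mult_left_mono powr_mono2)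
        show "(\<Sum>x\<in>fib R J z. \<Prod>i\<in>J. g i (x(k := c)) powr (1 / (m - 1))) \<le> (\<Prod>i\<in>J. (\<Sum>x\<in>fib R (J - {i}) z. g i (x(k := c))) powr (1 / (m - 1)))"
          unfolding m_def
        proof (rule insert.IH)
          show "g i ((x(i := b))(k := c)) = g i (x(k := c))" if "i \<in> J" for i x b
            by (subst fun_upd_twist[OF ne[OF that]]) (rule gi(2)[OF that])
        qed (use m2 gi in \<open>auto simp: m_def\<close>)
      qed (auto intro!: sum_nonneg prod_nonneg)
      also have "\<dots> = (\<Sum>x\<in>fib R J z. g k x) powr (1 / m) * (\<Prod>i\<in>J. (\<Sum>x\<in>fib R (J - {i}) z. g i (x(k := c))) powr (1 / m))"
        by (simp only: prod_powr_distrib r)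
      finally show ?thesis .
    qed
    have "(\<Sum>x\<in>fib R (insert k J) z. \<Prod>i\<in>insert k J. g i x powr (1 / m)) \<le>
      (\<Sum>c\<in>{- int R..int R}. (\<Sum>x\<in>fib R J z. g k x) powr (1 / m) * (\<Prod>i\<in>J. (\<Sum>x\<in>fib R (J - {i}) z. g i (x(k := c))) powr (1 / m)))"
      unfolding split by (rule sum_mono) (rule step)
    also have "\<dots> = (\<Sum>x\<in>fib R J z. g k x) powr (1 / m) * (\<Sum>c\<in>{- int R..int R}. \<Prod>i\<in>J. (\<Sum>x\<in>fib R (J - {i}) z. g i (x(k := c))) powr (1 / m))"
      by (simp add: sum_distrib_left)
    also have "\<dots> \<le> (\<Sum>x\<in>fib R J z. g k x) powr (1 / m) * (\<Prod>i\<in>J. (\<Sum>c\<in>{- int R..int R}. \<Sum>x\<in>fib R (J - {i}) z. g i (x(k := c))) powr (1 / m))"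
      unfolding m_def using insert(1) m2 gi by (intro mult_left_mono sum_prod_Holder) (auto simp: m_def intro!: sum_nonneg)
    also have "\<dots> = (\<Prod>i\<in>insert k J. (\<Sum>x\<in>fib R (insert k J - {i}) z. g i x) powr (1 / m))"
      using insert(1,2) by (simp add: fk rem)
    finally show ?thesis unfolding m .
  qed
qed

section \<open>Sobolev and Poincare inequalities\<close>

lemma abs_diff_le_variation:
  fixes g :: "int \<Rightarrow> real"
  assumes "a \<in> {l..r}" "b \<in> {l..r}"
  shows "\<bar>g b - g a\<bar> \<le> (\<Sum>c\<in>{l..<r}. \<bar>g (c + 1) - g c\<bar>)"
proof -
  have le: "\<bar>g b - g a\<bar> \<le> (\<Sum>c\<in>{a..<b}. \<bar>g (c + 1) - g c\<bar>)" if "a \<le> b" for a b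
    using that
  proof (induction b rule: int_ge_induct)
    case (step i)
    have "{a..<i + 1} = insert i {a..<i}" using step by auto
    then show ?case using step by simp
  qed simp
  have mono: "(\<Sum>c\<in>{a..<b}. \<bar>g (c + 1) - g c\<bar>) \<le> (\<Sum>c\<in>{l..<r}. \<bar>g (c + 1) - g c\<bar>)" if "l \<le> a" "b \<le> r" for a b
    using that by (intro sum_mono2) auto
  show ?thesis
  proof (cases "a \<le> b")
    case True
    then show ?thesis using le[OF True] mono[of a b] assms by auto
  next
    case False
    then show ?thesis using le[of b a] mono[of b a] assms by auto
  qed
qed

text \<open>Mean value theorem. Adding the powers at both endpoints makes the bound symmetric, so
  that the two ends of a bond can later be summed separately.\<close>

lemma powr_diff_le:
  fixes a b :: real
  assumes "a \<ge> 0" "b \<ge> 0" "\<gamma> \<ge> 1"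
  shows "\<bar>b powr \<gamma> - a powr \<gamma>\<bar> \<le> \<gamma> * \<bar>b - a\<bar> * (a powr (\<gamma> - 1) + b powr (\<gamma> - 1))"
proof -
  have *: "b powr \<gamma> - a powr \<gamma> \<le> \<gamma> * (b - a) * b powr (\<gamma> - 1)" if "0 \<le> a" "a < b" for a b :: real
  proof (cases "a = 0")
    case True
    have "b powr \<gamma> = 1 * b * b powr (\<gamma> - 1)" using that True by (simp add: powr_diff)
    also have "\<dots> \<le> \<gamma> * b * b powr (\<gamma> - 1)" using assms that by (intro mult_right_mono) auto
    finally show ?thesis using True by simp
  next
    case False
    have "\<exists>z. a < z \<and> z < b \<and> b powr \<gamma> - a powr \<gamma> = (b - a) * (\<gamma> * z powr (\<gamma> - 1))"
      using that False by (intro MVT2) (auto intro!: derivative_eq_intros simp: powr_diff)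
    then obtain z where z: "a < z" "z < b" "b powr \<gamma> - a powr \<gamma> = (b - a) * (\<gamma> * z powr (\<gamma> - 1))" by blast
    have "z powr (\<gamma> - 1) \<le> b powr (\<gamma> - 1)" using z that assms by (intro powr_mono2) auto
    then have "(b - a) * (\<gamma> * z powr (\<gamma> - 1)) \<le> (b - a) * (\<gamma> * b powr (\<gamma> - 1))"
      using that assms by (intro mult_left_mono) auto
    then show ?thesis using z(3) by (simp add: algebra_simps)
  qed
  have **: "\<bar>b powr \<gamma> - a powr \<gamma>\<bar> \<le> \<gamma> * \<bar>b - a\<bar> * b powr (\<gamma> - 1)" if "0 \<le> a" "a \<le> b" for a b :: real
  proof (cases "a = b")
    case False
    then show ?thesis using *[of a b] that assms powr_mono2[of \<gamma> a b] by auto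
  qed simp
  show ?thesis
  proof (cases "a \<le> b")
    case True
    have "\<gamma> * \<bar>b - a\<bar> * b powr (\<gamma> - 1) \<le> \<gamma> * \<bar>b - a\<bar> * (a powr (\<gamma> - 1) + b powr (\<gamma> - 1))"
      using assms by (intro mult_left_mono) auto
    then show ?thesis using **[of a b] True assms by linarith
  next
    case False
    have "\<gamma> * \<bar>b - a\<bar> * a powr (\<gamma> - 1) \<le> \<gamma> * \<bar>b - a\<bar> * (a powr (\<gamma> - 1) + b powr (\<gamma> - 1))"
      using assms by (intro mult_left_mono) auto
    moreover have "\<bar>a powr \<gamma> - b powr \<gamma>\<bar> \<le> \<gamma> * \<bar>a - b\<bar> * a powr (\<gamma> - 1)"
      using False assms by (intro **) auto
    ultimately show ?thesis
      unfolding abs_minus_commute[of a b] abs_minus_commute[of "a powr \<gamma>" "b powr \<gamma>"] by linarith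
  qed
qed

section \<open>Discrete gradients and sums over the bonds of a box\<close>

definition fdiff :: "(('d \<Rightarrow> int) \<Rightarrow> real) \<Rightarrow> 'd \<Rightarrow> ('d \<Rightarrow> int) \<Rightarrow> real" where
  "fdiff w k x = w (x(k := x k + 1)) - w x"

text \<open>The pair \<open>(k, x)\<close> stands for the bond from \<open>x\<close> to its neighbour in the positive direction \<open>k\<close>.\<close>

definition fib_edges :: "nat \<Rightarrow> 'd set \<Rightarrow> ('d \<Rightarrow> int) \<Rightarrow> ('d \<times> ('d \<Rightarrow> int)) set" where
  "fib_edges R I z = (SIGMA k:I. {x \<in> fib R I z. x k < int R})"

lemma fdiff_upd [simp]: "fdiff w k (x(k := c)) = w (x(k := c + 1)) - w (x(k := c))"
  by (simp add: fdiff_def)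

lemma finite_fib_edges: "finite I \<Longrightarrow> finite (fib_edges R I z)"
  by (auto simp: fib_edges_def finite_fib)

lemma sum_fib_edges:
  "finite I \<Longrightarrow> (\<Sum>(k, x)\<in>fib_edges R I z. F k x) = (\<Sum>k\<in>I. \<Sum>x | x \<in> fib R I z \<and> x k < int R. F k x)"
  unfolding fib_edges_def by (subst sum.Sigma) (auto simp: finite_fib)

lemma sum_fib_edges_line:
  assumes "finite I" "k \<in> I"
  shows "(\<Sum>x | x \<in> fib R I z \<and> x k < int R. F x) = (\<Sum>y\<in>fib R (I - {k}) z. \<Sum>c\<in>{- int R..<int R}. F (y(k := c)))"
proof -
  have "(\<Sum>x | x \<in> fib R I z \<and> x k < int R. F x) = (\<Sum>x\<in>fib R I z. if x k < int R then F x else 0)"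
    using assms by (simp add: sum.If_cases finite_fib Int_def)
  also have "\<dots> = (\<Sum>c\<in>{- int R..int R}. if c < int R then \<Sum>y\<in>fib R (I - {k}) z. F (y(k := c)) else 0)"
    using assms by (subst sum_fib_remove[of k]) (auto intro: sum.cong)
  also have "\<dots> = (\<Sum>c\<in>{- int R..<int R}. \<Sum>y\<in>fib R (I - {k}) z. F (y(k := c)))"
    by (subst sum.inter_filter[symmetric]) (auto intro!: sum.cong)
  also have "\<dots> = (\<Sum>y\<in>fib R (I - {k}) z. \<Sum>c\<in>{- int R..<int R}. F (y(k := c)))"
    by (rule sum.swap)
  finally show ?thesis .
qed

text \<open>A bond of the larger box either lies in a slice where the coordinate \<open>k\<close> is
  constant or points in direction \<open>k\<close>.\<close>

lemma sum_fib_edges_insert: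
  assumes "finite J" "k \<notin> J"
  shows "(\<Sum>(i, x)\<in>fib_edges R (insert k J) z. F i x) =
    (\<Sum>c\<in>{- int R..int R}. \<Sum>(i, x)\<in>fib_edges R J z. F i (x(k := c))) +
    (\<Sum>y\<in>fib R J z. \<Sum>c\<in>{- int R..<int R}. F k (y(k := c)))"
proof -
  have ik: "i \<noteq> k" if "i \<in> J" for i using that assms by auto
  have "(\<Sum>x | x \<in> fib R (insert k J) z \<and> x i < int R. F i x) =
     (\<Sum>c\<in>{- int R..int R}. \<Sum>x | x \<in> fib R J z \<and> x i < int R. F i (x(k := c)))" if "i \<in> J" for i
  proof -
    have "(\<Sum>x | x \<in> fib R (insert k J) z \<and> x i < int R. F i x) =
      (\<Sum>x\<in>fib R (insert k J) z. if x i < int R then F i x else 0)"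
      using assms by (subst sum.inter_filter[symmetric]) (auto simp: finite_fib)
    also have "\<dots> = (\<Sum>c\<in>{- int R..int R}. \<Sum>x | x \<in> fib R J z \<and> x i < int R. F i (x(k := c)))"
      using assms ik[OF that] by (subst sum.inter_filter) (auto simp: finite_fib sum_fib_insert)
    finally show ?thesis .
  qed
  then have "(\<Sum>i\<in>J. \<Sum>x | x \<in> fib R (insert k J) z \<and> x i < int R. F i x) =
    (\<Sum>c\<in>{- int R..int R}. \<Sum>i\<in>J. \<Sum>x | x \<in> fib R J z \<and> x i < int R. F i (x(k := c)))"
    by (subst sum.swap) simp
  moreover have "(\<Sum>x | x \<in> fib R (insert k J) z \<and> x k < int R. F k x) = (\<Sum>y\<in>fib R J z. \<Sum>c\<in>{- int R..<int R}. F k (y(k := c)))"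
  proof -
    have "insert k J - {k} = J" using assms by auto
    then show ?thesis using assms by (subst sum_fib_edges_line) auto
  qed
  ultimately show ?thesis
    unfolding sum_fib_edges[OF finite.insertI[OF assms(1)]] sum_fib_edges[OF assms(1)] sum.insert[OF assms]
    by (simp add: add.commute)
qed

text \<open>Two points are joined by first changing the coordinates in \<open>J\<close> and then the
  coordinate \<open>k\<close>, through the intermediate point \<open>y(k := c)\<close>. Both halves
  cost the same power of the side length, so a single power \<open>card I + 1\<close> survives the
  induction.\<close>

lemma fib_pair_diff:
  assumes "finite I"
  shows "(\<Sum>x\<in>fib R I z. \<Sum>y\<in>fib R I z. \<bar>f x - f y\<bar>)
    \<le> (2 * real R + 1) ^ (card I + 1) * (\<Sum>(k, x)\<in>fib_edges R I z. \<bar>fdiff f k x\<bar>)"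
  using assms
proof (induction I arbitrary: f)
  case empty
  then show ?case by (simp add: fib_edges_def)
next
  case (insert k J)
  define m where "m = 2 * real R + 1"
  let ?A = "{- int R..int R}" and ?F = "fib R J z"
  have cA: "real (card ?A) = m" by (simp add: m_def)
  have cF: "real (card ?F) = m ^ card J" using insert by (simp add: card_fib m_def add.commute)
  have "(\<Sum>x\<in>fib R (insert k J) z. \<Sum>y\<in>fib R (insert k J) z. \<bar>f x - f y\<bar>)
    = (\<Sum>c\<in>?A. \<Sum>x\<in>?F. \<Sum>c'\<in>?A. \<Sum>y\<in>?F. \<bar>f (x(k := c)) - f (y(k := c'))\<bar>)"
    using insert(2) by (simp add: sum_fib_insert)
  also have "\<dots> \<le> (\<Sum>c\<in>?A. \<Sum>x\<in>?F. \<Sum>c'\<in>?A. \<Sum>y\<in>?F. \<bar>f (x(k := c)) - f (y(k := c))\<bar> + \<bar>f (y(k := c)) - f (y(k := c'))\<bar>)"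
    by (intro sum_mono) linarith
  also have "\<dots> = m * (\<Sum>c\<in>?A. \<Sum>x\<in>?F. \<Sum>y\<in>?F. \<bar>f (x(k := c)) - f (y(k := c))\<bar>)
     + m ^ card J * (\<Sum>c\<in>?A. \<Sum>c'\<in>?A. \<Sum>y\<in>?F. \<bar>f (y(k := c)) - f (y(k := c'))\<bar>)"
    by (simp add: sum.distrib sum_distrib_left cF m_def[symmetric])
  also have "\<dots> \<le> m * (\<Sum>c\<in>?A. m ^ (card J + 1) * (\<Sum>(i, x)\<in>fib_edges R J z. \<bar>fdiff f i (x(k := c))\<bar>))
     + m ^ card J * (\<Sum>c\<in>?A. \<Sum>c'\<in>?A. \<Sum>y\<in>?F. \<Sum>b\<in>{- int R..<int R}. \<bar>fdiff f k (y(k := b))\<bar>)"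
  proof (intro add_mono mult_left_mono sum_mono)
    fix c
    have "fdiff (\<lambda>x. f (x(k := c))) i x = fdiff f i (x(k := c))" if "i \<in> J" for i x
    proof -
      have "i \<noteq> k" using that insert(2) by auto
      then show ?thesis by (simp add: fdiff_def fun_upd_twist)
    qed
    then have "(\<Sum>(i, x)\<in>fib_edges R J z. \<bar>fdiff (\<lambda>x. f (x(k := c))) i x\<bar>) = (\<Sum>(i, x)\<in>fib_edges R J z. \<bar>fdiff f i (x(k := c))\<bar>)"
      by (intro sum.cong) (auto simp: fib_edges_def)
    then show "(\<Sum>x\<in>?F. \<Sum>y\<in>?F. \<bar>f (x(k := c)) - f (y(k := c))\<bar>) \<le> m ^ (card J + 1) * (\<Sum>(i, x)\<in>fib_edges R J z. \<bar>fdiff f i (x(k := c))\<bar>)"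
      using insert.IH[of "\<lambda>x. f (x(k := c))"] by (simp add: m_def)
  next
    fix c c' y assume "c \<in> ?A" "c' \<in> ?A"
    then show "\<bar>f (y(k := c)) - f (y(k := c'))\<bar> \<le> (\<Sum>b\<in>{- int R..<int R}. \<bar>fdiff f k (y(k := b))\<bar>)"
      using abs_diff_le_variation[of c' "- int R" "int R" c "\<lambda>c. f (y(k := c))"] by simp
  qed (auto simp: m_def)
  also have "\<dots> = m ^ (card J + 2) * ((\<Sum>c\<in>?A. \<Sum>(i, x)\<in>fib_edges R J z. \<bar>fdiff f i (x(k := c))\<bar>)
      + (\<Sum>y\<in>?F. \<Sum>b\<in>{- int R..<int R}. \<bar>fdiff f k (y(k := b))\<bar>))"
    using cA by (simp add: sum_distrib_left[symmetric] power_add power2_eq_square algebra_simps)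
  also have "\<dots> = m ^ (card J + 2) * (\<Sum>(i, x)\<in>fib_edges R (insert k J) z. \<bar>fdiff f i x\<bar>)"
    using insert by (subst sum_fib_edges_insert) auto
  finally show ?case using insert by (simp add: m_def)
qed

text \<open>For \<open>y\<close> in \<open>Z\<close> one has
  \<open>\<bar>w x\<bar> = \<bar>w x - w y\<bar>\<close>, and averaging over these \<open>y\<close>
  leads to pair differences. A zero set of positive density takes the place of subtracting the
  mean.\<close>

lemma Poincare_L1:
  fixes \<zeta> :: real
  assumes "finite I" "Z \<subseteq> fib R I z" "\<And>x. x \<in> Z \<Longrightarrow> w x = 0" "\<zeta> > 0"
    and "\<zeta> * (2 * real R + 1) ^ card I \<le> real (card Z)"
  shows "\<zeta> * (\<Sum>x\<in>fib R I z. \<bar>w x\<bar>) \<le> (2 * real R + 1) * (\<Sum>(k, x)\<in>fib_edges R I z. \<bar>fdiff w k x\<bar>)"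
proof -
  define M where "M = (2 * real R + 1) ^ card I"
  have M: "M > 0" by (simp add: M_def)
  have "(\<zeta> * M) * (\<Sum>x\<in>fib R I z. \<bar>w x\<bar>) \<le> real (card Z) * (\<Sum>x\<in>fib R I z. \<bar>w x\<bar>)"
    using assms by (intro mult_right_mono) (auto simp: M_def intro: sum_nonneg)
  also have "\<dots> = (\<Sum>x\<in>fib R I z. \<Sum>y\<in>Z. \<bar>w x - w y\<bar>)"
    using assms by (simp add: sum_distrib_left)
  also have "\<dots> \<le> (\<Sum>x\<in>fib R I z. \<Sum>y\<in>fib R I z. \<bar>w x - w y\<bar>)"
    using assms by (intro sum_mono sum_mono2) (auto simp: finite_fib)
  also have "\<dots> \<le> M * ((2 * real R + 1) * (\<Sum>(k, x)\<in>fib_edges R I z. \<bar>fdiff w k x\<bar>))"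
    using fib_pair_diff[OF assms(1), where R = R and z = z and f = w] by (simp add: M_def algebra_simps)
  finally have "M * (\<zeta> * (\<Sum>x\<in>fib R I z. \<bar>w x\<bar>)) \<le> M * ((2 * real R + 1) * (\<Sum>(k, x)\<in>fib_edges R I z. \<bar>fdiff w k x\<bar>))"
    by (simp add: algebra_simps)
  then show ?thesis using M by simp
qed

text \<open>\<open>f x\<close> exceeds any value on its line by at most the variation along the
  line; average over these values.\<close>

lemma line_bound:
  fixes f :: "('d \<Rightarrow> int) \<Rightarrow> real"
  assumes "\<bar>x k\<bar> \<le> int R"
  shows "f x \<le> (\<Sum>c\<in>{- int R..<int R}. \<bar>fdiff f k (x(k := c))\<bar>) + (\<Sum>c\<in>{- int R..int R}. f (x(k := c))) / (2 * real R + 1)"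
proof -
  define V where "V = (\<Sum>c\<in>{- int R..<int R}. \<bar>fdiff f k (x(k := c))\<bar>)"
  have "f x \<le> V + f (x(k := c))" if "c \<in> {- int R..int R}" for c
    using abs_diff_le_variation[of c "- int R" "int R" "x k" "\<lambda>c. f (x(k := c))"] that assms
    by (auto simp: V_def abs_le_iff)
  then have "(\<Sum>c\<in>{- int R..int R}. f x) \<le> (\<Sum>c\<in>{- int R..int R}. V + f (x(k := c)))"
    by (rule sum_mono)
  then have "(f x - V) * (2 * real R + 1) \<le> (\<Sum>c\<in>{- int R..int R}. f (x(k := c)))"
    by (simp add: sum.distrib algebra_simps)
  then have "f x - V \<le> (\<Sum>c\<in>{- int R..int R}. f (x(k := c))) / (2 * real R + 1)"
    by (subst pos_le_divide_eq) auto
  then show ?thesis by (simp add: V_def)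
qed

text \<open>The power of \<open>f x\<close> is a product of one factor for each direction, and the
  factor for \<open>k\<close> is bounded by a quantity \<open>g k\<close> of the line through
  \<open>x\<close>, hence independent of \<open>x k\<close>: the input of Loomis-Whitney. The
  averages in \<open>g k\<close> appear because \<open>f\<close> need not vanish at the boundary of
  the box.\<close>

lemma Gagliardo_Nirenberg:
  assumes I: "finite I" "card I \<ge> 2" and f: "\<And>x. f x \<ge> 0"
  shows "(\<Sum>x\<in>fib R I z. f x powr (card I / (card I - 1)))
    \<le> ((\<Sum>(k, x)\<in>fib_edges R I z. \<bar>fdiff f k x\<bar>) + (\<Sum>x\<in>fib R I z. f x) / (2 * real R + 1)) powr (card I / (card I - 1))"
    (is "_ \<le> ?H powr _")
proof -
  define D where "D = card I"
  define g where "g k x = (\<Sum>c\<in>{- int R..<int R}. \<bar>fdiff f k (x(k := c))\<bar>) + (\<Sum>c\<in>{- int R..int R}. f (x(k := c))) / (2 * real R + 1)" for k x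
  have g0: "g k x \<ge> 0" for k x unfolding g_def using f by (auto intro!: add_nonneg_nonneg sum_nonneg divide_nonneg_nonneg)
  have Hk: "(\<Sum>x\<in>fib R (I - {k}) z. g k x) \<le> ?H" if "k \<in> I" for k
  proof -
    have "(\<Sum>x\<in>fib R (I - {k}) z. g k x) = (\<Sum>x | x \<in> fib R I z \<and> x k < int R. \<bar>fdiff f k x\<bar>) + (\<Sum>x\<in>fib R I z. f x) / (2 * real R + 1)"
      unfolding g_def sum.distrib sum_divide_distrib[symmetric]
      using I that sum.swap[of "\<lambda>x c. f (x(k := c))" "{- int R..int R}" "fib R (I - {k}) z"]
      by (simp only: sum_fib_edges_line sum_fib_remove[OF that])
    also have "(\<Sum>x | x \<in> fib R I z \<and> x k < int R. \<bar>fdiff f k x\<bar>) \<le> (\<Sum>(k, x)\<in>fib_edges R I z. \<bar>fdiff f k x\<bar>)"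
      using I that by (simp add: sum_fib_edges) (intro member_le_sum, auto intro: sum_nonneg)
    finally show ?thesis by simp
  qed
  have pw: "y powr (D / (D - 1)) = (\<Prod>k\<in>I. y powr (1 / (D - 1)))" if "y \<ge> 0" for y :: real
    using that I by (cases "y = 0") (auto simp: D_def powr_powr simp flip: powr_realpow)
  have "(\<Sum>x\<in>fib R I z. f x powr (D / (D - 1))) = (\<Sum>x\<in>fib R I z. \<Prod>k\<in>I. f x powr (1 / (D - 1)))"
    by (intro sum.cong refl pw f)
  also have "\<dots> \<le> (\<Sum>x\<in>fib R I z. \<Prod>k\<in>I. g k x powr (1 / (D - 1)))"
    using f I line_bound[of _ _ R f, folded g_def]
    by (intro sum_mono prod_mono conjI powr_mono2) (auto simp: fib_def)
  also have "\<dots> \<le> (\<Prod>k\<in>I. (\<Sum>x\<in>fib R (I - {k}) z. g k x) powr (1 / (D - 1)))"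
    unfolding D_def using I g0 by (intro Loomis_Whitney) (auto simp: g_def)
  also have "\<dots> \<le> (\<Prod>k\<in>I. ?H powr (1 / (D - 1)))"
    using I Hk g0 by (intro prod_mono conjI powr_mono2) (auto intro: sum_nonneg)
  also have "\<dots> = ?H powr (D / (D - 1))"
    using f by (subst pw) (auto intro!: add_nonneg_nonneg sum_nonneg divide_nonneg_nonneg)
  finally show ?thesis by (simp add: D_def)
qed

lemma sum_fib_shift_le:
  assumes "finite I" "k \<in> I" "\<And>x. G x \<ge> (0::real)"
  shows "(\<Sum>x | x \<in> fib R I z \<and> x k < int R. G (x(k := x k + 1))) \<le> (\<Sum>x\<in>fib R I z. G x)"
proof -
  let ?h = "\<lambda>x. x(k := x k + 1)"
  have inj: "inj_on ?h {x \<in> fib R I z. x k < int R}"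
    by (rule inj_on_inverseI[where g = "\<lambda>x. x(k := x k - 1)"]) (auto simp: fun_eq_iff)
  have "(\<Sum>x | x \<in> fib R I z \<and> x k < int R. G (?h x)) = (\<Sum>x\<in>?h ` {x \<in> fib R I z. x k < int R}. G x)"
    using sum.reindex[OF inj, of G] by simp
  also have "\<dots> \<le> (\<Sum>x\<in>fib R I z. G x)"
  proof (intro sum_mono2 finite_fib assms)
    show "?h ` {x \<in> fib R I z. x k < int R} \<subseteq> fib R I z"
    proof clarify
      fix x assume x: "x \<in> fib R I z" "x k < int R"
      then have "\<bar>x k\<bar> \<le> int R" using assms(2) by (auto simp: fib_def)
      with x show "?h x \<in> fib R I z" using assms(2) by (auto simp: fib_def)
    qed
  qed
  finally show ?thesis .
qed

text \<open>Chain rule and Hoelder. The relation between \<open>\<tau>\<close> and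
  \<open>\<gamma>\<close> says that the conjugate exponent of \<open>s\<close> turns
  \<open>f powr (\<gamma> - 1)\<close> into \<open>f powr \<tau>\<close>. Poincare takes
  \<open>\<gamma> = \<tau> = s\<close>, Sobolev takes \<open>\<tau> = t\<close>.\<close>

lemma sum_fdiff_powr_le:
  fixes s \<gamma> \<tau> :: real
  assumes I: "finite I" and f: "\<And>x. f x \<ge> (0::real)" and s: "s > 1" and g: "\<gamma> > 1"
    and tau: "\<tau> * (1 - 1 / s) = \<gamma> - 1"
  shows "(\<Sum>(k, x)\<in>fib_edges R I z. \<bar>fdiff (\<lambda>x. f x powr \<gamma>) k x\<bar>)
    \<le> 2 * \<gamma> * (\<Sum>(k, x)\<in>fib_edges R I z. \<bar>fdiff f k x\<bar> powr s) powr (1 / s)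
        * (card I * (\<Sum>x\<in>fib R I z. f x powr \<tau>)) powr (1 - 1 / s)"
proof -
  let ?E = "fib_edges R I z" and ?T = "card I * (\<Sum>x\<in>fib R I z. f x powr \<tau>)"
  let ?up = "\<lambda>k x. x(k := x k + 1)"
  define s' where "s' = 1 / (1 - 1 / s)"
  have s': "1 / s + 1 / s' = 1" "1 / s' = 1 - 1 / s" using s by (auto simp: s'_def)
  have pt: "(y powr (\<gamma> - 1)) powr s' = y powr \<tau>" for y
    using s by (simp add: powr_powr s'_def flip: tau)
  have b1: "(\<Sum>(k, x)\<in>?E. f x powr \<tau>) \<le> ?T"
  proof -
    have "(\<Sum>(k, x)\<in>?E. f x powr \<tau>) \<le> (\<Sum>k\<in>I. \<Sum>x\<in>fib R I z. f x powr \<tau>)"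
      unfolding sum_fib_edges[OF I] by (intro sum_mono sum_mono2) (auto simp: I finite_fib)
    then show ?thesis by simp
  qed
  have b2: "(\<Sum>(k, x)\<in>?E. f (?up k x) powr \<tau>) \<le> ?T"
  proof -
    have "(\<Sum>(k, x)\<in>?E. f (?up k x) powr \<tau>) \<le> (\<Sum>k\<in>I. \<Sum>x\<in>fib R I z. f x powr \<tau>)"
      unfolding sum_fib_edges[OF I] by (intro sum_mono sum_fib_shift_le[where G = "\<lambda>x. f x powr \<tau>"]) (auto simp: I)
    then show ?thesis by simp
  qed
  have H: "(\<Sum>(k, x)\<in>?E. \<bar>fdiff f k x\<bar> * h k x powr (\<gamma> - 1))
     \<le> (\<Sum>(k, x)\<in>?E. \<bar>fdiff f k x\<bar> powr s) powr (1 / s) * ?T powr (1 - 1 / s)"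
    if h: "(\<Sum>(k, x)\<in>?E. h k x powr \<tau>) \<le> ?T" for h
  proof -
    have "(\<Sum>(k, x)\<in>?E. \<bar>fdiff f k x\<bar> * h k x powr (\<gamma> - 1))
      \<le> (\<Sum>(k, x)\<in>?E. \<bar>fdiff f k x\<bar> powr s) powr (1 / s) * (\<Sum>(k, x)\<in>?E. (h k x powr (\<gamma> - 1)) powr s') powr (1 / s')"
      unfolding case_prod_beta using s s' by (intro sum_Holder) auto
    also have "\<dots> \<le> (\<Sum>(k, x)\<in>?E. \<bar>fdiff f k x\<bar> powr s) powr (1 / s) * ?T powr (1 - 1 / s)"
      unfolding pt s'(2) using h s by (intro mult_left_mono powr_mono2) (auto intro!: sum_nonneg)
    finally show ?thesis .
  qed
  have "(\<Sum>(k, x)\<in>?E. \<bar>fdiff (\<lambda>x. f x powr \<gamma>) k x\<bar>)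
    \<le> (\<Sum>(k, x)\<in>?E. \<gamma> * (\<bar>fdiff f k x\<bar> * f x powr (\<gamma> - 1)) + \<gamma> * (\<bar>fdiff f k x\<bar> * f (?up k x) powr (\<gamma> - 1)))"
  proof (intro sum_mono, clarify)
    fix k x
    show "\<bar>fdiff (\<lambda>x. f x powr \<gamma>) k x\<bar> \<le> \<gamma> * (\<bar>fdiff f k x\<bar> * f x powr (\<gamma> - 1)) + \<gamma> * (\<bar>fdiff f k x\<bar> * f (?up k x) powr (\<gamma> - 1))"
      using powr_diff_le[of "f x" "f (?up k x)" \<gamma>] f g by (simp add: fdiff_def algebra_simps)
  qed
  also have "\<dots> = \<gamma> * (\<Sum>(k, x)\<in>?E. \<bar>fdiff f k x\<bar> * f x powr (\<gamma> - 1)) + \<gamma> * (\<Sum>(k, x)\<in>?E. \<bar>fdiff f k x\<bar> * f (?up k x) powr (\<gamma> - 1))"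
    by (simp add: sum.distrib sum_distrib_left case_prod_beta)
  also have "\<dots> \<le> \<gamma> * ((\<Sum>(k, x)\<in>?E. \<bar>fdiff f k x\<bar> powr s) powr (1 / s) * ?T powr (1 - 1 / s))
     + \<gamma> * ((\<Sum>(k, x)\<in>?E. \<bar>fdiff f k x\<bar> powr s) powr (1 / s) * ?T powr (1 - 1 / s))"
    using g H[OF b1] H[OF b2] by (intro add_mono mult_left_mono) auto
  finally show ?thesis by (simp add: algebra_simps)
qed

text \<open>This is \<open>Poincare_L1\<close> for \<open>w powr s\<close>: the gradient of the
  power brings back a factor \<open>T powr (1 - 1 / s)\<close>, which is cancelled against the
  left-hand side.\<close>

lemma Poincare_powr:
  fixes s :: real
  assumes I: "finite I" "I \<noteq> {}" and w: "\<And>x. w x \<ge> (0::real)" and s: "s > 1"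
    and Z: "Z \<subseteq> fib R I z" "\<And>x. x \<in> Z \<Longrightarrow> w x = 0" "\<zeta> > 0"
    "\<zeta> * (2 * real R + 1) ^ card I \<le> real (card Z)"
  shows "(\<Sum>x\<in>fib R I z. w x powr s)
    \<le> (2 * s * card I / \<zeta> * (2 * real R + 1)) powr s * (\<Sum>(k, x)\<in>fib_edges R I z. \<bar>fdiff w k x\<bar> powr s)"
proof -
  define T where "T = (\<Sum>x\<in>fib R I z. w x powr s)"
  define G where "G = (\<Sum>(k, x)\<in>fib_edges R I z. \<bar>fdiff w k x\<bar> powr s)"
  define m where "m = (2 * real R + 1)"
  define K where "K = 2 * s * card I / \<zeta> * m"
  have T0: "T \<ge> 0" "G \<ge> 0" "K \<ge> 0" "card I \<ge> 1"
    using I Z s by (auto simp: T_def G_def K_def m_def Suc_le_eq card_gt_0_iff intro!: sum_nonneg mult_nonneg_nonneg divide_nonneg_nonneg)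
  have c: "real (card I) powr (1 - 1 / s) \<le> card I"
    using T0 s powr_mono[of "1 - 1 / s" 1 "card I"] by simp
  have "\<zeta> * T \<le> m * (\<Sum>(k, x)\<in>fib_edges R I z. \<bar>fdiff (\<lambda>x. w x powr s) k x\<bar>)"
    using Poincare_L1[OF I(1) Z(1), of "\<lambda>x. w x powr s" \<zeta>] Z by (simp add: T_def m_def)
  also have "\<dots> \<le> m * (2 * s * G powr (1 / s) * (card I * T) powr (1 - 1 / s))"
    unfolding G_def T_def m_def using s I w
    by (intro mult_left_mono sum_fdiff_powr_le) (auto simp: field_simps)
  also have "\<dots> = m * (2 * s * G powr (1 / s) * (card I powr (1 - 1 / s) * T powr (1 - 1 / s)))"
    by (simp add: powr_mult)
  also have "\<dots> \<le> m * (2 * s * G powr (1 / s) * (card I * T powr (1 - 1 / s)))"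
    using c s by (intro mult_left_mono mult_right_mono) (auto simp: m_def)
  finally have "T \<le> K * G powr (1 / s) * T powr (1 - 1 / s)"
    using Z(3) by (simp add: K_def field_simps)
  moreover have "T = T powr (1 / s) * T powr (1 - 1 / s)"
    using T0 by (simp flip: powr_add)
  ultimately have "T powr (1 / s) * T powr (1 - 1 / s) \<le> (K * G powr (1 / s)) * T powr (1 - 1 / s)" by simp
  then have "T powr (1 / s) \<le> K * G powr (1 / s)"
    using T0 by (cases "T = 0") (auto simp: mult_le_cancel_right)
  then have "(T powr (1 / s)) powr s \<le> (K * G powr (1 / s)) powr s"
    using s by (intro powr_mono2) auto
  then have "T \<le> K powr s * G" using T0 s by (simp add: powr_powr powr_mult)
  then show ?thesis by (simp add: T_def G_def K_def m_def)
qed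

text \<open>Gagliardo-Nirenberg for \<open>w powr \<gamma>\<close>, with \<open>\<gamma>\<close>
  such that its left-hand side is \<open>T\<close>, the sum of \<open>w powr t\<close>. Both terms
  on the right then carry \<open>T powr (1 - 1 / s)\<close>, and cancelling it leaves
  \<open>T powr (1 / t)\<close>.\<close>

lemma Sobolev:
  fixes s t :: real
  assumes I: "finite I" "card I \<ge> 2" and w: "\<And>x. w x \<ge> (0::real)" and s: "s > 1"
    and t: "t > 0" "1 / t = 1 / s - 1 / card I"
  shows "(\<Sum>x\<in>fib R I z. w x powr t) powr (1 / t)
    \<le> (2 * t * card I + 1) * ((\<Sum>(k, x)\<in>fib_edges R I z. \<bar>fdiff w k x\<bar> powr s) + (\<Sum>x\<in>fib R I z. (w x / (2 * real R + 1)) powr s)) powr (1 / s)"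
proof -
  define T where "T = (\<Sum>x\<in>fib R I z. w x powr t)"
  define G1 where "G1 = (\<Sum>(k, x)\<in>fib_edges R I z. \<bar>fdiff w k x\<bar> powr s)"
  define G2 where "G2 = (\<Sum>x\<in>fib R I z. (w x / (2 * real R + 1)) powr s)"
  define D where "D = real (card I)"
  define \<gamma> where "\<gamma> = t * (1 - 1 / D)"
  have D: "D \<ge> 2" using I by (simp add: D_def)
  have t1: "1 / t = 1 / s - 1 / D" using t(2) by (simp add: D_def)
  have "1 - 1 / D = (1 - 1 / s) + 1 / t" using t1 by simp
  then have "\<gamma> = t * (1 - 1 / s) + t * (1 / t)" unfolding \<gamma>_def by (simp only: distrib_left)
  then have gt: "t * (1 - 1 / s) = \<gamma> - 1" using t(1) by simp
  have "t * (1 - 1 / s) > 0" using t s by simp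
  then have g1: "\<gamma> > 1" using gt by simp
  have "t * (1 - 1 / D) \<le> t * 1" using t D by (intro mult_left_mono) auto
  then have gle: "\<gamma> \<le> t" by (simp add: \<gamma>_def)
  have nn: "T \<ge> 0" "G1 \<ge> 0" "G2 \<ge> 0" by (auto simp: T_def G1_def G2_def intro!: sum_nonneg)
  have gD: "\<gamma> * (D / (D - 1)) = t" using D by (simp add: \<gamma>_def field_simps)
  have cr: "real (card I - 1) = D - 1" using I by (simp add: D_def of_nat_diff)
  let ?A = "\<Sum>(k, x)\<in>fib_edges R I z. \<bar>fdiff (\<lambda>x. w x powr \<gamma>) k x\<bar>"
  let ?B = "(\<Sum>x\<in>fib R I z. w x powr \<gamma>) / (2 * real R + 1)"
  have AB: "?A \<ge> 0" "?B \<ge> 0" by (auto intro!: sum_nonneg divide_nonneg_nonneg)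
  have "T \<le> (?A + ?B) powr (D / (D - 1))"
    using Gagliardo_Nirenberg[OF I, of "\<lambda>x. w x powr \<gamma>" R z]
    unfolding cr D_def[symmetric] powr_powr gD T_def by simp
  then have "T powr ((D - 1) / D) \<le> ((?A + ?B) powr (D / (D - 1))) powr ((D - 1) / D)"
    using D nn by (intro powr_mono2) auto
  then have 1: "T powr (1 - 1 / D) \<le> ?A + ?B" using D AB by (simp add: powr_powr field_simps)
  have "D powr (1 - 1 / s) \<le> D" using D s powr_mono[of "1 - 1 / s" 1 D] by simp
  then have DT: "(D * T) powr (1 - 1 / s) \<le> D * T powr (1 - 1 / s)"
    by (simp add: powr_mult mult_right_mono)
  have "?A \<le> 2 * \<gamma> * G1 powr (1 / s) * (D * T) powr (1 - 1 / s)"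
    unfolding G1_def T_def D_def using I w s g1 gt by (intro sum_fdiff_powr_le) auto
  also have "\<dots> \<le> 2 * t * (G1 + G2) powr (1 / s) * (D * T powr (1 - 1 / s))"
    using gle nn s t g1 DT by (intro mult_mono powr_mono2) auto
  finally have A: "?A \<le> 2 * t * D * (G1 + G2) powr (1 / s) * T powr (1 - 1 / s)" by (simp add: algebra_simps)
  have "?B = (\<Sum>x\<in>fib R I z. (w x / (2 * real R + 1)) * w x powr (\<gamma> - 1))"
    using w by (simp add: sum_divide_distrib powr_mult_base)
  also have "\<dots> \<le> G2 powr (1 / s) * (\<Sum>x\<in>fib R I z. (w x powr (\<gamma> - 1)) powr (1 / (1 - 1 / s))) powr (1 / (1 / (1 - 1 / s)))"
    unfolding G2_def using s w by (intro sum_Holder) auto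
  also have "\<dots> = G2 powr (1 / s) * T powr (1 - 1 / s)"
    using s by (simp add: T_def powr_powr flip: gt)
  also have "\<dots> \<le> (G1 + G2) powr (1 / s) * T powr (1 - 1 / s)"
    using nn s by (intro mult_right_mono powr_mono2) auto
  finally have B: "?B \<le> (G1 + G2) powr (1 / s) * T powr (1 - 1 / s)" .
  have "T powr (1 / t) * T powr (1 - 1 / s) \<le> ((2 * t * D + 1) * (G1 + G2) powr (1 / s)) * T powr (1 - 1 / s)"
    using 1 A B by (simp add: t1 algebra_simps flip: powr_add)
  then have "T powr (1 / t) \<le> (2 * t * D + 1) * (G1 + G2) powr (1 / s)"
    using nn t D by (cases "T = 0") (auto simp: mult_le_cancel_right)
  then show ?thesis by (simp add: T_def G1_def G2_def D_def)
qed

section \<open>Energy estimates\<close>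

definition cube :: "nat \<Rightarrow> ('d \<Rightarrow> int) set" where
  "cube R = {x. \<forall>i. \<bar>x i\<bar> \<le> int R}"

definition edges :: "nat \<Rightarrow> ('d \<times> ('d \<Rightarrow> int)) set" where
  "edges R = (SIGMA k:UNIV. {x \<in> cube R. x k < int R})"

text \<open>Each bond carries one coefficient, stored at its lower endpoint. The symmetry of the
  conductances is thereby built in.\<close>

definition gen :: "('d \<Rightarrow> ('d \<Rightarrow> int) \<Rightarrow> real) \<Rightarrow> (('d::finite \<Rightarrow> int) \<Rightarrow> real) \<Rightarrow> ('d \<Rightarrow> int) \<Rightarrow> real" where
  "gen a w x = (\<Sum>k\<in>UNIV. a k x * (w (x(k := x k + 1)) - w x) + a k (x(k := x k - 1)) * (w (x(k := x k - 1)) - w x))"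

lemma fib_UNIV: "fib R UNIV z = cube R"
  by (auto simp: fib_def cube_def)

lemma fib_edges_UNIV: "fib_edges R UNIV z = edges R"
  by (simp add: fib_edges_def edges_def fib_UNIV)

lemma finite_cube [simp]: "finite (cube R :: ('d::finite \<Rightarrow> int) set)"
  using finite_fib[of "UNIV :: 'd set" R] by (simp add: fib_UNIV)

lemma finite_edges [simp]: "finite (edges R :: ('d::finite \<times> ('d \<Rightarrow> int)) set)"
  using finite_fib_edges[of "UNIV :: 'd set" R] by (simp add: fib_edges_UNIV)

lemma card_cube: "card (cube R :: ('d::finite \<Rightarrow> int) set) = (2 * R + 1) ^ CARD('d)"
  using card_fib[of "UNIV :: 'd set" R] by (simp add: fib_UNIV)

lemma cube_mono: "R \<le> S \<Longrightarrow> cube R \<subseteq> cube S"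
  unfolding cube_def by (auto dest: spec intro: order_trans)

lemma edges_mono: "R \<le> S \<Longrightarrow> edges R \<subseteq> edges S"
  using cube_mono[of R S] by (fastforce simp: edges_def)

lemma sum_edges:
  "(\<Sum>(k, x)\<in>edges R. F k x) = (\<Sum>k\<in>(UNIV :: 'd::finite set). \<Sum>x | x \<in> cube R \<and> x k < int R. F k x)"
  unfolding edges_def by (subst sum.Sigma) auto

lemma edge_ends: "(k, x) \<in> edges R \<Longrightarrow> x \<in> cube R \<and> x(k := x k + 1) \<in> cube R"
  by (auto simp: edges_def cube_def) (smt (verit))+

text \<open>Every bond contributes to both of its endpoints; the contribution of the upper one is
  moved by a shift. Bonds that leave the cube are harmless because \<open>\<psi>\<close> vanishes on
  its faces.\<close>

lemma sum_by_parts: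
  fixes \<psi> :: "('d::finite \<Rightarrow> int) \<Rightarrow> real"
  assumes \<psi>: "\<And>x i. x \<in> cube R \<Longrightarrow> \<bar>x i\<bar> = int R \<Longrightarrow> \<psi> x = 0"
  shows "(\<Sum>(k, x)\<in>edges R. a k x * fdiff \<psi> k x * fdiff w k x) = - (\<Sum>x\<in>cube R. \<psi> x * gen a w x)"
proof -
  have 1: "(\<Sum>x | x \<in> cube R \<and> x k < int R. a k x * \<psi> (x(k := x k + 1)) * fdiff w k x)
    = - (\<Sum>x\<in>cube R. \<psi> x * (a k (x(k := x k - 1)) * (w (x(k := x k - 1)) - w x)))" for k
  proof -
    have "(\<Sum>x | x \<in> cube R \<and> x k < int R. a k x * \<psi> (x(k := x k + 1)) * fdiff w k x)
      = (\<Sum>x | x \<in> cube R \<and> - int R < x k. - (\<psi> x * (a k (x(k := x k - 1)) * (w (x(k := x k - 1)) - w x))))"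
      by (rule sum.reindex_bij_witness[where i = "\<lambda>x. x(k := x k - 1)" and j = "\<lambda>x. x(k := x k + 1)"])
        (auto simp: cube_def fdiff_def algebra_simps, (smt (verit))+)
    also have "\<dots> = (\<Sum>x\<in>cube R. - (\<psi> x * (a k (x(k := x k - 1)) * (w (x(k := x k - 1)) - w x))))"
    proof (intro sum.mono_neutral_left ballI)
      fix x assume "x \<in> cube R - {x \<in> cube R. - int R < x k}"
      then have "x \<in> cube R" "\<bar>x k\<bar> \<le> int R" "x k \<le> - int R" by (auto simp: cube_def)
      then have "x \<in> cube R" "\<bar>x k\<bar> = int R" by auto
      then show "- (\<psi> x * (a k (x(k := x k - 1)) * (w (x(k := x k - 1)) - w x))) = 0" using \<psi> by simp
    qed auto
    finally show ?thesis by (simp add: sum_negf)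
  qed
  have 2: "(\<Sum>x | x \<in> cube R \<and> x k < int R. a k x * \<psi> x * fdiff w k x)
    = (\<Sum>x\<in>cube R. \<psi> x * (a k x * (w (x(k := x k + 1)) - w x)))" for k
  proof -
    have "(\<Sum>x | x \<in> cube R \<and> x k < int R. a k x * \<psi> x * fdiff w k x) = (\<Sum>x\<in>cube R. a k x * \<psi> x * fdiff w k x)"
    proof (intro sum.mono_neutral_left ballI)
      fix x assume "x \<in> cube R - {x \<in> cube R. x k < int R}"
      then have "x \<in> cube R" "\<bar>x k\<bar> \<le> int R" "x k \<ge> int R" by (auto simp: cube_def)
      then have "x \<in> cube R" "\<bar>x k\<bar> = int R" by auto
      then show "a k x * \<psi> x * fdiff w k x = 0" using \<psi> by simp
    qed auto
    then show ?thesis by (simp add: fdiff_def algebra_simps)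
  qed
  have "(\<Sum>(k, x)\<in>edges R. a k x * fdiff \<psi> k x * fdiff w k x)
    = (\<Sum>k\<in>UNIV. (\<Sum>x | x \<in> cube R \<and> x k < int R. a k x * \<psi> (x(k := x k + 1)) * fdiff w k x)
        - (\<Sum>x | x \<in> cube R \<and> x k < int R. a k x * \<psi> x * fdiff w k x))"
    unfolding sum_edges sum_subtractf[symmetric]
    by (intro sum.cong refl) (simp add: fdiff_def[of \<psi>] algebra_simps)
  also have "\<dots> = (\<Sum>k\<in>UNIV. - (\<Sum>x\<in>cube R. \<psi> x * (a k x * (w (x(k := x k + 1)) - w x) + a k (x(k := x k - 1)) * (w (x(k := x k - 1)) - w x))))"
  proof (intro sum.cong refl)
    fix k
    show "(\<Sum>x | x \<in> cube R \<and> x k < int R. a k x * \<psi> (x(k := x k + 1)) * fdiff w k x)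
        - (\<Sum>x | x \<in> cube R \<and> x k < int R. a k x * \<psi> x * fdiff w k x)
      = - (\<Sum>x\<in>cube R. \<psi> x * (a k x * (w (x(k := x k + 1)) - w x) + a k (x(k := x k - 1)) * (w (x(k := x k - 1)) - w x)))"
      unfolding 1 2 distrib_left sum.distrib by linarith
  qed
  also have "\<dots> = - (\<Sum>x\<in>cube R. \<psi> x * gen a w x)"
    unfolding gen_def sum_distrib_left sum_negf by (subst sum.swap) simp
  finally show ?thesis .
qed

section \<open>Radial structure of bonds with respect to the sup norm\<close>

definition outward :: "'d \<Rightarrow> ('d \<Rightarrow> int) \<Rightarrow> 'd \<Rightarrow> int" where
  "outward k x = (if x k \<ge> 0 then x(k := x k + 1) else x)"

definition inward :: "'d \<Rightarrow> ('d \<Rightarrow> int) \<Rightarrow> 'd \<Rightarrow> int" where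
  "inward k x = (if x k \<ge> 0 then x else x(k := x k + 1))"

text \<open>The absolute value of the coordinate \<open>k\<close> at the outer endpoint: in
  direction \<open>k\<close> the bond crosses from \<open>rad k x - 1\<close> to
  \<open>rad k x\<close>. It is at least 1, also for the bond from -1 to 0, whose outer endpoint is
  at -1.\<close>

definition rad :: "'d \<Rightarrow> ('d \<Rightarrow> int) \<Rightarrow> int" where
  "rad k x = (if x k \<ge> 0 then x k + 1 else - x k)"

definition supnorm :: "('d::finite \<Rightarrow> int) \<Rightarrow> int" where
  "supnorm x = Max (range (\<lambda>i. \<bar>x i\<bar>))"

lemma supnorm_le_iff: "supnorm x \<le> b \<longleftrightarrow> (\<forall>i. \<bar>x i\<bar> \<le> b)"
  unfolding supnorm_def by (subst Max_le_iff) auto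

lemma abs_le_supnorm: "\<bar>x i\<bar> \<le> supnorm x"
  using supnorm_le_iff[of x "supnorm x"] by simp

lemma supnorm_attained: "\<exists>i. supnorm x = \<bar>x i\<bar>"
proof -
  have "supnorm x \<in> range (\<lambda>i. \<bar>x i\<bar>)" unfolding supnorm_def by (rule Max_in) auto
  then show ?thesis by auto
qed

lemma cube_supnorm: "x \<in> cube R \<longleftrightarrow> supnorm x \<le> int R"
  by (simp add: cube_def supnorm_le_iff)

text \<open>Only the coordinate \<open>k\<close> changes along the bond, by one in absolute value;
  if the sup norms differ, the outer one is attained at \<open>k\<close>. So a radial cutoff either
  is constant on a bond or drops there as it does at \<open>rad k x\<close>.\<close>

lemma supnorm_inward_outward:
  "supnorm (inward k x) = supnorm (outward k x) \<or>
   supnorm (outward k x) = rad k x \<and> supnorm (inward k x) = rad k x - 1"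
proof -
  have k: "\<bar>outward k x k\<bar> = rad k x" "\<bar>inward k x k\<bar> = rad k x - 1" by (auto simp: outward_def inward_def rad_def)
  have i: "inward k x i = outward k x i" if "i \<noteq> k" for i using that by (auto simp: outward_def inward_def)
  have le: "supnorm (inward k x) \<le> supnorm (outward k x)"
    unfolding supnorm_le_iff
  proof
    fix i show "\<bar>inward k x i\<bar> \<le> supnorm (outward k x)"
      using abs_le_supnorm[of "outward k x" i] k i[of i] by (cases "i = k") auto
  qed
  obtain j where j: "supnorm (outward k x) = \<bar>outward k x j\<bar>" using supnorm_attained by blast
  note jle = abs_le_supnorm[of "inward k x"]
  show ?thesis
  proof (cases "supnorm (inward k x) = supnorm (outward k x)")
    case False
    with le jle[of j] j i[of j] have "j = k" by fastforce
    with j k jle[of k] le False show ?thesis by auto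
  qed simp
qed

lemma supnorm_outward_edge: "(k, x) \<in> edges R \<Longrightarrow> supnorm (outward k x) \<le> int R"
  using edge_ends[of k x R] by (auto simp: outward_def cube_supnorm)

text \<open>Only the value \<open>b\<close> at the endpoint with the smaller cutoff \<open>B\<close> enters the error term. Therefore one
  slice per layer suffices later on.\<close>

lemma Caccioppoli_pointwise:
  fixes A B a b :: real
  assumes "0 \<le> B" "B \<le> A"
  shows "(A^2 * a - B^2 * b) * (a - b) \<ge> A^2 * (a - b)^2 / 2 - 2 * (A - B)^2 * b^2"
proof -
  have eq: "(A^2 * a - B^2 * b) * (a - b) = A^2 * (a - b)^2 + (A - B) * (A + B) * b * (a - b)"
    by (simp add: power2_eq_square algebra_simps)
  have "\<bar>(A - B) * (A + B) * b * (a - b)\<bar> = (A + B) * (\<bar>(A - B) * b\<bar> * \<bar>a - b\<bar>)"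
    using assms by (simp add: abs_mult)
  also have "\<dots> \<le> (2 * A) * (\<bar>(A - B) * b\<bar> * \<bar>a - b\<bar>)"
    using assms by (intro mult_right_mono) auto
  also have "\<dots> = 2 * (A * \<bar>a - b\<bar>) * \<bar>(A - B) * b\<bar>" by simp
  also have "\<dots> \<le> (A * \<bar>a - b\<bar>)^2 / 2 + 2 * \<bar>(A - B) * b\<bar>^2"
    using sum_squares_bound[of "A * \<bar>a - b\<bar>" "2 * \<bar>(A - B) * b\<bar>"] by (simp add: power_mult_distrib)
  finally have "(A - B) * (A + B) * b * (a - b) \<ge> - (A^2 * (a - b)^2 / 2 + 2 * (A - B)^2 * b^2)"
    by (simp add: power_mult_distrib abs_le_iff)
  then show ?thesis unfolding eq by simp
qed

text \<open>The test function is the squared cutoff times \<open>w\<close>. In the error the drop of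
  the cutoff is taken at \<open>rad k x\<close> even on bonds where the sup norm stays constant.
  This overestimates the error, but the bonds of one layer then form complete slices of the cube, on
  which Sobolev is available.\<close>

lemma Caccioppoli:
  fixes a :: "'d::finite \<Rightarrow> ('d \<Rightarrow> int) \<Rightarrow> real" and \<phi> :: "int \<Rightarrow> real"
  assumes a: "\<And>k x. a k x \<ge> 0"
    and sub: "\<And>x. supnorm x < int R \<Longrightarrow> w x * gen a w x \<ge> 0"
    and \<phi>: "antimono \<phi>" "\<And>c. \<phi> c \<ge> 0" "\<phi> (int R) = 0"
  shows "(\<Sum>(k, x)\<in>edges R. a k x * (\<phi> (supnorm (inward k x)))^2 * (fdiff w k x)^2)
    \<le> 4 * (\<Sum>(k, x)\<in>edges R. a k x * (\<phi> (rad k x - 1) - \<phi> (rad k x))^2 * (w (outward k x))^2)"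
proof -
  define \<eta> where "\<eta> x = \<phi> (supnorm x)" for x :: "'d \<Rightarrow> int"
  define \<psi> where "\<psi> x = (\<eta> x)^2 * w x" for x
  have bd: "\<psi> x = 0" if "x \<in> cube R" "\<bar>x i\<bar> = int R" for x i
  proof -
    have "supnorm x \<ge> int R" using that(2) abs_le_supnorm[of x i] by simp
    then have "supnorm x = int R" using that(1) by (simp add: cube_supnorm)
    then show ?thesis using \<phi> by (simp add: \<psi>_def \<eta>_def)
  qed
  have "(\<Sum>(k, x)\<in>edges R. a k x * fdiff \<psi> k x * fdiff w k x) = - (\<Sum>x\<in>cube R. \<psi> x * gen a w x)"
    by (rule sum_by_parts) (rule bd)
  also have "\<dots> \<le> 0"
  proof -
    have "\<psi> x * gen a w x \<ge> 0" if "x \<in> cube R" for x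
    proof (cases "supnorm x < int R")
      case True
      show ?thesis unfolding \<psi>_def mult.assoc by (rule mult_nonneg_nonneg[OF _ sub[OF True]]) simp
    next
      case False
      then have "\<eta> x = 0" using that \<phi>(3) by (simp add: cube_supnorm \<eta>_def)
      then show ?thesis by (simp add: \<psi>_def)
    qed
    then show ?thesis by (simp add: sum_nonneg)
  qed
  finally have le0: "(\<Sum>(k, x)\<in>edges R. a k x * fdiff \<psi> k x * fdiff w k x) \<le> 0" .
  have pt: "a k x * fdiff \<psi> k x * fdiff w k x \<ge> a k x * (\<eta> (inward k x))^2 * (fdiff w k x)^2 / 2
     - 2 * (a k x * (\<phi> (rad k x - 1) - \<phi> (rad k x))^2 * (w (outward k x))^2)" for k x
  proof -
    have io: "\<eta> (outward k x) \<le> \<eta> (inward k x)"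
      using supnorm_inward_outward[of k x] \<phi>(1) by (auto simp: \<eta>_def antimono_def)
    have d: "(\<eta> (inward k x) - \<eta> (outward k x))^2 \<le> (\<phi> (rad k x - 1) - \<phi> (rad k x))^2"
      using supnorm_inward_outward[of k x] by (auto simp: \<eta>_def)
    have e0: "fdiff \<psi> k x * fdiff w k x = ((\<eta> (inward k x))^2 * w (inward k x) - (\<eta> (outward k x))^2 * w (outward k x)) * (w (inward k x) - w (outward k x))"
      and e1: "(fdiff w k x)^2 = (w (inward k x) - w (outward k x))^2"
      by (auto simp: fdiff_def \<psi>_def inward_def outward_def algebra_simps power2_eq_square)
    have "fdiff \<psi> k x * fdiff w k x \<ge> (\<eta> (inward k x))^2 * (fdiff w k x)^2 / 2 - 2 * (\<eta> (inward k x) - \<eta> (outward k x))^2 * (w (outward k x))^2"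
      unfolding e0 e1 using io \<phi> by (intro Caccioppoli_pointwise) (auto simp: \<eta>_def)
    moreover have "(\<eta> (inward k x) - \<eta> (outward k x))^2 * (w (outward k x))^2 \<le> (\<phi> (rad k x - 1) - \<phi> (rad k x))^2 * (w (outward k x))^2"
      using d by (intro mult_right_mono) auto
    ultimately have "fdiff \<psi> k x * fdiff w k x \<ge> (\<eta> (inward k x))^2 * (fdiff w k x)^2 / 2 - 2 * ((\<phi> (rad k x - 1) - \<phi> (rad k x))^2 * (w (outward k x))^2)"
      by linarith
    from mult_left_mono[OF this a[of k x]] show ?thesis by (simp add: algebra_simps)
  qed
  have "(\<Sum>(k, x)\<in>edges R. a k x * (\<eta> (inward k x))^2 * (fdiff w k x)^2) / 2
     - 2 * (\<Sum>(k, x)\<in>edges R. a k x * (\<phi> (rad k x - 1) - \<phi> (rad k x))^2 * (w (outward k x))^2)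
    = (\<Sum>(k, x)\<in>edges R. a k x * (\<eta> (inward k x))^2 * (fdiff w k x)^2 / 2
     - 2 * (a k x * (\<phi> (rad k x - 1) - \<phi> (rad k x))^2 * (w (outward k x))^2))"
    by (simp add: case_prod_beta sum_subtractf sum_divide_distrib sum_distrib_left)
  also have "\<dots> \<le> (\<Sum>(k, x)\<in>edges R. a k x * fdiff \<psi> k x * fdiff w k x)"
    by (intro sum_mono) (auto intro: pt)
  finally show ?thesis using le0 by (simp add: \<eta>_def)
qed

text \<open>The cutoff at \<open>c\<close> is the proportion of \<open>L\<close> that lies beyond
  \<open>c\<close>. It drops by \<open>1 / card L\<close> on the layers of \<open>L\<close> and is
  constant across all others, so only layers of \<open>L\<close> enter the error.\<close>

lemma Caccioppoli_layers:
  fixes a :: "'d::finite \<Rightarrow> ('d \<Rightarrow> int) \<Rightarrow> real"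
  assumes a: "\<And>k x. a k x \<ge> 0"
    and sub: "\<And>x. supnorm x < int R \<Longrightarrow> w x * gen a w x \<ge> 0"
    and L: "L \<subseteq> {int R'<..int R}" "L \<noteq> {}" and RR: "R' \<le> R"
  shows "(\<Sum>(k, x)\<in>edges R'. a k x * (fdiff w k x)^2)
    \<le> 4 / (real (card L))^2 * (\<Sum>(k, x) | (k, x) \<in> edges R \<and> rad k x \<in> L. a k x * (w (outward k x))^2)"
proof -
  define \<phi> where "\<phi> c = real (card (L \<inter> {c<..})) / real (card L)" for c
  have fL: "finite L" using L finite_subset by blast
  then have cL: "card L > 0" using L by (simp add: card_gt_0_iff)
  have am: "antimono \<phi>"
    unfolding \<phi>_def antimono_def using fL by (auto intro!: divide_right_mono card_mono)
  have "L \<inter> {int R<..} = {}" using L by auto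
  then have R0: "\<phi> (int R) = 0" by (simp add: \<phi>_def)
  have one: "\<phi> c = 1" if "c \<le> int R'" for c
  proof -
    have "L \<inter> {c<..} = L" using L that by auto
    then show ?thesis using cL by (simp add: \<phi>_def)
  qed
  have drop: "\<phi> (c - 1) - \<phi> c = (if c \<in> L then 1 / real (card L) else 0)" for c
  proof -
    have "{c - 1<..} = insert c {c<..}" by auto
    then have "L \<inter> {c - 1<..} = (if c \<in> L then insert c (L \<inter> {c<..}) else L \<inter> {c<..})" by auto
    then show ?thesis using fL by (auto simp: \<phi>_def simp flip: diff_divide_distrib)
  qed
  have "(\<Sum>(k, x)\<in>edges R'. a k x * (fdiff w k x)^2)
    = (\<Sum>(k, x)\<in>edges R'. a k x * (\<phi> (supnorm (inward k x)))^2 * (fdiff w k x)^2)"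
  proof (intro sum.cong refl, clarify)
    fix k :: 'd and x assume "(k, x) \<in> edges R'"
    then have "supnorm (inward k x) \<le> int R'"
      using edge_ends[of k x R'] by (auto simp: inward_def cube_supnorm)
    then show "a k x * (fdiff w k x)^2 = a k x * (\<phi> (supnorm (inward k x)))^2 * (fdiff w k x)^2" by (simp add: one)
  qed
  also have "\<dots> \<le> (\<Sum>(k, x)\<in>edges R. a k x * (\<phi> (supnorm (inward k x)))^2 * (fdiff w k x)^2)"
    using a edges_mono[OF RR] by (intro sum_mono2) auto
  also have "\<dots> \<le> 4 * (\<Sum>(k, x)\<in>edges R. a k x * (\<phi> (rad k x - 1) - \<phi> (rad k x))^2 * (w (outward k x))^2)"
    by (rule Caccioppoli[OF a sub am _ R0]) (simp_all add: \<phi>_def)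
  also have "(\<Sum>(k, x)\<in>edges R. a k x * (\<phi> (rad k x - 1) - \<phi> (rad k x))^2 * (w (outward k x))^2)
    = (\<Sum>(k, x)\<in>edges R. if rad k x \<in> L then 1 / (real (card L))^2 * (a k x * (w (outward k x))^2) else 0)"
    unfolding drop by (intro sum.cong) (auto simp: power_divide)
  also have "\<dots> = (\<Sum>(k, x) | (k, x) \<in> edges R \<and> rad k x \<in> L. 1 / (real (card L))^2 * (a k x * (w (outward k x))^2))"
  proof -
    have eq: "{(k, x). (k, x) \<in> edges R \<and> rad k x \<in> L} = {e \<in> edges R. rad (fst e) (snd e) \<in> L}" by auto
    show ?thesis unfolding eq sum.inter_filter[OF finite_edges] by (intro sum.cong) auto
  qed
  finally show ?thesis by (simp add: case_prod_beta sum_distrib_left)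
qed

text \<open>With \<open>\<tau>\<close> the logarithm of \<open>a / b\<close>, the product splits
  into \<open>B^2 * (2 - exp \<tau> - exp (- \<tau>))\<close>, which yields a quadratic gain, and a
  cutoff term in which \<open>1 - exp (- \<tau>)\<close> is at most 1 and at most
  \<open>\<bar>\<tau>\<bar>\<close>. Young's inequality spends half of the gain on the latter, and
  no value of the function remains in the error.\<close>

lemma log_pointwise:
  fixes A B a b :: real
  assumes "0 \<le> B" "B \<le> A" "a > 0" "b > 0"
  shows "(B^2 / b - A^2 / a) * (b - a) \<le> 5 * (A - B)^2 - B^2 * (ln b - ln a)^2 / 4"
proof -
  define \<tau> where "\<tau> = ln a - ln b"
  have ab: "a / b = exp \<tau>" "b / a = exp (- \<tau>)"
    using assms by (simp_all add: \<tau>_def exp_diff)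
  have "(B^2 / b - A^2 / a) * (b - a) = A^2 + B^2 - A^2 * (b / a) - B^2 * (a / b)"
    using assms by (simp add: field_simps)
  also have "\<dots> = B^2 * (2 - exp \<tau> - exp (- \<tau>)) + (A^2 - B^2) * (1 - exp (- \<tau>))"
    unfolding ab by (simp add: algebra_simps)
  also have "\<dots> \<le> B^2 * (- (\<tau>^2 / 2)) + (5 * (A - B)^2 + B^2 * \<tau>^2 / 4)"
  proof (intro add_mono mult_left_mono)
    \<comment> \<open>Expanding both exponentials would give \<open>t^2\<close>; a quadratic bound
      for one and a linear bound for the other already suffice.\<close>
    have 1: "exp t + exp (- t) \<ge> 2 + t^2 / 2" if "t \<ge> 0" for t :: real
      using exp_lower_Taylor_quadratic[OF that] exp_ge_add_one_self[of "- t"] by simp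
    show "2 - exp \<tau> - exp (- \<tau>) \<le> - (\<tau>^2 / 2)"
      using 1[of \<tau>] 1[of "- \<tau>"] by (cases "\<tau> \<ge> 0") auto
    define m where "m = 1 - exp (- \<tau>)"
    have m: "m \<le> 1" "m \<le> \<bar>\<tau>\<bar>" using exp_ge_add_one_self[of "- \<tau>"] by (auto simp: m_def)
    have "(A^2 - B^2) * m = (A - B)^2 * m + 2 * ((A - B) * B) * m"
      by (simp add: power2_eq_square algebra_simps)
    also have "\<dots> \<le> (A - B)^2 * 1 + 2 * ((A - B) * B) * \<bar>\<tau>\<bar>"
      using m assms by (intro add_mono mult_left_mono) auto
    also have "\<dots> \<le> 5 * (A - B)^2 + B^2 * \<tau>^2 / 4"
    proof -
      have "(2 * (A - B))^2 = 4 * (A - B)^2" "(B * \<bar>\<tau>\<bar> / 2)^2 = B^2 * \<tau>^2 / 4"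
        by (simp_all only: power2_eq_square) (simp_all add: algebra_simps)
      moreover have "2 * ((A - B) * B) * \<bar>\<tau>\<bar> = 2 * (2 * (A - B)) * (B * \<bar>\<tau>\<bar> / 2)" by simp
      ultimately show ?thesis
        using sum_squares_bound[of "2 * (A - B)" "B * \<bar>\<tau>\<bar> / 2"] by linarith
    qed
    finally show "(A^2 - B^2) * (1 - exp (- \<tau>)) \<le> 5 * (A - B)^2 + B^2 * \<tau>^2 / 4" by (simp add: m_def)
  qed simp
  also have "\<tau>^2 = (ln b - ln a)^2" by (simp add: \<tau>_def power2_commute)
  finally show ?thesis by simp
qed

text \<open>The equation is tested with the squared cutoff over \<open>f\<close>. The gain carries
  the smaller cutoff, that at the outer endpoint, in contrast to \<open>Caccioppoli\<close>. The
  constant is 20 = 5 * 4 by the factors 5 and 1/4 in \<open>log_pointwise\<close>.\<close>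

lemma log_energy:
  fixes a :: "'d::finite \<Rightarrow> ('d \<Rightarrow> int) \<Rightarrow> real" and \<phi> :: "int \<Rightarrow> real"
  assumes a: "\<And>k x. a k x \<ge> 0"
    and f: "\<And>x. x \<in> cube R \<Longrightarrow> f x > 0"
    and harm: "\<And>x. supnorm x < int R \<Longrightarrow> gen a f x = 0"
    and \<phi>: "antimono \<phi>" "\<And>c. \<phi> c \<ge> 0" "\<phi> (int R) = 0"
  shows "(\<Sum>(k, x)\<in>edges R. a k x * (\<phi> (supnorm (outward k x)))^2 * (fdiff (\<lambda>x. ln (f x)) k x)^2)
    \<le> 20 * (\<Sum>(k, x)\<in>edges R. a k x * (\<phi> (rad k x - 1) - \<phi> (rad k x))^2)"
proof -
  define \<eta> where "\<eta> x = \<phi> (supnorm x)" for x :: "'d \<Rightarrow> int"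
  define \<psi> where "\<psi> x = (\<eta> x)^2 / f x" for x
  have e0: "\<eta> x = 0" if "x \<in> cube R" "\<not> supnorm x < int R" for x
    using that \<phi>(3) by (simp add: cube_supnorm \<eta>_def)
  have bd: "\<psi> x = 0" if "x \<in> cube R" "\<bar>x i\<bar> = int R" for x i
  proof -
    have "supnorm x \<ge> int R" using that(2) abs_le_supnorm[of x i] by simp
    then show ?thesis using e0[OF that(1)] by (simp add: \<psi>_def)
  qed
  have "(\<Sum>(k, x)\<in>edges R. a k x * fdiff \<psi> k x * fdiff f k x) = - (\<Sum>x\<in>cube R. \<psi> x * gen a f x)"
    by (rule sum_by_parts) (rule bd)
  also have "(\<Sum>x\<in>cube R. \<psi> x * gen a f x) = 0"
  proof (intro sum.neutral ballI)
    fix x :: "'d \<Rightarrow> int" assume "x \<in> cube R"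
    then show "\<psi> x * gen a f x = 0" using e0[of x] harm[of x] by (cases "supnorm x < int R") (auto simp: \<psi>_def)
  qed
  finally have zero: "(\<Sum>(k, x)\<in>edges R. a k x * fdiff \<psi> k x * fdiff f k x) = 0" by simp
  have pt: "a k x * fdiff \<psi> k x * fdiff f k x \<le> 5 * (a k x * (\<phi> (rad k x - 1) - \<phi> (rad k x))^2)
     - a k x * (\<eta> (outward k x))^2 * (fdiff (\<lambda>x. ln (f x)) k x)^2 / 4" if "(k, x) \<in> edges R" for k x
  proof -
    have io: "\<eta> (outward k x) \<le> \<eta> (inward k x)"
      using supnorm_inward_outward[of k x] \<phi>(1) by (auto simp: \<eta>_def antimono_def)
    have d: "(\<eta> (inward k x) - \<eta> (outward k x))^2 \<le> (\<phi> (rad k x - 1) - \<phi> (rad k x))^2"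
      using supnorm_inward_outward[of k x] by (auto simp: \<eta>_def)
    have "f x > 0" "f (x(k := x k + 1)) > 0" using edge_ends[OF that] f by auto
    then have fp: "f (inward k x) > 0" "f (outward k x) > 0" by (auto simp: inward_def outward_def)
    have e0: "fdiff \<psi> k x * fdiff f k x = ((\<eta> (outward k x))^2 / f (outward k x) - (\<eta> (inward k x))^2 / f (inward k x)) * (f (outward k x) - f (inward k x))"
      and e1: "(fdiff (\<lambda>x. ln (f x)) k x)^2 = (ln (f (outward k x)) - ln (f (inward k x)))^2"
    proof -
      have sw: "(A - B) * (C - D) = (B - A) * (D - C)" for A B C D :: real by (simp add: algebra_simps)
      show "fdiff \<psi> k x * fdiff f k x = ((\<eta> (outward k x))^2 / f (outward k x) - (\<eta> (inward k x))^2 / f (inward k x)) * (f (outward k x) - f (inward k x))"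
        by (cases "x k \<ge> 0") (simp_all add: fdiff_def \<psi>_def inward_def outward_def, rule sw)
      show "(fdiff (\<lambda>x. ln (f x)) k x)^2 = (ln (f (outward k x)) - ln (f (inward k x)))^2"
        by (cases "x k \<ge> 0") (simp_all add: fdiff_def inward_def outward_def power2_commute)
    qed
    have "fdiff \<psi> k x * fdiff f k x \<le> 5 * (\<eta> (inward k x) - \<eta> (outward k x))^2 - (\<eta> (outward k x))^2 * (fdiff (\<lambda>x. ln (f x)) k x)^2 / 4"
      unfolding e0 e1 using io \<phi> fp by (intro log_pointwise) (auto simp: \<eta>_def)
    then have "fdiff \<psi> k x * fdiff f k x \<le> 5 * (\<phi> (rad k x - 1) - \<phi> (rad k x))^2 - (\<eta> (outward k x))^2 * (fdiff (\<lambda>x. ln (f x)) k x)^2 / 4"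
      using d by linarith
    from mult_left_mono[OF this a[of k x]] show ?thesis by (simp add: algebra_simps)
  qed
  have "0 \<le> (\<Sum>(k, x)\<in>edges R. 5 * (a k x * (\<phi> (rad k x - 1) - \<phi> (rad k x))^2)
     - a k x * (\<eta> (outward k x))^2 * (fdiff (\<lambda>x. ln (f x)) k x)^2 / 4)"
    unfolding zero[symmetric] by (intro sum_mono) (auto intro: pt)
  also have "\<dots> = 5 * (\<Sum>(k, x)\<in>edges R. a k x * (\<phi> (rad k x - 1) - \<phi> (rad k x))^2)
     - (\<Sum>(k, x)\<in>edges R. a k x * (\<eta> (outward k x))^2 * (fdiff (\<lambda>x. ln (f x)) k x)^2) / 4"
    by (simp add: case_prod_beta sum_subtractf sum_divide_distrib sum_distrib_left)
  finally show ?thesis by (simp add: \<eta>_def)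
qed

text \<open>Where \<open>v > l\<close>, truncation keeps the value \<open>v x - l\<close> and can
  only raise the neighbouring ones; elsewhere the factor in front vanishes. Thus subharmonicity is
  asked for only above the level.\<close>

lemma gen_truncate:
  fixes a :: "'d::finite \<Rightarrow> ('d \<Rightarrow> int) \<Rightarrow> real"
  assumes a: "\<And>k x. a k x \<ge> 0" and v: "v x > l \<Longrightarrow> gen a v x \<ge> 0"
  shows "max 0 (v x - l) * gen a (\<lambda>x. max 0 (v x - l)) x \<ge> 0"
proof (cases "v x > l")
  case True
  have "gen a v x \<le> gen a (\<lambda>x. max 0 (v x - l)) x"
    unfolding gen_def using True a by (intro sum_mono add_mono mult_left_mono) auto
  then show ?thesis using v[OF True] by (intro mult_nonneg_nonneg) auto
qed simp

text \<open>Convexity of \<open>- ln\<close>, in the form of the tangent bound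
  \<open>ln r \<le> r - 1\<close>. The factor 2 puts the level \<open>f = 1 / 2\<close> at height
  0.\<close>

lemma gen_neg_ln:
  fixes a :: "'d::finite \<Rightarrow> ('d \<Rightarrow> int) \<Rightarrow> real"
  assumes a: "\<And>k x. a k x \<ge> 0"
    and f: "\<And>x. x \<in> cube R \<Longrightarrow> f x > 0"
    and x: "supnorm x < int R" "gen a f x = 0"
  shows "gen a (\<lambda>x. - ln (2 * f x)) x \<ge> 0"
proof -
  have xi: "\<bar>x i\<bar> < int R" for i using x(1) abs_le_supnorm[of x i] by linarith
  have xc: "x \<in> cube R" "x(k := x k + 1) \<in> cube R" "x(k := x k - 1) \<in> cube R" for k
  proof -
    have "\<bar>x k + 1\<bar> \<le> int R" "\<bar>x k - 1\<bar> \<le> int R" using xi[of k] by linarith+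
    then show "x \<in> cube R" "x(k := x k + 1) \<in> cube R" "x(k := x k - 1) \<in> cube R"
      using xi by (auto simp: cube_def intro: less_imp_le)
  qed
  have ln: "- ln (2 * f y) - - ln (2 * f x) \<ge> - ((f y - f x) / f x)" if "y \<in> cube R" for y
  proof -
    have p: "f y > 0" "f x > 0" using f that xc by auto
    then have "ln (f y / f x) \<le> f y / f x - 1" by (intro ln_le_minus_one) auto
    then show ?thesis using p by (simp add: ln_div ln_mult diff_divide_distrib)
  qed
  have "(- 1 / f x) * gen a f x \<le> gen a (\<lambda>x. - ln (2 * f x)) x"
    unfolding gen_def sum_distrib_left
  proof (rule sum_mono)
    fix k
    have "(- 1 / f x) * (a k x * (f (x(k := x k + 1)) - f x) + a k (x(k := x k - 1)) * (f (x(k := x k - 1)) - f x))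
      = a k x * (- ((f (x(k := x k + 1)) - f x) / f x)) + a k (x(k := x k - 1)) * (- ((f (x(k := x k - 1)) - f x) / f x))"
      by (simp add: field_simps add_divide_distrib diff_divide_distrib)
    also have "\<dots> \<le> a k x * (- ln (2 * f (x(k := x k + 1))) - - ln (2 * f x)) + a k (x(k := x k - 1)) * (- ln (2 * f (x(k := x k - 1))) - - ln (2 * f x))"
      using a xc by (intro add_mono mult_left_mono ln) auto
    finally show "(- 1 / f x) * (a k x * (f (x(k := x k + 1)) - f x) + a k (x(k := x k - 1)) * (f (x(k := x k - 1)) - f x))
      \<le> a k x * (- ln (2 * f (x(k := x k + 1))) - - ln (2 * f x)) + a k (x(k := x k - 1)) * (- ln (2 * f (x(k := x k - 1))) - - ln (2 * f x))" .
  qed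
  then show ?thesis using x by simp
qed

section \<open>De Giorgi iteration\<close>

lemma sum_layer:
  fixes F :: "'d::finite \<Rightarrow> ('d \<Rightarrow> int) \<Rightarrow> real"
  assumes c: "1 \<le> c" "c \<le> int R"
  shows "(\<Sum>(k, x) | (k, x) \<in> edges R \<and> rad k x = c. F k (outward k x)) =
    (\<Sum>k\<in>UNIV. \<Sum>y\<in>fib R (UNIV - {k}) z. F k (y(k := c)) + F k (y(k := - c)))"
proof -
  have eq: "{(k, x). (k, x) \<in> edges R \<and> rad k x = c} = {e \<in> edges R. rad (fst e) (snd e) = c}" by auto
  have "(\<Sum>(k, x) | (k, x) \<in> edges R \<and> rad k x = c. F k (outward k x)) =
    (\<Sum>(k, x)\<in>edges R. if rad k x = c then F k (outward k x) else 0)"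
    unfolding eq sum.inter_filter[OF finite_edges] by (intro sum.cong) auto
  also have "\<dots> = (\<Sum>k\<in>UNIV. \<Sum>y\<in>fib R (UNIV - {k}) z. \<Sum>b\<in>{- int R..<int R}.
      if rad k (y(k := b)) = c then F k (outward k (y(k := b))) else 0)"
  proof -
    have "(\<Sum>x | x \<in> cube R \<and> x k < int R. H x) = (\<Sum>y\<in>fib R (UNIV - {k}) z. \<Sum>b\<in>{- int R..<int R}. H (y(k := b)))"
      for k :: 'd and H :: "('d \<Rightarrow> int) \<Rightarrow> real"
      using sum_fib_edges_line[where I = UNIV and k = k and R = R and z = z and F = H] unfolding fib_UNIV by simp
    then show ?thesis unfolding sum_edges by simp
  qed
  also have "\<dots> = (\<Sum>k\<in>UNIV. \<Sum>y\<in>fib R (UNIV - {k}) z. F k (y(k := c)) + F k (y(k := - c)))"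
  proof (intro sum.cong refl)
    fix k and y :: "'d \<Rightarrow> int"
    let ?f = "\<lambda>b. if rad k (y(k := b)) = c then F k (outward k (y(k := b))) else 0"
    \<comment> \<open>A bond of layer \<open>c\<close> has its lower endpoint at
      \<open>c - 1\<close> on the positive side and at \<open>- c\<close> on the negative side; the
      outer endpoints are at \<open>c\<close> and \<open>- c\<close>.\<close>
    have "(\<Sum>b\<in>{- int R..<int R}. ?f b) = (\<Sum>b\<in>{c - 1, - c}. ?f b)"
      using c by (intro sum.mono_neutral_right) (auto simp: rad_def)
    also have "\<dots> = F k (y(k := c)) + F k (y(k := - c))"
      using c by (simp add: rad_def outward_def)
    finally show "(\<Sum>b\<in>{- int R..<int R}. ?f b) = F k (y(k := c)) + F k (y(k := - c))" .
  qed
  finally show ?thesis .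
qed

definition slice_norm :: "real \<Rightarrow> nat \<Rightarrow> (('d::finite \<Rightarrow> int) \<Rightarrow> real) \<Rightarrow> 'd \<Rightarrow> int \<Rightarrow> real" where
  "slice_norm s R w k \<tau> =
    (\<Sum>(i, x)\<in>fib_edges R (UNIV - {k}) (\<lambda>_. 0). \<bar>fdiff w i (x(k := \<tau>))\<bar> powr s) +
    (\<Sum>x\<in>fib R (UNIV - {k}) (\<lambda>_. 0). (w (x(k := \<tau>)) / (2 * real R + 1)) powr s)"

lemma slice_norm_nonneg: "slice_norm s R w k \<tau> \<ge> 0"
  unfolding slice_norm_def by (auto intro!: add_nonneg_nonneg sum_nonneg)

text \<open>For one direction \<open>k\<close> the slices are disjoint and miss only the bonds in
  direction \<open>k\<close>; the factor counts the directions.\<close>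

lemma sum_slice_norm_le:
  fixes w :: "('d::finite \<Rightarrow> int) \<Rightarrow> real"
  shows "(\<Sum>k\<in>UNIV. \<Sum>\<tau>\<in>{- int R..int R}. slice_norm s R w k \<tau>) \<le>
    CARD('d) * ((\<Sum>(k, x)\<in>edges R. \<bar>fdiff w k x\<bar> powr s) + (\<Sum>x\<in>cube R. (w x / (2 * real R + 1)) powr s))"
proof -
  have "(\<Sum>\<tau>\<in>{- int R..int R}. slice_norm s R w k \<tau>) \<le>
     (\<Sum>(k, x)\<in>edges R. \<bar>fdiff w k x\<bar> powr s) + (\<Sum>x\<in>cube R. (w x / (2 * real R + 1)) powr s)" for k
  proof -
    have ins: "insert k (UNIV - {k}) = UNIV" by auto
    have 1: "(\<Sum>(i, x)\<in>edges R. \<bar>fdiff w i x\<bar> powr s) =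
      (\<Sum>\<tau>\<in>{- int R..int R}. \<Sum>(i, x)\<in>fib_edges R (UNIV - {k}) (\<lambda>_. 0). \<bar>fdiff w i (x(k := \<tau>))\<bar> powr s) +
      (\<Sum>y\<in>fib R (UNIV - {k}) (\<lambda>_. 0). \<Sum>c\<in>{- int R..<int R}. \<bar>fdiff w k (y(k := c))\<bar> powr s)"
      using sum_fib_edges_insert[of "UNIV - {k}" k "\<lambda>i x. \<bar>fdiff w i x\<bar> powr s" R "\<lambda>_. 0"]
      by (simp only: ins fib_edges_UNIV) simp
    have 2: "(\<Sum>x\<in>cube R. (w x / (2 * real R + 1)) powr s) =
      (\<Sum>\<tau>\<in>{- int R..int R}. \<Sum>x\<in>fib R (UNIV - {k}) (\<lambda>_. 0). (w (x(k := \<tau>)) / (2 * real R + 1)) powr s)"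
      using sum_fib_remove[of k UNIV "\<lambda>x. (w x / (2 * real R + 1)) powr s" R "\<lambda>_. 0"]
      by (simp only: fib_UNIV UNIV_I)
    have 3: "(\<Sum>y\<in>fib R (UNIV - {k}) (\<lambda>_. 0). \<Sum>c\<in>{- int R..<int R}. \<bar>fdiff w k (y(k := c))\<bar> powr s) \<ge> 0"
      by (intro sum_nonneg) simp
    show ?thesis unfolding slice_norm_def sum.distrib using 1 2 3 by linarith
  qed
  then have "(\<Sum>k\<in>(UNIV :: 'd set). \<Sum>\<tau>\<in>{- int R..int R}. slice_norm s R w k \<tau>) \<le>
    (\<Sum>k\<in>(UNIV :: 'd set). (\<Sum>(k, x)\<in>edges R. \<bar>fdiff w k x\<bar> powr s) + (\<Sum>x\<in>cube R. (w x / (2 * real R + 1)) powr s))"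
    by (rule sum_mono)
  then show ?thesis by simp
qed

lemma sum_slice_norm_layers_le:
  fixes w :: "('d::finite \<Rightarrow> int) \<Rightarrow> real"
  assumes S: "S \<subseteq> {1..int R}"
  shows "(\<Sum>c\<in>S. \<Sum>k\<in>UNIV. slice_norm s R w k c + slice_norm s R w k (- c)) \<le>
    CARD('d) * ((\<Sum>(k, x)\<in>edges R. \<bar>fdiff w k x\<bar> powr s) + (\<Sum>x\<in>cube R. (w x / (2 * real R + 1)) powr s))"
proof -
  have fS: "finite S" using S by (rule finite_subset) simp
  have disj: "S \<inter> uminus ` S = {}"
  proof -
    have "c \<notin> uminus ` S" if "c \<in> S" for c
    proof
      assume "c \<in> uminus ` S"
      then obtain b where b: "c = - b" "b \<in> S" by blast
      then have "b \<in> {1..int R}" "c \<in> {1..int R}" using S \<open>c \<in> S\<close> by blast+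
      then show False using b(1) by simp
    qed
    then show ?thesis by blast
  qed
  have bd: "S \<union> uminus ` S \<subseteq> {- int R..int R}"
  proof
    fix c assume "c \<in> S \<union> uminus ` S"
    then have "c \<in> {1..int R} \<or> - c \<in> {1..int R}" using S by auto
    then show "c \<in> {- int R..int R}" by auto
  qed
  have "(\<Sum>c\<in>S. \<Sum>k\<in>UNIV. slice_norm s R w k c + slice_norm s R w k (- c)) \<le>
    (\<Sum>k\<in>UNIV. \<Sum>\<tau>\<in>{- int R..int R}. slice_norm s R w k \<tau>)"
  proof (subst sum.swap, intro sum_mono)
    fix k
    have "(\<Sum>c\<in>S. slice_norm s R w k (- c)) = (\<Sum>c\<in>uminus ` S. slice_norm s R w k c)"
      by (subst sum.reindex) auto
    then have "(\<Sum>c\<in>S. slice_norm s R w k c + slice_norm s R w k (- c)) = (\<Sum>c\<in>S \<union> uminus ` S. slice_norm s R w k c)"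
      unfolding sum.distrib by (subst sum.union_disjoint) (simp_all add: fS disj)
    also have "\<dots> \<le> (\<Sum>\<tau>\<in>{- int R..int R}. slice_norm s R w k \<tau>)"
      using bd by (intro sum_mono2 slice_norm_nonneg) auto
    finally show "(\<Sum>c\<in>S. slice_norm s R w k c + slice_norm s R w k (- c)) \<le> (\<Sum>\<tau>\<in>{- int R..int R}. slice_norm s R w k \<tau>)" .
  qed
  also note sum_slice_norm_le
  finally show ?thesis .
qed

text \<open>Here the dimension drops by one. \<open>CARD('d) \<ge> 3\<close> makes the slice at
  least two-dimensional, as Loomis-Whitney demands.\<close>

lemma slice_Sobolev:
  fixes w :: "('d::finite \<Rightarrow> int) \<Rightarrow> real" and s t :: real
  assumes d: "CARD('d) \<ge> 3" and w: "\<And>x. w x \<ge> 0" and s: "s > 1"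
    and t: "t > 0" "1 / t = 1 / s - 1 / (real CARD('d) - 1)"
  shows "(\<Sum>x\<in>fib R (UNIV - {k}) (\<lambda>_. 0). w (x(k := \<tau>)) powr t)
    \<le> (2 * t * CARD('d) + 1) powr t * slice_norm s R w k \<tau> powr (t / s)"
proof -
  let ?I = "UNIV - {k} :: 'd set"
  have cI: "card ?I = CARD('d) - 1" by simp
  then have cI': "real (card ?I) = real CARD('d) - 1" unfolding cI using d by (simp add: of_nat_diff)
  have fd: "fdiff (\<lambda>x. w (x(k := \<tau>))) i x = fdiff w i (x(k := \<tau>))" if "i \<noteq> k" for i x
    using that by (simp add: fdiff_def fun_upd_twist)
  have sn: "(\<Sum>(i, x)\<in>fib_edges R ?I (\<lambda>_. 0). \<bar>fdiff (\<lambda>x. w (x(k := \<tau>))) i x\<bar> powr s) =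
    (\<Sum>(i, x)\<in>fib_edges R ?I (\<lambda>_. 0). \<bar>fdiff w i (x(k := \<tau>))\<bar> powr s)"
  proof (intro sum.cong refl, clarify)
    fix i x assume "(i, x) \<in> fib_edges R ?I (\<lambda>_. 0)"
    then have "i \<noteq> k" by (simp add: fib_edges_def)
    then show "\<bar>fdiff (\<lambda>x. w (x(k := \<tau>))) i x\<bar> powr s = \<bar>fdiff w i (x(k := \<tau>))\<bar> powr s" by (simp add: fd)
  qed
  define T where "T = (\<Sum>x\<in>fib R ?I (\<lambda>_. 0). w (x(k := \<tau>)) powr t)"
  have T: "T \<ge> 0" unfolding T_def by (intro sum_nonneg) simp
  have "T powr (1 / t) \<le> (2 * t * card ?I + 1) * slice_norm s R w k \<tau> powr (1 / s)"
    unfolding slice_norm_def T_def sn[symmetric]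
    using d w s t by (intro Sobolev) (auto simp: cI')
  also have "\<dots> \<le> (2 * t * CARD('d) + 1) * slice_norm s R w k \<tau> powr (1 / s)"
    using t by (intro mult_right_mono) (auto simp: cI')
  finally have "(T powr (1 / t)) powr t \<le> ((2 * t * CARD('d) + 1) * slice_norm s R w k \<tau> powr (1 / s)) powr t"
    using t by (intro powr_mono2) auto
  then show ?thesis using t(1) T by (simp add: powr_powr powr_mult T_def)
qed

text \<open>Where the truncation is nonzero, \<open>(y / h) powr (2 * (\<beta> - 1))\<close> is at
  least 1. Raising the power from 2 to \<open>2 * \<beta>\<close> is the source of superlinearity;
  the price is a negative power of the level gap \<open>h\<close>.\<close>

lemma truncation_gain:
  fixes h y \<beta> :: real
  assumes "h > 0" "\<beta> \<ge> 1" "y \<ge> 0"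
  shows "(max 0 (y - h))^2 \<le> h powr (- 2 * (\<beta> - 1)) * y powr (2 * \<beta>)"
proof (cases "y > h")
  case True
  have "(max 0 (y - h))^2 \<le> y^2" using True assms by (intro power_mono) auto
  also have "\<dots> = y powr (2 * \<beta>) * y powr (- 2 * (\<beta> - 1))"
    using True assms by (simp add: algebra_simps flip: powr_add)
  also have "\<dots> \<le> y powr (2 * \<beta>) * h powr (- 2 * (\<beta> - 1))"
    using True assms by (intro mult_left_mono powr_mono2') auto
  finally show ?thesis by (simp add: mult.commute)
qed (use assms in auto)

text \<open>After \<open>truncation_gain\<close>, Hoelder with exponent \<open>p\<close> on the
  coefficients leaves \<open>w\<close> with the power \<open>2 * \<beta>\<close> times the dual
  exponent of \<open>p\<close>, which is \<open>t\<close>. Slice Sobolev then applies on each of the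
  \<open>2 * CARD('d)\<close> slices of the layer.\<close>

lemma layer_energy:
  fixes a :: "'d::finite \<Rightarrow> ('d \<Rightarrow> int) \<Rightarrow> real" and p s t \<beta> h :: real
  assumes d: "CARD('d) \<ge> 3" and a: "\<And>k x. a k x > 0" and w: "\<And>x. w x \<ge> 0"
    and p: "p > 1" and s: "s > 1" and t: "t > 0" "1 / t = 1 / s - 1 / (real CARD('d) - 1)"
    and \<beta>: "\<beta> = t * (1 - 1 / p) / 2" "\<beta> > 1" and h: "h > 0" and c: "1 \<le> c" "c \<le> int R"
  shows "(\<Sum>(k, x) | (k, x) \<in> edges R \<and> rad k x = c. a k x * (max 0 (w (outward k x) - h))^2)
    \<le> h powr (- 2 * (\<beta> - 1)) * (\<Sum>(k, x) | (k, x) \<in> edges R \<and> rad k x = c. a k x powr p) powr (1 / p)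
      * (2 * CARD('d) * (2 * t * CARD('d) + 1) powr t
         * (\<Sum>k\<in>UNIV. slice_norm s R w k c + slice_norm s R w k (- c)) powr (t / s)) powr (1 - 1 / p)"
proof -
  let ?X = "{(k, x). (k, x) \<in> edges R \<and> rad k x = c}"
  let ?G = "\<Sum>k\<in>UNIV. slice_norm s R w k c + slice_norm s R w k (- c)"
  let ?C = "(2 * t * CARD('d) + 1) powr t"
  define p' where "p' = 1 / (1 - 1 / p)"
  have p': "1 / p + 1 / p' = 1" "1 / p' = 1 - 1 / p" "p' > 0" using p by (auto simp: p'_def)
  have "2 * \<beta> = t * (1 / p')" unfolding p'(2) using \<beta> by simp
  then have bp: "2 * \<beta> * p' = t" using p'(3) by simp
  have G0: "?G \<ge> 0" by (intro sum_nonneg add_nonneg_nonneg slice_norm_nonneg)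
  have wt: "(\<Sum>(k, x)\<in>?X. (w (outward k x) powr (2 * \<beta>)) powr p') \<le> 2 * CARD('d) * ?C * ?G powr (t / s)"
  proof -
    have gle: "slice_norm s R w k \<tau> \<le> ?G" if "\<tau> = c \<or> \<tau> = - c" for k \<tau>
    proof -
      have "slice_norm s R w k \<tau> \<le> slice_norm s R w k c + slice_norm s R w k (- c)"
        using that slice_norm_nonneg[of s R w k c] slice_norm_nonneg[of s R w k "- c"] by auto
      also have "\<dots> \<le> ?G" by (intro member_le_sum add_nonneg_nonneg slice_norm_nonneg) auto
      finally show ?thesis .
    qed
    have b: "(\<Sum>y\<in>fib R (UNIV - {k}) (\<lambda>_. 0). w (y(k := \<tau>)) powr t) \<le> ?C * ?G powr (t / s)" if "\<tau> = c \<or> \<tau> = - c" for k \<tau>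
      using gle[OF that, of k] s t
      by (intro order_trans[OF slice_Sobolev[OF d w s t]] mult_left_mono powr_mono2) (auto simp: slice_norm_nonneg)
    have "(\<Sum>(k, x)\<in>?X. (w (outward k x) powr (2 * \<beta>)) powr p') = (\<Sum>k\<in>UNIV. \<Sum>y\<in>fib R (UNIV - {k}) (\<lambda>_. 0). w (y(k := c)) powr t + w (y(k := - c)) powr t)"
      unfolding powr_powr bp by (rule sum_layer[OF c])
    also have "\<dots> \<le> (\<Sum>k\<in>(UNIV :: 'd set). ?C * ?G powr (t / s) + ?C * ?G powr (t / s))"
    proof (rule sum_mono)
      fix k :: 'd
      show "(\<Sum>y\<in>fib R (UNIV - {k}) (\<lambda>_. 0). w (y(k := c)) powr t + w (y(k := - c)) powr t) \<le> ?C * ?G powr (t / s) + ?C * ?G powr (t / s)"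
        by (subst sum.distrib) (intro add_mono b, simp_all)
    qed
    also have "\<dots> = 2 * CARD('d) * ?C * ?G powr (t / s)" by simp
    finally show ?thesis .
  qed
  have "(\<Sum>(k, x)\<in>?X. a k x * (max 0 (w (outward k x) - h))^2)
    \<le> (\<Sum>(k, x)\<in>?X. h powr (- 2 * (\<beta> - 1)) * (a k x * w (outward k x) powr (2 * \<beta>)))"
  proof (intro sum_mono, clarify)
    fix k x
    have "a k x * (max 0 (w (outward k x) - h))^2 \<le> a k x * (h powr (- 2 * (\<beta> - 1)) * w (outward k x) powr (2 * \<beta>))"
      using a[of k x] h \<beta> w by (intro mult_left_mono truncation_gain) auto
    then show "a k x * (max 0 (w (outward k x) - h))^2 \<le> h powr (- 2 * (\<beta> - 1)) * (a k x * w (outward k x) powr (2 * \<beta>))"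
      by (simp add: mult.left_commute)
  qed
  also have "\<dots> = h powr (- 2 * (\<beta> - 1)) * (\<Sum>(k, x)\<in>?X. a k x * w (outward k x) powr (2 * \<beta>))"
    by (simp add: sum_distrib_left case_prod_beta)
  also have "\<dots> \<le> h powr (- 2 * (\<beta> - 1)) * ((\<Sum>(k, x)\<in>?X. a k x powr p) powr (1 / p) * (\<Sum>(k, x)\<in>?X. (w (outward k x) powr (2 * \<beta>)) powr p') powr (1 / p'))"
    unfolding case_prod_beta using a p p' by (intro mult_left_mono sum_Holder) (auto intro: less_imp_le)
  also have "\<dots> \<le> h powr (- 2 * (\<beta> - 1)) * ((\<Sum>(k, x)\<in>?X. a k x powr p) powr (1 / p) * (2 * CARD('d) * ?C * ?G powr (t / s)) powr (1 / p'))"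
    using p'(3) by (intro mult_left_mono powr_mono2 wt) (auto intro!: sum_nonneg)
  finally show ?thesis by (simp add: p'(2) mult.assoc)
qed

text \<open>Markov: each of the two quantities exceeds four times the bound for its mean on at most
  a quarter of the layers, so at least half of the layers are good for both.\<close>

lemma good_layers:
  fixes A G :: "int \<Rightarrow> real"
  assumes N: "finite S" "card S > 0"
    and A: "\<And>c. c \<in> S \<Longrightarrow> A c \<ge> 0" "sum A S \<le> P" and G: "\<And>c. c \<in> S \<Longrightarrow> G c \<ge> 0" "sum G S \<le> H"
  obtains L where "L \<subseteq> S" "real (card L) \<ge> real (card S) / 2"
    "\<And>c. c \<in> L \<Longrightarrow> A c \<le> 4 * P / real (card S)" "\<And>c. c \<in> L \<Longrightarrow> G c \<le> 4 * H / real (card S)"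
proof -
  define N where "N = real (card S)"
  have N0: "N > 0" using N by (simp add: N_def)
  have bad: "real (card {c \<in> S. F c > 4 * Q / N}) \<le> N / 4"
    if F: "\<And>c. c \<in> S \<Longrightarrow> F c \<ge> 0" "sum F S \<le> Q" for F :: "int \<Rightarrow> real" and Q
  proof -
    let ?B = "{c \<in> S. F c > 4 * Q / N}"
    have Q0: "Q \<ge> 0" using F sum_nonneg[of S F] by force
    have le: "sum F ?B \<le> Q" using F N(1) by (intro order_trans[OF sum_mono2 F(2)]) auto
    have "real (card ?B) * (4 * Q / N) \<le> sum F ?B"
      using sum_mono[of ?B "\<lambda>_. 4 * Q / N" F] by auto
    then have *: "real (card ?B) * (4 * Q / N) \<le> Q" using le by simp
    show ?thesis
    \<comment> \<open>Markov says nothing when the threshold is 0; in that case the quantity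
      vanishes on all layers.\<close>
    proof (cases "Q = 0")
      case True
      then have "sum F S = 0" using F sum_nonneg[of S F] by force
      then have "\<forall>c\<in>S. F c = 0" using F N by (subst (asm) sum_nonneg_eq_0_iff) auto
      then have e: "?B = {}" using True by auto
      show ?thesis unfolding e using N0 by simp
    next
      case False
      then show ?thesis using * Q0 N0 by (simp add: field_simps)
    qed
  qed
  define L where "L = {c \<in> S. A c \<le> 4 * P / N \<and> G c \<le> 4 * H / N}"
  let ?BA = "{c \<in> S. A c > 4 * P / N}" and ?BG = "{c \<in> S. G c > 4 * H / N}"
  have "S = L \<union> (?BA \<union> ?BG)" by (auto simp: L_def)
  then have "card S = card (L \<union> (?BA \<union> ?BG))" by simp
  also have "\<dots> \<le> card L + (card ?BA + card ?BG)"
    by (intro order_trans[OF card_Un_le] add_left_mono card_Un_le)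
  finally have "card S \<le> card L + (card ?BA + card ?BG)" .
  then have "N \<le> card L + (real (card {c \<in> S. A c > 4 * P / N}) + real (card {c \<in> S. G c > 4 * H / N}))"
    by (simp add: N_def)
  with bad[OF A] bad[OF G] have "real (card L) \<ge> N / 2" by linarith
  moreover have "L \<subseteq> S" "\<And>c. c \<in> L \<Longrightarrow> A c \<le> 4 * P / N" "\<And>c. c \<in> L \<Longrightarrow> G c \<le> 4 * H / N"
    by (auto simp: L_def)
  ultimately show ?thesis unfolding N_def by (intro that)
qed

text \<open>Caccioppoli with a cutoff that drops only on good layers. The exponent of the gap
  collects -1 from \<open>4 / card L\<close>, one power of \<open>card L\<close> having paid for the
  sum over layers, and \<open>- 1 / p\<close> and \<open>- 2 * \<beta> / s\<close> from the layer
  averages of coefficients and gradient. \<open>B\<close> stands for a Poincare constant and removes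
  the zero-order part of the slice norms.\<close>

lemma DeGiorgi_step:
  fixes p s t \<beta> B :: real
  assumes d: "CARD('d::finite) \<ge> 3"
    and p: "p > 1" and s: "s > 1" and t: "t > 0" "1 / t = 1 / s - 1 / (real CARD('d) - 1)"
    and \<beta>: "\<beta> = t * (1 - 1 / p) / 2" "\<beta> > 1" and B: "B \<ge> 0"
  shows "\<exists>C>0. \<forall>(a :: 'd \<Rightarrow> ('d \<Rightarrow> int) \<Rightarrow> real) w h R R'.
    (\<forall>k x. a k x > 0) \<longrightarrow> (\<forall>x. w x \<ge> 0) \<longrightarrow> h > 0 \<longrightarrow> R' < R \<longrightarrow>
    (\<forall>x. supnorm x < int R \<longrightarrow> max 0 (w x - h) * gen a (\<lambda>x. max 0 (w x - h)) x \<ge> 0) \<longrightarrow>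
    (\<Sum>x\<in>cube R. (w x / (2 * real R + 1)) powr s) \<le> B * (\<Sum>(k, x)\<in>edges R. \<bar>fdiff w k x\<bar> powr s) \<longrightarrow>
    (\<Sum>(k, x)\<in>edges R'. a k x * (fdiff (\<lambda>x. max 0 (w x - h)) k x)^2)
      \<le> C * h powr (- 2 * (\<beta> - 1)) * (real R - real R') powr (- (1 + 1 / p + 2 * \<beta> / s))
        * (\<Sum>(k, x)\<in>edges R. a k x powr p) powr (1 / p) * (\<Sum>(k, x)\<in>edges R. \<bar>fdiff w k x\<bar> powr s) powr (2 * \<beta> / s)"
proof -
  define d where "d = real CARD('d)"
  define M1 where "M1 = 2 * d * (2 * t * d + 1) powr t"
  define M2 where "M2 = d * (1 + B)"
  define C where "C = 8 * 4 powr (1 / p) * M1 powr (1 - 1 / p) * (4 * M2) powr (2 * \<beta> / s)"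
  have d3: "d \<ge> 3" using d by (simp add: d_def)
  have "2 * t * d \<ge> 0" using d3 t by simp
  then have "2 * t * d + 1 \<noteq> 0" by linarith
  then have "(2 * t * d + 1) powr t > 0" by simp
  then have M: "M1 > 0" "M2 > 0" using d3 B by (auto simp: M1_def M2_def add_pos_nonneg)
  have C: "C > 0" using M by (simp add: C_def)
  have ts: "(t / s) * (1 - 1 / p) = 2 * \<beta> / s" using \<beta> by simp
  show ?thesis
  proof (intro exI[of _ C] conjI C allI impI)
    fix a :: "'d \<Rightarrow> ('d \<Rightarrow> int) \<Rightarrow> real" and w h R R'
    assume a: "\<forall>k x. a k x > 0" and w: "\<forall>x. w x \<ge> 0" and h: "h > 0" and RR: "R' < R"
      and sub: "\<forall>x. supnorm x < int R \<longrightarrow> max 0 (w x - h) * gen a (\<lambda>x. max 0 (w x - h)) x \<ge> 0"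
      and PB: "(\<Sum>x\<in>cube R. (w x / (2 * real R + 1)) powr s) \<le> B * (\<Sum>(k, x)\<in>edges R. \<bar>fdiff w k x\<bar> powr s)"
    define N where "N = real R - real R'"
    define P where "P = (\<Sum>(k, x)\<in>edges R. a k x powr p)"
    define G where "G = (\<Sum>(k, x)\<in>edges R. \<bar>fdiff w k x\<bar> powr s)"
    define S where "S = {int R'<..int R}"
    define X :: "int \<Rightarrow> ('d \<times> ('d \<Rightarrow> int)) set" where "X c = {(k, x). (k, x) \<in> edges R \<and> rad k x = c}" for c :: int
    define A where "A c = (\<Sum>(k, x)\<in>X c. a k x powr p)" for c
    define Gc where "Gc c = (\<Sum>k\<in>UNIV. slice_norm s R w k c + slice_norm s R w k (- c))" for c
    have N: "N > 0" using RR by (simp add: N_def)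
    have cS: "real (card S) = N" "card S > 0" using RR by (auto simp: S_def N_def)
    have P0: "P \<ge> 0" "G \<ge> 0" unfolding P_def G_def by (auto intro!: sum_nonneg)
    have A0: "A c \<ge> 0" for c unfolding A_def by (auto intro!: sum_nonneg)
    have Gc0: "Gc c \<ge> 0" for c unfolding Gc_def by (intro sum_nonneg add_nonneg_nonneg slice_norm_nonneg)
    have fX: "finite (X c)" for c by (rule finite_subset[OF _ finite_edges[of R]]) (auto simp: X_def)
    have union: "(\<Sum>c\<in>T. \<Sum>(k, x)\<in>X c. F k x) = (\<Sum>(k, x)\<in>(\<Union>c\<in>T. X c). F k x)" if "finite T" for T and F :: "'d \<Rightarrow> ('d \<Rightarrow> int) \<Rightarrow> real"
      using that fX by (subst sum.UNION_disjoint) (auto simp: X_def)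
    have sumA: "sum A S \<le> P"
    proof -
      have "sum A S = (\<Sum>(k, x)\<in>(\<Union>c\<in>S. X c). a k x powr p)"
        unfolding A_def by (rule union) (simp add: S_def)
      also have "\<dots> \<le> P" unfolding P_def by (intro sum_mono2) (auto simp: X_def)
      finally show ?thesis .
    qed
    have sumG: "sum Gc S \<le> M2 * G"
    proof -
      have "sum Gc S \<le> d * (G + (\<Sum>x\<in>cube R. (w x / (2 * real R + 1)) powr s))"
        unfolding Gc_def d_def G_def by (rule sum_slice_norm_layers_le) (auto simp: S_def)
      also have "\<dots> \<le> d * (G + B * G)"
        using PB d3 unfolding G_def by (intro mult_left_mono add_left_mono) auto
      finally show ?thesis by (simp add: M2_def algebra_simps)
    qed
    obtain L where L: "L \<subseteq> S" "real (card L) \<ge> N / 2"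
      "\<And>c. c \<in> L \<Longrightarrow> A c \<le> 4 * P / N" "\<And>c. c \<in> L \<Longrightarrow> Gc c \<le> 4 * (M2 * G) / N"
    proof -
      have "finite S" by (simp add: S_def)
      from good_layers[OF this cS(2) A0 sumA Gc0 sumG] show ?thesis
        using that unfolding cS(1) by blast
    qed
    have fL: "finite L" using L(1) by (rule finite_subset) (simp add: S_def)
    have cL: "real (card L) > 0" using L N by linarith
    define Y where "Y = h powr (- 2 * (\<beta> - 1)) * (4 * P / N) powr (1 / p) * (M1 * (4 * (M2 * G) / N) powr (t / s)) powr (1 - 1 / p)"
    have lay: "(\<Sum>(k, x)\<in>X c. a k x * (max 0 (w (outward k x) - h))^2) \<le> Y" if c: "c \<in> L" for c
    proof -
      have cR: "1 \<le> c" "c \<le> int R" using c L by (auto simp: S_def)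
      have "(\<Sum>(k, x)\<in>X c. a k x * (max 0 (w (outward k x) - h))^2)
        \<le> h powr (- 2 * (\<beta> - 1)) * A c powr (1 / p) * (M1 * Gc c powr (t / s)) powr (1 - 1 / p)"
        unfolding X_def A_def Gc_def M1_def d_def
        using layer_energy[OF assms(1) a[rule_format] w[rule_format] p s t \<beta> h cR] by simp
      also have "\<dots> \<le> Y" unfolding Y_def
        using L(3,4)[OF c] A0 Gc0 M p s t
        by (intro mult_mono powr_mono2 order_refl mult_nonneg_nonneg) auto
      finally show ?thesis .
    qed
    have XL: "{(k, x). (k, x) \<in> edges R \<and> rad k x \<in> L} = (\<Union>c\<in>L. X c)" by (auto simp: X_def)
    have "(\<Sum>(k, x)\<in>edges R'. a k x * (fdiff (\<lambda>x. max 0 (w x - h)) k x)^2)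
      \<le> 4 / (real (card L))^2 * (\<Sum>(k, x) | (k, x) \<in> edges R \<and> rad k x \<in> L. a k x * (max 0 (w (outward k x) - h))^2)"
      using a sub L(1) cL RR unfolding S_def by (intro Caccioppoli_layers) (auto intro: less_imp_le)
    also have "\<dots> = 4 / (real (card L))^2 * (\<Sum>c\<in>L. \<Sum>(k, x)\<in>X c. a k x * (max 0 (w (outward k x) - h))^2)"
      unfolding XL union[OF fL] ..
    also have "\<dots> \<le> 4 / (real (card L))^2 * (\<Sum>c\<in>L. Y)"
      by (intro mult_left_mono sum_mono lay) auto
    also have "\<dots> = 4 / real (card L) * Y"
      using cL by (simp add: power2_eq_square)
    also have "\<dots> \<le> 4 / (N / 2) * Y"
      using L(2) N unfolding Y_def by (intro mult_right_mono divide_left_mono) auto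
    also have "Y = h powr (- 2 * (\<beta> - 1)) * (4 powr (1 / p) * P powr (1 / p) * N powr (- (1 / p)))
       * (M1 powr (1 - 1 / p) * ((4 * M2) powr (2 * \<beta> / s) * G powr (2 * \<beta> / s) * N powr (- (2 * \<beta> / s))))"
      unfolding Y_def powr_mult powr_powr powr_divide ts by (simp add: powr_minus powr_mult divide_simps)
    also have "4 / (N / 2) * \<dots> = C * h powr (- 2 * (\<beta> - 1)) * (N powr (- 1) * N powr (- (1 / p)) * N powr (- (2 * \<beta> / s))) * P powr (1 / p) * G powr (2 * \<beta> / s)"
      using N by (simp add: C_def powr_minus divide_simps)
    also have "N powr (- 1) * N powr (- (1 / p)) * N powr (- (2 * \<beta> / s)) = N powr (- (1 + 1 / p + 2 * \<beta> / s))"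
      unfolding powr_add[symmetric] by simp
    finally show "(\<Sum>(k, x)\<in>edges R'. a k x * (fdiff (\<lambda>x. max 0 (w x - h)) k x)^2)
      \<le> C * h powr (- 2 * (\<beta> - 1)) * (real R - real R') powr (- (1 + 1 / p + 2 * \<beta> / s))
        * (\<Sum>(k, x)\<in>edges R. a k x powr p) powr (1 / p) * (\<Sum>(k, x)\<in>edges R. \<bar>fdiff w k x\<bar> powr s) powr (2 * \<beta> / s)"
      unfolding N_def P_def G_def .
  qed
qed

text \<open>\<open>s\<close> is chosen such that the weight \<open>a powr (- s / 2)\<close> left
  over by the energy is \<open>a powr (- q)\<close> to the power \<open>1 / (q + 1)\<close>, the
  exponent complementary to \<open>s / 2\<close>.\<close>

lemma gradient_Holder:
  fixes a :: "'d::finite \<Rightarrow> ('d \<Rightarrow> int) \<Rightarrow> real"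
  assumes a: "\<And>k x. a k x > 0" and q: "q > 0" and s: "s = 2 * q / (q + 1)"
  shows "(\<Sum>(k, x)\<in>edges R. \<bar>fdiff w k x\<bar> powr s) \<le>
    ((\<Sum>(k, x)\<in>edges R. a k x * (fdiff w k x)^2) * (\<Sum>(k, x)\<in>edges R. a k x powr (- q)) powr (1 / q)) powr (s / 2)"
proof -
  have e: "s / 2 + 1 / (q + 1) = 1" "1 / (q + 1) = (1 / q) * (s / 2)" "s / 2 = q / (q + 1)" using q s by (auto simp: field_simps)
  have "\<bar>fdiff w k x\<bar> powr s = (a k x * (fdiff w k x)^2) powr (s / 2) * (a k x powr (- q)) powr (1 / (q + 1))" for k x
  proof -
    have "(a k x * (fdiff w k x)^2) powr (s / 2) = a k x powr (s / 2) * (\<bar>fdiff w k x\<bar> powr 2) powr (s / 2)"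
      by (simp add: powr_mult)
    also have "\<dots> = a k x powr (s / 2) * \<bar>fdiff w k x\<bar> powr s" by (simp only: powr_powr) simp
    finally have "(a k x * (fdiff w k x)^2) powr (s / 2) * (a k x powr (- q)) powr (1 / (q + 1))
       = (a k x powr (q / (q + 1)) * a k x powr (- q * (1 / (q + 1)))) * \<bar>fdiff w k x\<bar> powr s"
      by (simp only: powr_powr e(3)) simp
    also have "a k x powr (q / (q + 1)) * a k x powr (- q * (1 / (q + 1))) = 1"
      using a[of k x] by (simp flip: powr_add)
    finally show ?thesis by simp
  qed
  then have "(\<Sum>(k, x)\<in>edges R. \<bar>fdiff w k x\<bar> powr s) =
    (\<Sum>(k, x)\<in>edges R. (a k x * (fdiff w k x)^2) powr (s / 2) * (a k x powr (- q)) powr (1 / (q + 1)))"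
    by simp
  also have "\<dots> \<le> (\<Sum>(k, x)\<in>edges R. a k x * (fdiff w k x)^2) powr (s / 2) * (\<Sum>(k, x)\<in>edges R. a k x powr (- q)) powr (1 / (q + 1))"
    unfolding case_prod_beta using e q s a by (intro sum_powr_Holder) (auto intro!: mult_nonneg_nonneg less_imp_le[OF a])
  finally show ?thesis by (simp only: powr_mult powr_powr e(2))
qed

text \<open>\<open>A * e0 powr \<epsilon> \<le> \<sigma>\<close> pays for one step, and
  \<open>b * \<sigma> powr \<epsilon> \<le> 1\<close> says that the decay accumulated so far
  outweighs the factor \<open>b ^ j\<close>. The horizon \<open>J\<close> is finite because the
  recursion ends at the lattice scale.\<close>

lemma superlinear_decay:
  fixes e :: "nat \<Rightarrow> real"
  assumes e: "\<And>j. e j \<ge> 0" "e 0 \<le> e0" and rec: "\<And>j. j < J \<Longrightarrow> e (Suc j) \<le> A * b ^ j * e j powr (1 + \<epsilon>)"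
    and par: "A \<ge> 0" "b \<ge> 0" "\<epsilon> > 0" "\<sigma> > 0" "A * e0 powr \<epsilon> \<le> \<sigma>" "b * \<sigma> powr \<epsilon> \<le> 1"
    and j: "j \<le> J"
  shows "e j \<le> e0 * \<sigma> ^ j"
  using j
proof (induction j)
  case (Suc j)
  have e00: "e0 \<ge> 0" using e(1)[of 0] e(2) by linarith
  have sj: "(\<sigma> ^ j) powr \<epsilon> = (\<sigma> powr \<epsilon>) ^ j" using par(4) by (simp add: powr_powr mult.commute flip: powr_realpow)
  have "e (Suc j) \<le> A * b ^ j * e j powr (1 + \<epsilon>)" using Suc by (intro rec) auto
  also have "\<dots> \<le> A * b ^ j * (e0 * \<sigma> ^ j) powr (1 + \<epsilon>)"
    using Suc e par by (intro mult_left_mono powr_mono2) auto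
  also have "(e0 * \<sigma> ^ j) powr (1 + \<epsilon>) = (e0 * e0 powr \<epsilon>) * (\<sigma> ^ j * (\<sigma> powr \<epsilon>) ^ j)"
    using e00 par by (simp add: powr_add powr_mult sj)
  also have "A * b ^ j * \<dots> = (A * e0 powr \<epsilon>) * ((b * \<sigma> powr \<epsilon>) ^ j * (e0 * \<sigma> ^ j))"
    by (simp add: power_mult_distrib)
  also have "\<dots> \<le> \<sigma> * (1 * (e0 * \<sigma> ^ j))"
    using par e00 by (intro mult_mono mult_right_mono power_le_one) auto
  finally show ?case by (simp add: mult.left_commute)
qed (use e in simp)

text \<open>As \<open>2 * R + 1 \<le> 2 * (2 * n + 1)\<close>, passing to the larger cube costs at
  most a factor \<open>2 ^ CARD('d)\<close> in density, beyond the factor 2 for the half.\<close>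

lemma half_card:
  assumes R: "n \<le> R" "R \<le> 2 * n" and half: "card (cube n :: ('d::finite \<Rightarrow> int) set) \<le> 2 * c"
  shows "1 / (2::real) ^ (CARD('d) + 1) * (2 * real R + 1) ^ CARD('d) \<le> real c"
proof -
  have "2 * real R + 1 \<le> 2 * (2 * real n + 1)" using R by simp
  then have "(2 * real R + 1) ^ CARD('d) \<le> (2 * (2 * real n + 1)) ^ CARD('d)" by (intro power_mono) auto
  also have "\<dots> = 2 ^ CARD('d) * real (card (cube n :: ('d \<Rightarrow> int) set))"
    unfolding card_cube power_mult_distrib of_nat_power by (simp add: add.commute)
  also have "\<dots> \<le> 2 ^ CARD('d) * (2 * real c)"
    by (intro mult_left_mono) (use half in linarith, simp)
  finally show ?thesis by (simp add: field_simps)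
qed

lemma half_Poincare:
  fixes w :: "('d::finite \<Rightarrow> int) \<Rightarrow> real"
  assumes w: "\<And>x. w x \<ge> 0" and s: "s > 1" and R: "n \<le> R" "R \<le> 2 * n"
    and half: "card (cube n :: ('d \<Rightarrow> int) set) \<le> 2 * card {x \<in> cube n. w x = 0}"
  shows "(\<Sum>x\<in>cube R. (w x / (2 * real R + 1)) powr s)
    \<le> (2 * s * CARD('d) * 2 ^ (CARD('d) + 1)) powr s * (\<Sum>(k, x)\<in>edges R. \<bar>fdiff w k x\<bar> powr s)"
proof -
  define m where "m = 2 * real R + 1"
  define \<zeta> where "\<zeta> = 1 / (2::real) ^ (CARD('d) + 1)"
  let ?Z = "{x \<in> cube n. w x = 0}"
  have m0: "m > 0" by (simp add: m_def)
  have z: "\<zeta> > 0" by (simp add: \<zeta>_def)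
  have zc: "\<zeta> * m ^ card (UNIV :: 'd set) \<le> real (card ?Z)"
    unfolding \<zeta>_def m_def by (rule half_card[OF R half])
  have "(\<Sum>x\<in>fib R UNIV (\<lambda>_. 0). w x powr s)
    \<le> (2 * s * card (UNIV :: 'd set) / \<zeta> * (2 * real R + 1)) powr s * (\<Sum>(k, x)\<in>fib_edges R UNIV (\<lambda>_. 0). \<bar>fdiff w k x\<bar> powr s)"
    using w s z zc cube_mono[OF R(1)] unfolding m_def
    by (intro Poincare_powr[where Z = ?Z]) (auto simp: fib_UNIV)
  then have "(\<Sum>x\<in>cube R. w x powr s) \<le> ((2 * s * CARD('d) * 2 ^ (CARD('d) + 1)) * m) powr s * (\<Sum>(k, x)\<in>edges R. \<bar>fdiff w k x\<bar> powr s)"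
    by (simp add: fib_UNIV fib_edges_UNIV \<zeta>_def m_def)
  then have "(\<Sum>x\<in>cube R. w x powr s) / m powr s \<le> (2 * s * CARD('d) * 2 ^ (CARD('d) + 1)) powr s * (\<Sum>(k, x)\<in>edges R. \<bar>fdiff w k x\<bar> powr s)"
    using m0 by (simp only: powr_mult) (simp add: field_simps)
  then show ?thesis by (simp add: powr_divide sum_divide_distrib m_def)
qed

text \<open>As long as \<open>n / 2 ^ j \<ge> 2\<close>, rounding down loses at most half. Hence
  \<open>j + 2\<close> in the exponent, where exact halving would give \<open>j + 1\<close>.\<close>

lemma dyadic_radius_gap:
  assumes "2 ^ Suc j \<le> (n::nat)"
  shows "real (n div 2 ^ j) - real (n div 2 ^ Suc j) \<ge> real n * 2 powr (- (real j + 2))"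
    and "n div 2 ^ Suc j < n div 2 ^ j"
proof -
  define y where "y = n div 2 ^ j"
  have y2: "n div 2 ^ Suc j = y div 2" unfolding y_def power_Suc2 div_mult2_eq ..
  have "real n < (real y + 1) * 2 ^ j"
  proof -
    have "n < (y + 1) * 2 ^ j" unfolding y_def by (simp add: dividend_less_div_times)
    then have "real n < real ((y + 1) * 2 ^ j)" by (simp only: of_nat_less_iff)
    then show ?thesis by (simp add: algebra_simps)
  qed
  then have "real n / 2 ^ j < real y + 1" by (simp add: field_simps)
  moreover have "real n \<ge> real (2 ^ Suc j)" using assms by (simp only: of_nat_le_iff)
  then have "real n / 2 ^ j \<ge> 2" by (simp add: field_simps)
  ultimately have y: "real y \<ge> (real n / 2 ^ j) / 2" by simp
  have "2 powr (- (real j + 2)) = 1 / (2 ^ j * 4)"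
    using powr_realpow[of 2 "j + 2"] powr_minus_divide[of "2::real" "real j + 2"] by (simp add: add.commute)
  then have "real n * 2 powr (- (real j + 2)) = (real n / 2 ^ j) / 4" by simp
  also have "\<dots> \<le> real y / 2" using y by simp
  also have "\<dots> \<le> real y - real (y div 2)" by linarith
  finally show "real (n div 2 ^ j) - real (n div 2 ^ Suc j) \<ge> real n * 2 powr (- (real j + 2))"
    by (simp only: y2) (simp add: y_def)
  have "y > 0" using y \<open>real n / 2 ^ j \<ge> 2\<close> by (cases y) auto
  then show "n div 2 ^ Suc j < n div 2 ^ j" unfolding y2 by (simp add: y_def)
qed

text \<open>\<open>\<Lambda>\<close> and \<open>\<mu>\<close> bound the averaged norms of the
  coefficients and of their inverses. Radii shrink from \<open>2 * n\<close> towards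
  \<open>n\<close>, levels rise from 0 towards \<open>K\<close>, and the scaled energies obey a
  recursion in which \<open>\<Lambda>\<close> and \<open>\<mu>\<close> occur only through their
  product \<open>M\<close>. Taking \<open>K\<close> as a multiple of \<open>M powr \<kappa>\<close>
  starts the decay; the final pointwise bound contributes the power 1/2.\<close>

lemma DeGiorgi_sup_bound:
  fixes p q C0 :: real
  assumes d: "CARD('d::finite) \<ge> 3" and pq: "p > 1" "q > 1" "1 / p + 1 / q < 2 / (real CARD('d) - 1)"
    and C0: "C0 > 0"
  shows "\<exists>C>0. \<exists>\<kappa>>0. \<forall>(a :: 'd \<Rightarrow> ('d \<Rightarrow> int) \<Rightarrow> real) v n \<Lambda> \<mu>.
    (\<forall>k x. a k x > 0) \<longrightarrow> n \<ge> 1 \<longrightarrow> \<Lambda> > 0 \<longrightarrow> \<mu> > 0 \<longrightarrow>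
    (\<Sum>(k, x)\<in>edges (2 * n). a k x powr p) \<le> \<Lambda> powr p * real n powr CARD('d) \<longrightarrow>
    (\<Sum>(k, x)\<in>edges (2 * n). a k x powr (- q)) \<le> \<mu> powr q * real n powr CARD('d) \<longrightarrow>
    (\<forall>x. supnorm x < 2 * int n \<longrightarrow> v x > 0 \<longrightarrow> gen a v x \<ge> 0) \<longrightarrow>
    card (cube n :: ('d \<Rightarrow> int) set) \<le> 2 * card {x \<in> cube n. v x \<le> 0} \<longrightarrow>
    (\<Sum>(k, x)\<in>edges (2 * n). a k x * (fdiff (\<lambda>x. max 0 (v x)) k x)^2) \<le> C0 * \<Lambda> * real n powr (real CARD('d) - 2) \<longrightarrow>
    (\<forall>x\<in>cube n. v x \<le> C * ((\<Lambda> * \<mu>) powr \<kappa> + (\<Lambda> * \<mu>) powr (1 / 2)))"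
proof -
  define d where "d = real CARD('d)"
  define s where "s = 2 * q / (q + 1)"
  define t where "t = 1 / (1 / s - 1 / (d - 1))"
  define \<beta> where "\<beta> = t * (1 - 1 / p) / 2"
  define \<epsilon> where "\<epsilon> = \<beta> - 1"
  define \<kappa>0 where "\<kappa>0 = 1 + 1 / p + 2 * \<beta> / s"
  define B where "B = (2 * s * d * 2 ^ (CARD('d) + 1)) powr s"
  have d3: "d \<ge> 3" using d by (simp add: d_def)
  have s1: "s > 1" using pq by (simp add: s_def field_simps)
  have invs: "1 / s = 1 / 2 + (1 / q) / 2" using pq by (simp add: s_def field_simps)
  \<comment> \<open>Together with \<open>1 / s > 1 / 2\<close> this keeps \<open>s\<close> below the
    dimension of the slices, so \<open>t\<close> is a genuine Sobolev exponent.\<close>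
  have id: "1 / (d - 1) \<le> 1 / 2" using d3 by (simp add: field_simps)
  have it: "1 / t = 1 / s - 1 / (d - 1)" by (simp add: t_def)
  have "0 < X \<Longrightarrow> Y \<le> 1 / 2 \<Longrightarrow> 0 < 1 / 2 + X / 2 - Y" for X Y :: real by linarith
  from this[of "1 / q", OF _ id] have "1 / t > 0" unfolding it invs using pq by simp
  then have t0: "t > 0" by simp
  \<comment> \<open>The hypothesis on the exponents is equivalent to
    \<open>1 / t < (1 - 1 / p) / 2\<close>, that is to \<open>\<beta> > 1\<close>.\<close>
  have "1 / p + 1 / q < 2 * (1 / (d - 1))" using pq by (simp add: d_def)
  then have "1 / t < (1 - 1 / p) / 2" unfolding it invs by (simp add: field_simps)
  then have "t * (1 / t) < t * ((1 - 1 / p) / 2)" using t0 by (intro mult_strict_left_mono)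
  then have \<beta>1: "\<beta> > 1" using t0 by (simp add: \<beta>_def)
  then have \<epsilon>0: "\<epsilon> > 0" by (simp add: \<epsilon>_def)
  have "\<beta> * (2 * (1 / t)) = 1 - 1 / p" using t0 by (simp add: \<beta>_def)
  moreover have "2 * (1 / t) = 1 + 1 / q - 2 / (d - 1)" unfolding it invs by simp
  ultimately have "\<beta> * (1 + 1 / q - 2 / (d - 1)) = 1 - 1 / p" by (simp only:)
  then have "\<beta> * (1 + 1 / q - 2 / (d - 1)) * (d - 1) = (1 - 1 / p) * (d - 1)" by (simp only:)
  moreover have "2 / (d - 1) * (d - 1) = 2"
    by (subst times_divide_eq_left, subst nonzero_mult_div_cancel_right) (use d3 in auto)
  then have "(1 + 1 / q - 2 / (d - 1)) * (d - 1) = (1 + 1 / q) * (d - 1) - 2" by (simp only: left_diff_distrib)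
  ultimately have bal: "\<beta> * ((1 + 1 / q) * (d - 1) - 2) = (1 - 1 / p) * (d - 1)" by (simp only: mult.assoc)
  \<comment> \<open>The powers of the radius come, in this order, from the gap of the radii, the
    norm of the coefficients, the gradient sum and the normalisation of the energy.\<close>
  have expo: "- \<kappa>0 + d / p + (d - 2 + d / q) * \<beta> + (2 - d) = 0"
  proof -
    have "2 / s = 1 + 1 / q" using invs by simp
    moreover have "2 * \<beta> / s = \<beta> * (2 / s)" by simp
    ultimately have "2 * \<beta> / s = \<beta> * (1 + 1 / q)" by (simp only:)
    then show ?thesis unfolding \<kappa>0_def using bal by (simp add: algebra_simps add_divide_distrib diff_divide_distrib)
  qed
  have \<kappa>00: "\<kappa>0 > 0" using pq \<beta>1 s1 by (simp add: \<kappa>0_def add_pos_pos)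
  have B0: "B \<ge> 0" by (simp add: B_def)
  obtain C1 where C1: "C1 > 0" and step: "\<And>(a :: 'd \<Rightarrow> ('d \<Rightarrow> int) \<Rightarrow> real) w h R R'.
    (\<And>k x. a k x > 0) \<Longrightarrow> (\<And>x. w x \<ge> 0) \<Longrightarrow> h > 0 \<Longrightarrow> R' < R \<Longrightarrow>
    (\<And>x. supnorm x < int R \<Longrightarrow> max 0 (w x - h) * gen a (\<lambda>x. max 0 (w x - h)) x \<ge> 0) \<Longrightarrow>
    (\<Sum>x\<in>cube R. (w x / (2 * real R + 1)) powr s) \<le> B * (\<Sum>(k, x)\<in>edges R. \<bar>fdiff w k x\<bar> powr s) \<Longrightarrow>
    (\<Sum>(k, x)\<in>edges R'. a k x * (fdiff (\<lambda>x. max 0 (w x - h)) k x)^2)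
      \<le> C1 * h powr (- 2 * \<epsilon>) * (real R - real R') powr (- \<kappa>0)
        * (\<Sum>(k, x)\<in>edges R. a k x powr p) powr (1 / p) * (\<Sum>(k, x)\<in>edges R. \<bar>fdiff w k x\<bar> powr s) powr (2 * \<beta> / s)"
    using DeGiorgi_step[OF assms(1) pq(1) s1 t0 it[unfolded d_def] \<beta>_def \<beta>1 B0]
    unfolding \<epsilon>_def \<kappa>0_def by blast
  define A where "A = C1 * 2 powr (2 * \<epsilon> + 2 * \<kappa>0)"
  define b where "b = 2 powr (2 * \<epsilon> + \<kappa>0)"
  \<comment> \<open>The first entry gives \<open>b * \<sigma> powr \<epsilon> \<le> 1\<close>; the
    second makes \<open>\<sigma> ^ J\<close> at most of order
    \<open>n powr (- 2 * d)\<close>.\<close>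
  define \<xi> where "\<xi> = max ((2 * \<epsilon> + \<kappa>0) / \<epsilon>) (2 * d)"
  define \<sigma> where "\<sigma> = 2 powr (- \<xi>)"
  \<comment> \<open>\<open>K0\<close> and \<open>\<kappa>\<close> solve the smallness condition of
    \<open>superlinear_decay\<close> with equality, see \<open>smallK\<close>.\<close>
  define K0 where "K0 = (A * C0 powr \<epsilon> / \<sigma>) powr (1 / (2 * \<epsilon>))"
  define C2 where "C2 = 5 * B powr (1 / s) * (C0 * 2 powr \<xi>) powr (1 / 2)"
  define \<kappa> where "\<kappa> = \<beta> / (2 * \<epsilon>)"
  have A0: "A > 0" using C1 by (simp add: A_def)
  have K0: "K0 > 0" using A0 C0 by (simp add: K0_def \<sigma>_def)
  have C2: "C2 \<ge> 0" by (simp add: C2_def)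
  have \<sigma>0: "\<sigma> > 0" by (simp add: \<sigma>_def)
  have b\<sigma>: "b * \<sigma> powr \<epsilon> \<le> 1"
  proof -
    have "(2 * \<epsilon> + \<kappa>0) / \<epsilon> \<le> \<xi>" by (simp add: \<xi>_def)
    then have "2 * \<epsilon> + \<kappa>0 - \<xi> * \<epsilon> \<le> 0" using \<epsilon>0 by (simp add: field_simps)
    then have "(2::real) powr (2 * \<epsilon> + \<kappa>0 - \<xi> * \<epsilon>) \<le> 2 powr 0" by (intro powr_mono) auto
    then show ?thesis by (simp add: b_def \<sigma>_def powr_powr flip: powr_add)
  qed
  show ?thesis
  proof (rule exI[of _ "K0 + C2"], rule conjI, use K0 C2 in simp, rule exI[of _ \<kappa>], rule conjI, use \<epsilon>0 \<beta>1 in \<open>simp add: \<kappa>_def\<close>, intro allI impI ballI)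
    fix a :: "'d \<Rightarrow> ('d \<Rightarrow> int) \<Rightarrow> real" and v n \<Lambda> \<mu> and z :: "'d \<Rightarrow> int"
    assume a: "\<forall>k x. a k x > 0" and n1: "n \<ge> 1" and L: "\<Lambda> > 0" "\<mu> > 0"
      and P: "(\<Sum>(k, x)\<in>edges (2 * n). a k x powr p) \<le> \<Lambda> powr p * real n powr CARD('d)"
      and Q: "(\<Sum>(k, x)\<in>edges (2 * n). a k x powr (- q)) \<le> \<mu> powr q * real n powr CARD('d)"
      and sub: "\<forall>x. supnorm x < 2 * int n \<longrightarrow> v x > 0 \<longrightarrow> gen a v x \<ge> 0"
      and half: "card (cube n :: ('d \<Rightarrow> int) set) \<le> 2 * card {x \<in> cube n. v x \<le> 0}"
      and E0: "(\<Sum>(k, x)\<in>edges (2 * n). a k x * (fdiff (\<lambda>x. max 0 (v x)) k x)^2) \<le> C0 * \<Lambda> * real n powr (real CARD('d) - 2)"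
      and z: "z \<in> cube n"
    define M where "M = \<Lambda> * \<mu>"
    define \<nu> where "\<nu> = real n"
    define K where "K = K0 * M powr \<kappa>"
    define R where "R j = n + n div 2 ^ j" for j
    define l where "l j = K * (1 - 2 powr (- real j))" for j
    define h where "h j = K * 2 powr (- (real j + 1))" for j
    define w where "w j x = max 0 (v x - l j)" for j x
    define E where "E j = (\<Sum>(k, x)\<in>edges (R j). a k x * (fdiff (w j) k x)^2)" for j
    define G where "G j = (\<Sum>(k, x)\<in>edges (R j). \<bar>fdiff (w j) k x\<bar> powr s)" for j
    \<comment> \<open>A dimensionless energy: unchanged when the coefficients are multiplied by a
      constant, and with the growth \<open>n powr (d - 2)\<close> of the initial energy divided
      out.\<close>
    define e where "e j = E j * \<mu> * \<nu> powr (2 - d)" for j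
    have M0: "M > 0" using L by (simp add: M_def)
    have \<nu>1: "\<nu> \<ge> 1" using n1 by (simp add: \<nu>_def)
    have K: "K > 0" using K0 M0 by (simp add: K_def)
    have lnn: "l j \<ge> 0" for j
    proof -
      have "(2::real) powr (- real j) \<le> 2 powr 0" by (intro powr_mono) auto
      then show ?thesis using K by (simp add: l_def)
    qed
    have h0: "h j > 0" for j using K by (simp add: h_def)
    have lS: "l (Suc j) = l j + h j" for j
    proof -
      have "(2::real) powr (- real j) = 2 powr (- (real j + 1)) * 2 powr 1" unfolding powr_add[symmetric] by simp
      then show ?thesis by (simp add: l_def h_def algebra_simps)
    qed
    have wS: "w (Suc j) = (\<lambda>x. max 0 (w j x - h j))" for j
      using h0[of j] by (auto simp: w_def lS fun_eq_iff)
    have w0: "w j x \<ge> 0" for j x by (simp add: w_def)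
    have R: "n \<le> R j" "R j \<le> 2 * n" for j by (auto simp: R_def mult_2)
    have E_nn: "E j \<ge> 0" for j unfolding E_def using a by (auto intro!: sum_nonneg mult_nonneg_nonneg simp: less_imp_le)
    have G_nn: "G j \<ge> 0" for j unfolding G_def by (auto intro!: sum_nonneg)
    have e_nn: "e j \<ge> 0" for j unfolding e_def using E_nn L by simp
    have PB: "(\<Sum>x\<in>cube (R j). (w j x / (2 * real (R j) + 1)) powr s) \<le> B * G j" for j
    proof -
      have "card {x \<in> cube n. v x \<le> 0} \<le> card {x \<in> cube n. w j x = 0}"
        using lnn[of j] by (intro card_mono) (auto simp: w_def)
      with half have "card (cube n :: ('d \<Rightarrow> int) set) \<le> 2 * card {x \<in> cube n. w j x = 0}" by linarith
      from half_Poincare[OF w0 s1 R this] show ?thesis unfolding B_def G_def d_def .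
    qed
    have Pj: "(\<Sum>(k, x)\<in>edges (R j). a k x powr p) powr (1 / p) \<le> \<Lambda> * \<nu> powr (d / p)" for j
    proof -
      have "(\<Sum>(k, x)\<in>edges (R j). a k x powr p) \<le> \<Lambda> powr p * \<nu> powr d"
        using edges_mono[OF R(2)[of j]] P unfolding \<nu>_def d_def by (intro order_trans[OF sum_mono2 P]) auto
      then have "(\<Sum>(k, x)\<in>edges (R j). a k x powr p) powr (1 / p) \<le> (\<Lambda> powr p * \<nu> powr d) powr (1 / p)"
        using pq by (intro powr_mono2) (auto intro!: sum_nonneg)
      then show ?thesis using pq L by (simp add: powr_mult powr_powr)
    qed
    have Qj: "(\<Sum>(k, x)\<in>edges (R j). a k x powr (- q)) powr (1 / q) \<le> \<mu> * \<nu> powr (d / q)" for j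
    proof -
      have "(\<Sum>(k, x)\<in>edges (R j). a k x powr (- q)) \<le> \<mu> powr q * \<nu> powr d"
        using edges_mono[OF R(2)[of j]] Q unfolding \<nu>_def d_def by (intro order_trans[OF sum_mono2 Q]) auto
      then have "(\<Sum>(k, x)\<in>edges (R j). a k x powr (- q)) powr (1 / q) \<le> (\<mu> powr q * \<nu> powr d) powr (1 / q)"
        using pq by (intro powr_mono2) (auto intro!: sum_nonneg)
      then show ?thesis using pq L by (simp add: powr_mult powr_powr)
    qed
    have eE: "E j * (\<mu> * \<nu> powr (d / q)) = e j * \<nu> powr (d - 2 + d / q)" for j
    proof -
      have "\<nu> powr (2 - d) * \<nu> powr (d - 2 + d / q) = \<nu> powr (d / q)" unfolding powr_add[symmetric] by simp
      then show ?thesis by (simp add: e_def)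
    qed
    have Gj: "G j \<le> (e j * \<nu> powr (d - 2 + d / q)) powr (s / 2)" for j
    proof -
      have "G j \<le> (E j * (\<Sum>(k, x)\<in>edges (R j). a k x powr (- q)) powr (1 / q)) powr (s / 2)"
        unfolding G_def E_def using a pq by (intro gradient_Holder) (auto simp: s_def)
      also have "\<dots> \<le> (E j * (\<mu> * \<nu> powr (d / q))) powr (s / 2)"
        using Qj[of j] E_nn[of j] s1 by (intro powr_mono2 mult_left_mono mult_nonneg_nonneg) auto
      finally show ?thesis unfolding eE .
    qed
    obtain J where J: "2 ^ J \<le> n" "n < 2 ^ (J + 1)"
      using ex_power_ivl1[of 2 n] n1 by auto
    have rec: "e (Suc j) \<le> (A * K powr (- 2 * \<epsilon>) * M) * b ^ j * e j powr (1 + \<epsilon>)" if j: "j < J" for j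
    proof -
      have "2 ^ Suc j \<le> (2 ^ J :: nat)" using j by (intro power_increasing) auto
      then have jn: "2 ^ Suc j \<le> n" using J by linarith
      note gap = dyadic_radius_gap[OF jn]
      have RR: "R (Suc j) < R j" using gap by (simp add: R_def)
      have N: "real (R j) - real (R (Suc j)) \<ge> \<nu> * 2 powr (- (real j + 2))"
        using gap by (simp add: R_def \<nu>_def)
      have subj: "max 0 (w j x - h j) * gen a (\<lambda>x. max 0 (w j x - h j)) x \<ge> 0" if "supnorm x < int (R j)" for x
      proof -
        have "max 0 (v x - l (Suc j)) * gen a (\<lambda>x. max 0 (v x - l (Suc j))) x \<ge> 0"
          using a sub that R(2)[of j] lnn[of "Suc j"] by (intro gen_truncate) (auto intro: less_imp_le)
        then show ?thesis using wS[of j] by (simp add: w_def[of "Suc j"] fun_eq_iff)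
      qed
      have "E (Suc j) \<le> C1 * h j powr (- 2 * \<epsilon>) * (real (R j) - real (R (Suc j))) powr (- \<kappa>0)
        * (\<Sum>(k, x)\<in>edges (R j). a k x powr p) powr (1 / p) * G j powr (2 * \<beta> / s)"
        unfolding E_def wS G_def using a w0 h0 RR subj PB[of j] unfolding G_def by (intro step) auto
      also have "\<dots> \<le> C1 * h j powr (- 2 * \<epsilon>) * (\<nu> * 2 powr (- (real j + 2))) powr (- \<kappa>0)
        * (\<Lambda> * \<nu> powr (d / p)) * ((e j * \<nu> powr (d - 2 + d / q)) powr (s / 2)) powr (2 * \<beta> / s)"
        using C1 N \<kappa>00 \<nu>1 L Pj[of j] Gj[of j] G_nn[of j] s1 \<beta>1
        by (intro mult_mono powr_mono2 powr_mono2' order_refl mult_nonneg_nonneg) auto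
      also have "((e j * \<nu> powr (d - 2 + d / q)) powr (s / 2)) powr (2 * \<beta> / s) = e j powr (1 + \<epsilon>) * \<nu> powr ((d - 2 + d / q) * \<beta>)"
        using s1 by (simp add: powr_powr powr_mult \<epsilon>_def)
      finally have "E (Suc j) * (\<mu> * \<nu> powr (2 - d)) \<le> (C1 * h j powr (- 2 * \<epsilon>) * (\<nu> * 2 powr (- (real j + 2))) powr (- \<kappa>0)
        * (\<Lambda> * \<nu> powr (d / p)) * (e j powr (1 + \<epsilon>) * \<nu> powr ((d - 2 + d / q) * \<beta>))) * (\<mu> * \<nu> powr (2 - d))"
        using L by (intro mult_right_mono) auto
      also have "\<dots> = C1 * K powr (- 2 * \<epsilon>) * M * e j powr (1 + \<epsilon>)
        * (\<nu> powr (- \<kappa>0) * \<nu> powr (d / p) * \<nu> powr ((d - 2 + d / q) * \<beta>) * \<nu> powr (2 - d))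
        * (2 powr ((real j + 1) * (2 * \<epsilon>)) * 2 powr ((real j + 2) * \<kappa>0))"
      proof -
        have e1: "(2 powr (- (real j + 1))) powr (- 2 * \<epsilon>) = 2 powr ((real j + 1) * (2 * \<epsilon>))"
          and e2: "(2 powr (- (real j + 2))) powr (- \<kappa>0) = 2 powr ((real j + 2) * \<kappa>0)"
          unfolding powr_powr by (simp_all add: algebra_simps)
        show ?thesis unfolding h_def powr_mult e1 e2 M_def by (simp only: mult_ac)
      qed
      \<comment> \<open>scale invariance: the choice of \<open>\<beta>\<close> makes all powers of the radius cancel\<close>
      also have "\<nu> powr (- \<kappa>0) * \<nu> powr (d / p) * \<nu> powr ((d - 2 + d / q) * \<beta>) * \<nu> powr (2 - d) = 1"
        unfolding powr_add[symmetric] expo using \<nu>1 by simp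
      also have "(2::real) powr ((real j + 1) * (2 * \<epsilon>)) * 2 powr ((real j + 2) * \<kappa>0) = 2 powr (2 * \<epsilon> + 2 * \<kappa>0) * b ^ j"
      proof -
        have "b ^ j = 2 powr ((2 * \<epsilon> + \<kappa>0) * real j)" by (simp add: b_def powr_powr flip: powr_realpow)
        then show ?thesis unfolding powr_add[symmetric] by (simp add: algebra_simps flip: powr_add)
      qed
      finally show ?thesis by (simp add: e_def A_def mult_ac)
    qed
    have e0: "e 0 \<le> C0 * M"
    proof -
      have "R 0 = 2 * n" "w 0 = (\<lambda>x. max 0 (v x))" by (auto simp: R_def l_def w_def)
      then have "E 0 \<le> C0 * \<Lambda> * \<nu> powr (d - 2)" using E0 by (simp add: E_def \<nu>_def d_def)
      then have "e 0 \<le> (C0 * \<Lambda> * \<nu> powr (d - 2)) * \<mu> * \<nu> powr (2 - d)"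
        unfolding e_def using L by (intro mult_right_mono) auto
      also have "\<dots> = C0 * M * (\<nu> powr (d - 2) * \<nu> powr (2 - d))" by (simp add: M_def)
      also have "\<nu> powr (d - 2) * \<nu> powr (2 - d) = 1" unfolding powr_add[symmetric] using \<nu>1 by simp
      finally show ?thesis by simp
    qed
    have smallK: "(A * K powr (- 2 * \<epsilon>) * M) * (C0 * M) powr \<epsilon> = \<sigma>"
    proof -
      have "K powr (- 2 * \<epsilon>) = inverse (A * C0 powr \<epsilon> / \<sigma>) * M powr (- \<beta>)"
        using \<epsilon>0 A0 C0 \<sigma>0 M0 by (simp add: K_def K0_def \<kappa>_def powr_mult powr_powr powr_minus field_simps)
      also have "M powr (- \<beta>) = inverse (M * M powr \<epsilon>)"
        using M0 by (simp add: \<epsilon>_def powr_minus powr_diff)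
      finally show ?thesis using A0 C0 M0 \<sigma>0 by (simp add: powr_mult field_simps)
    qed
    have eJ: "e J \<le> (C0 * M) * \<sigma> ^ J"
      using e_nn e0 rec A0 M0 \<epsilon>0 \<sigma>0 smallK b\<sigma> by (intro superlinear_decay[where A = "A * K powr (- 2 * \<epsilon>) * M" and b = b and \<epsilon> = \<epsilon> and J = J]) (auto simp: b_def)
    \<comment> \<open>The dyadic radii cannot be refined below the lattice scale. After \<open>J \<approx> log n\<close> steps the energy has decayed by a power of
      \<open>n\<close> large enough for a crude pointwise bound.\<close>
    have \<sigma>J: "\<sigma> ^ J \<le> 2 powr \<xi> * \<nu> powr (- 2 * d)"
    proof -
      have "real n < real (2 ^ (J + 1))" using J(2) by (simp only: of_nat_less_iff)
      then have n2: "\<nu> / 2 \<le> 2 powr real J" by (simp add: \<nu>_def powr_realpow)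
      have x0: "\<xi> \<ge> 2 * d" "\<xi> \<ge> 0" using d3 by (auto simp: \<xi>_def)
      have "\<sigma> ^ J = (2 powr real J) powr (- \<xi>)" by (simp add: \<sigma>_def powr_powr mult.commute flip: powr_realpow)
      also have "\<dots> \<le> (\<nu> / 2) powr (- \<xi>)" using n2 x0 \<nu>1 by (intro powr_mono2') auto
      also have "\<dots> = 2 powr \<xi> * \<nu> powr (- \<xi>)" by (simp add: powr_divide powr_minus field_simps)
      also have "\<dots> \<le> 2 powr \<xi> * \<nu> powr (- 2 * d)" using x0 \<nu>1 by (intro mult_left_mono powr_mono) auto
      finally show ?thesis .
    qed
    \<comment> \<open>A single value is one summand of the left-hand side of Poincare. The decay
      leaves a factor \<open>n powr (- 2)\<close> in the energy, whose square root compensates the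
      side length \<open>m \<le> 5 * \<nu>\<close>.\<close>
    have "w J z \<le> C2 * M powr (1 / 2)"
    proof -
      define m where "m = 2 * real (R J) + 1"
      have Rn: "R J \<le> 2 * n" using R(2)[of J] .
      then have "real (R J) \<le> 2 * \<nu>" unfolding \<nu>_def by linarith
      then have m: "m > 0" "m \<le> 5 * \<nu>" using \<nu>1 by (auto simp: m_def)
      have "z \<in> cube (R J)" using z cube_mono[OF R(1)[of J]] by auto
      then have "(w J z / m) powr s \<le> (\<Sum>x\<in>cube (R J). (w J x / m) powr s)"
        by (intro member_le_sum) auto
      also have "\<dots> \<le> B * G J" using PB[of J] by (simp add: m_def)
      also have "\<dots> \<le> B * (e J * \<nu> powr (d - 2 + d / q)) powr (s / 2)"
        using Gj[of J] B0 by (intro mult_left_mono) auto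
      also have "\<dots> \<le> B * ((C0 * 2 powr \<xi>) * M * \<nu> powr (- 2)) powr (s / 2)"
      proof (intro mult_left_mono powr_mono2 B0)
        have "d / q \<le> d" using pq d3 by (simp add: field_simps)
        then have "e J * \<nu> powr (d - 2 + d / q) \<le> ((C0 * M) * (2 powr \<xi> * \<nu> powr (- 2 * d))) * \<nu> powr (2 * d - 2)"
          using eJ \<sigma>J e_nn[of J] C0 M0 \<nu>1
          by (intro mult_mono powr_mono order_trans[OF eJ] mult_left_mono) auto
        also have "\<dots> = (C0 * 2 powr \<xi>) * M * (\<nu> powr (- 2 * d) * \<nu> powr (2 * d - 2))" by simp
        also have "\<nu> powr (- 2 * d) * \<nu> powr (2 * d - 2) = \<nu> powr (- 2)" unfolding powr_add[symmetric] by simp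
        finally show "e J * \<nu> powr (d - 2 + d / q) \<le> (C0 * 2 powr \<xi>) * M * \<nu> powr (- 2)" .
      qed (use e_nn s1 in auto)
      finally have "((w J z / m) powr s) powr (1 / s) \<le> (B * ((C0 * 2 powr \<xi>) * M * \<nu> powr (- 2)) powr (s / 2)) powr (1 / s)"
        using s1 by (intro powr_mono2) auto
      then have "w J z / m \<le> B powr (1 / s) * ((C0 * 2 powr \<xi>) powr (1 / 2) * M powr (1 / 2) * (\<nu> powr (- 2)) powr (1 / 2))"
        using s1 w0[of J z] m(1) by (simp add: powr_mult powr_powr)
      also have "(\<nu> powr (- 2)) powr (1 / 2) = 1 / \<nu>" unfolding powr_powr using \<nu>1 by simp
      finally have "w J z \<le> (B powr (1 / s) * ((C0 * 2 powr \<xi>) powr (1 / 2) * M powr (1 / 2) * (1 / \<nu>))) * m"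
        using m(1) by (simp add: pos_divide_le_eq)
      also have "\<dots> \<le> (B powr (1 / s) * ((C0 * 2 powr \<xi>) powr (1 / 2) * M powr (1 / 2) * (1 / \<nu>))) * (5 * \<nu>)"
        using m \<nu>1 by (intro mult_left_mono) auto
      also have "\<dots> = C2 * M powr (1 / 2)" using \<nu>1 by (simp add: C2_def)
      finally show ?thesis .
    qed
    moreover have "l J \<le> K" using K by (simp add: l_def)
    ultimately have "v z \<le> K0 * M powr \<kappa> + C2 * M powr (1 / 2)" by (simp add: w_def K_def)
    also have "\<dots> \<le> (K0 + C2) * (M powr \<kappa> + M powr (1 / 2))"
      using K0 C2 by (simp add: algebra_simps)
    finally show "v z \<le> (K0 + C2) * ((\<Lambda> * \<mu>) powr \<kappa> + (\<Lambda> * \<mu>) powr (1 / 2))" by (simp add: M_def)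
  qed
qed

section \<open>Upper bounds for the logarithm of a positive harmonic function\<close>

text \<open>The cutoff is 1 up to \<open>2 * n\<close> and falls linearly to 0 at
  \<open>4 * n\<close>, with slope \<open>1 / (2 * n)\<close>, so \<open>log_energy\<close> gives 20
  times \<open>1 / (4 * n^2)\<close>. Taking the positive part does not increase
  differences.\<close>

lemma initial_energy:
  fixes a :: "'d::finite \<Rightarrow> ('d \<Rightarrow> int) \<Rightarrow> real"
  assumes a: "\<And>k x. a k x \<ge> 0" and n: "n \<ge> 1"
    and f: "\<And>x. x \<in> cube (4 * n) \<Longrightarrow> f x > 0"
    and harm: "\<And>x. supnorm x < 4 * int n \<Longrightarrow> gen a f x = 0"
  shows "(\<Sum>(k, x)\<in>edges (2 * n). a k x * (fdiff (\<lambda>x. max 0 (- ln (2 * f x))) k x)^2)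
    \<le> 5 / (real n)^2 * (\<Sum>(k, x)\<in>edges (4 * n). a k x)"
proof -
  define \<phi> where "\<phi> c = min 1 (max 0 ((4 * real n - real_of_int c) / (2 * real n)))" for c
  have n0: "real n > 0" using n by simp
  have am: "antimono \<phi>"
    unfolding \<phi>_def using n0 by (intro antimonoI min.mono max.mono divide_right_mono order_refl diff_left_mono) auto
  have R0: "\<phi> (int (4 * n)) = 0" by (simp add: \<phi>_def)
  have one: "\<phi> c = 1" if "c \<le> int (2 * n)" for c
  proof -
    have "real_of_int c \<le> 2 * real n" using that by linarith
    then have "(4 * real n - real_of_int c) / (2 * real n) \<ge> 1" using n0 by (simp add: field_simps)
    then show ?thesis by (simp add: \<phi>_def)
  qed
  have drop: "(\<phi> (c - 1) - \<phi> c)^2 \<le> 1 / (4 * (real n)^2)" for c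
  proof -
    have eq: "(4 * real n - real_of_int (c - 1)) / (2 * real n) = (4 * real n - real_of_int c) / (2 * real n) + 1 / (2 * real n)"
      using n0 by (simp add: field_simps)
    have gen: "\<bar>min 1 (max 0 (X + e)) - min 1 (max 0 X)\<bar> \<le> e" if "e \<ge> 0" for X e :: real
      using that by (auto simp: min_def max_def)
    have "\<bar>\<phi> (c - 1) - \<phi> c\<bar> \<le> 1 / (2 * real n)" unfolding \<phi>_def eq by (rule gen) (use n0 in simp)
    then have "\<bar>\<phi> (c - 1) - \<phi> c\<bar>^2 \<le> (1 / (2 * real n))^2" by (intro power_mono) auto
    then show ?thesis by (simp add: power_divide power_mult_distrib)
  qed
  have "(\<Sum>(k, x)\<in>edges (2 * n). a k x * (fdiff (\<lambda>x. max 0 (- ln (2 * f x))) k x)^2)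
    \<le> (\<Sum>(k, x)\<in>edges (2 * n). a k x * (\<phi> (supnorm (outward k x)))^2 * (fdiff (\<lambda>x. ln (f x)) k x)^2)"
  proof (intro sum_mono, clarify)
    fix k :: 'd and x assume e: "(k, x) \<in> edges (2 * n)"
    then have "(k, x) \<in> edges (4 * n)" using edges_mono[of "2 * n" "4 * n"] by auto
    then have fp: "f x > 0" "f (x(k := x k + 1)) > 0" using edge_ends[of k x "4 * n"] f by auto
    have "\<phi> (supnorm (outward k x)) = 1" using supnorm_outward_edge[OF e] by (intro one)
    moreover have mx: "\<bar>max 0 A - max 0 B\<bar> \<le> \<bar>A - B\<bar>" for A B :: real by (auto simp: max_def)
    have "ln (2 * f x) = ln 2 + ln (f x)" "ln (2 * f (x(k := x k + 1))) = ln 2 + ln (f (x(k := x k + 1)))"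
      using fp by (simp_all add: ln_mult)
    then have "\<bar>fdiff (\<lambda>x. max 0 (- ln (2 * f x))) k x\<bar> \<le> \<bar>fdiff (\<lambda>x. ln (f x)) k x\<bar>"
      unfolding fdiff_def using mx[of "- ln (2 * f (x(k := x k + 1)))" "- ln (2 * f x)"] by linarith
    then have "(fdiff (\<lambda>x. max 0 (- ln (2 * f x))) k x)^2 \<le> (fdiff (\<lambda>x. ln (f x)) k x)^2"
      by (simp add: abs_le_square_iff)
    ultimately show "a k x * (fdiff (\<lambda>x. max 0 (- ln (2 * f x))) k x)^2 \<le> a k x * (\<phi> (supnorm (outward k x)))^2 * (fdiff (\<lambda>x. ln (f x)) k x)^2"
      using a by (simp add: mult_left_mono)
  qed
  also have "\<dots> \<le> (\<Sum>(k, x)\<in>edges (4 * n). a k x * (\<phi> (supnorm (outward k x)))^2 * (fdiff (\<lambda>x. ln (f x)) k x)^2)"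
    using a edges_mono[of "2 * n" "4 * n"] by (intro sum_mono2) auto
  also have "\<dots> \<le> 20 * (\<Sum>(k, x)\<in>edges (4 * n). a k x * (\<phi> (rad k x - 1) - \<phi> (rad k x))^2)"
    using harm by (intro log_energy[OF a f _ am _ R0]) (auto simp: \<phi>_def)
  also have "\<dots> \<le> 20 * (\<Sum>(k, x)\<in>edges (4 * n). a k x * (1 / (4 * (real n)^2)))"
  proof (intro mult_left_mono sum_mono, clarify)
    fix k :: 'd and x :: "'d \<Rightarrow> int"
    show "a k x * (\<phi> (rad k x - 1) - \<phi> (rad k x))^2 \<le> a k x * (1 / (4 * (real n)^2))"
      by (intro mult_left_mono drop a)
  qed simp
  also have "\<dots> = 5 / (real n)^2 * (\<Sum>(k, x)\<in>edges (4 * n). a k x)"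
    by (simp add: case_prod_beta flip: sum_distrib_right sum_divide_distrib)
  finally show ?thesis .
qed

text \<open>For \<open>d = 2\<close> a slice is a line, and \<open>slice_norm 1\<close> is its
  variation plus its average, the right-hand side of \<open>line_bound\<close>.\<close>

lemma planar_slice_bound:
  fixes w :: "('d::finite \<Rightarrow> int) \<Rightarrow> real"
  assumes d: "CARD('d) = 2" and w: "\<And>x. w x \<ge> 0" and y: "y \<in> cube R"
  shows "w y \<le> slice_norm 1 R w k (y k)"
proof -
  have "card (UNIV - {k}) = 1" using d by simp
  then obtain i where i: "UNIV - {k} = {i}" by (rule card_1_singletonE)
  then have ik: "i \<noteq> k" by auto
  have only: "j = k \<or> j = i" for j using i by auto
  have yc: "(((\<lambda>_. 0)(i := c))(k := y k)) = y(i := c)" for c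
    using only ik by (auto simp: fun_eq_iff)
  have "(\<Sum>(j, x)\<in>fib_edges R {i} (\<lambda>_. 0). \<bar>fdiff w j (x(k := y k))\<bar>) = (\<Sum>c\<in>{- int R..<int R}. \<bar>fdiff w i (y(i := c))\<bar>)"
  proof -
    have "fib_edges R {} (\<lambda>_. 0) = ({} :: ('d \<times> ('d \<Rightarrow> int)) set)" by (simp add: fib_edges_def)
    then show ?thesis
      using sum_fib_edges_insert[of "{}" i "\<lambda>j x. \<bar>fdiff w j (x(k := y k))\<bar>" R "\<lambda>_. 0"] by (simp add: yc del: fdiff_upd)
  qed
  moreover have "(\<Sum>x\<in>fib R {i} (\<lambda>_. 0). w (x(k := y k)) / (2 * real R + 1)) = (\<Sum>c\<in>{- int R..int R}. w (y(i := c))) / (2 * real R + 1)"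
    by (subst sum_fib_remove[of i]) (simp_all add: yc sum_divide_distrib)
  ultimately have "slice_norm 1 R w k (y k) = (\<Sum>c\<in>{- int R..<int R}. \<bar>fdiff w i (y(i := c))\<bar>) + (\<Sum>c\<in>{- int R..int R}. w (y(i := c))) / (2 * real R + 1)"
    using w unfolding slice_norm_def i by (simp del: fdiff_upd)
  moreover have "\<bar>y i\<bar> \<le> int R" using y by (simp add: cube_def)
  ultimately show ?thesis using line_bound[of y i R w] by simp
qed

text \<open>Averaging over \<open>n\<close> layers yields one on which \<open>w \<le> V\<close>. The
  part of \<open>v\<close> above \<open>V\<close> then has no Caccioppoli error, so its gradient
  vanishes inside that layer; being 0 on half of the cube, it is 0 throughout.\<close>

lemma planar_sup_bound:
  fixes a :: "'d::finite \<Rightarrow> ('d \<Rightarrow> int) \<Rightarrow> real"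
  assumes d: "CARD('d) = 2" and a: "\<And>k x. a k x > 0" and n: "n \<ge> 1"
    and sub: "\<And>x. supnorm x < 2 * int n \<Longrightarrow> v x > 0 \<Longrightarrow> gen a v x \<ge> 0"
    and half: "card (cube n :: ('d \<Rightarrow> int) set) \<le> 2 * card {x \<in> cube n. v x \<le> 0}"
    and z: "z \<in> cube n"
  shows "v z \<le> 18 / real n * (\<Sum>(k, x)\<in>edges (2 * n). \<bar>fdiff (\<lambda>x. max 0 (v x)) k x\<bar>)"
proof -
  define w where "w x = max 0 (v x)" for x
  define D where "D = (\<Sum>(k, x)\<in>edges (2 * n). \<bar>fdiff w k x\<bar>)"
  \<comment> \<open>18 = 2 * (1 + 8): two directions, the gradient sum \<open>D\<close>, and at most
    \<open>8 * D\<close> from the averages. Here 8 is \<open>2 ^ (CARD('d) + 1)\<close>, the inverse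
    of the density in \<open>half_card\<close>.\<close>
  define V where "V = 18 / real n * D"
  let ?Z = "{x \<in> cube n. v x \<le> 0}"
  have n0: "real n > 0" using n by simp
  have w0: "w x \<ge> 0" for x by (simp add: w_def)
  have D0: "D \<ge> 0" unfolding D_def by (auto intro!: sum_nonneg)
  then have V0: "V \<ge> 0" by (simp add: V_def)
  have P: "(\<Sum>x\<in>cube (2 * n). \<bar>w x\<bar>) / 8 \<le> (4 * real n + 1) * D"
    using Poincare_L1[of UNIV ?Z "2 * n" "\<lambda>_. 0" w "1 / 8"] half_card[OF _ order_refl half] cube_mono[of n "2 * n"] d
    by (auto simp: fib_UNIV fib_edges_UNIV D_def w_def)
  have avg: "(\<Sum>x\<in>cube (2 * n). w x / (2 * real (2 * n) + 1)) \<le> 8 * D"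
    using P w0 n0 by (simp add: pos_divide_le_eq mult_ac flip: sum_divide_distrib)
  define S where "S = {int n<..int (2 * n)}"
  define G where "G c = (\<Sum>k\<in>UNIV. slice_norm 1 (2 * n) w k c + slice_norm 1 (2 * n) w k (- c))" for c
  have "sum G S \<le> CARD('d) * ((\<Sum>(k, x)\<in>edges (2 * n). \<bar>fdiff w k x\<bar> powr 1) + (\<Sum>x\<in>cube (2 * n). (w x / (2 * real (2 * n) + 1)) powr 1))"
    unfolding G_def by (rule sum_slice_norm_layers_le) (auto simp: S_def)
  also have "\<dots> = 2 * (D + (\<Sum>x\<in>cube (2 * n). w x / (2 * real (2 * n) + 1)))"
    using w0 by (simp add: d D_def)
  also have "\<dots> \<le> 18 * D" using avg by simp
  finally have sumG: "sum G S \<le> 18 * D" .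
  have "\<exists>c\<in>S. G c \<le> V"
  proof (rule ccontr)
    assume "\<not> ?thesis"
    then have "(\<Sum>c\<in>S. V) < sum G S" using n by (intro sum_strict_mono) (auto simp: S_def not_le)
    moreover have "(\<Sum>c\<in>S. V) = 18 * D" using n0 by (simp add: S_def V_def)
    ultimately show False using sumG by simp
  qed
  then obtain c where c: "c \<in> S" "G c \<le> V" by blast
  \<comment> \<open>The radius just inside the chosen layer. The layers start at
    \<open>n + 1\<close>, so the cube of radius \<open>n\<close> is still contained.\<close>
  define m where "m = nat (c - 1)"
  have m: "n \<le> m" "m < 2 * n" "c = int m + 1" using c(1) by (auto simp: m_def S_def)
  define w' where "w' x = max 0 (v x - V)" for x
  have "(\<Sum>(k, x)\<in>edges m. a k x * (fdiff w' k x)^2)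
    \<le> 4 / (real (card {c}))^2 * (\<Sum>(k, x) | (k, x) \<in> edges (2 * n) \<and> rad k x \<in> {c}. a k x * (w' (outward k x))^2)"
  proof (rule Caccioppoli_layers)
    fix x :: "'d \<Rightarrow> int" assume "supnorm x < int (2 * n)"
    then show "w' x * gen a w' x \<ge> 0"
      unfolding w'_def using sub V0 a by (intro gen_truncate) (auto intro: less_imp_le)
  qed (use a m in \<open>auto intro: less_imp_le\<close>)
  also have "(\<Sum>(k, x) | (k, x) \<in> edges (2 * n) \<and> rad k x \<in> {c}. a k x * (w' (outward k x))^2) = 0"
  proof (intro sum.neutral ballI, clarify)
    fix k :: 'd and x assume e: "(k, x) \<in> edges (2 * n)" and r: "c = rad k x"
    have oc: "outward k x \<in> cube (2 * n)" using supnorm_outward_edge[OF e] by (simp add: cube_supnorm)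
    have "outward k x k = c \<or> outward k x k = - c" unfolding r by (auto simp: outward_def rad_def)
    then have "slice_norm 1 (2 * n) w k (outward k x k) \<le> slice_norm 1 (2 * n) w k c + slice_norm 1 (2 * n) w k (- c)"
      using slice_norm_nonneg[of 1 "2 * n" w k c] slice_norm_nonneg[of 1 "2 * n" w k "- c"] by auto
    also have "\<dots> \<le> G c" unfolding G_def by (intro member_le_sum add_nonneg_nonneg slice_norm_nonneg) auto
    finally have "slice_norm 1 (2 * n) w k (outward k x k) \<le> V" using c(2) by linarith
    moreover have "w (outward k x) \<le> slice_norm 1 (2 * n) w k (outward k x k)"
      by (rule planar_slice_bound[OF d w0 oc])
    ultimately have "w (outward k x) \<le> V" by linarith
    then show "a k x * (w' (outward k x))^2 = 0" by (simp add: w_def w'_def)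
  qed
  finally have le0: "(\<Sum>(k, x)\<in>edges m. a k x * (fdiff w' k x)^2) \<le> 0" by simp
  have flat: "fdiff w' k x = 0" if "(k, x) \<in> edges m" for k x
  proof -
    have "a k x * (fdiff w' k x)^2 \<le> (\<Sum>(k, x)\<in>edges m. a k x * (fdiff w' k x)^2)"
      using member_le_sum[OF that, of "\<lambda>(k, x). a k x * (fdiff w' k x)^2"] a by (auto simp: less_imp_le)
    then have "a k x * (fdiff w' k x)^2 \<le> 0" using le0 by linarith
    then show ?thesis using a[of k x] by (auto simp: mult_le_0_iff)
  qed
  have "1 / 8 * (\<Sum>x\<in>cube m. \<bar>w' x\<bar>) \<le> (2 * real m + 1) * (\<Sum>(k, x)\<in>edges m. \<bar>fdiff w' k x\<bar>)"
    using Poincare_L1[of UNIV ?Z m "\<lambda>_. 0" w' "1 / 8"] half_card[OF m(1) _ half] m(2) cube_mono[OF m(1)] d V0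
    by (auto simp: fib_UNIV fib_edges_UNIV w'_def)
  also have "(\<Sum>(k, x)\<in>edges m. \<bar>fdiff w' k x\<bar>) = 0" by (intro sum.neutral) (auto simp: flat)
  finally have "(\<Sum>x\<in>cube m. \<bar>w' x\<bar>) \<le> 0" by simp
  moreover have "\<bar>w' z\<bar> \<le> (\<Sum>x\<in>cube m. \<bar>w' x\<bar>)"
    using z cube_mono[OF m(1)] by (intro member_le_sum) auto
  ultimately have "w' z = 0" by simp
  then show ?thesis unfolding w'_def V_def D_def w_def by simp
qed

text \<open>The coordinate form of \<open>avg_norm\<close>, for finite exponents.\<close>

definition enorm :: "real \<Rightarrow> nat \<Rightarrow> ('d::finite \<Rightarrow> ('d \<Rightarrow> int) \<Rightarrow> real) \<Rightarrow> real" where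
  "enorm r R b = (1 / real (card (edges R :: ('d \<times> ('d \<Rightarrow> int)) set)) * (\<Sum>(k, x)\<in>edges R. \<bar>b k x\<bar> powr r)) powr (1 / r)"

text \<open>The interface between sup bounds and decay of oscillation, so that \<open>d = 2\<close>
  and \<open>d \<ge> 3\<close> share the latter. The norms enter as a product, which is unchanged
  when all conductances are multiplied by a constant.\<close>

definition log_bound :: "'d::finite itself \<Rightarrow> real \<Rightarrow> real \<Rightarrow> (real \<Rightarrow> real) \<Rightarrow> bool" where
  "log_bound _ p q V \<longleftrightarrow> (\<forall>(a :: 'd \<Rightarrow> ('d \<Rightarrow> int) \<Rightarrow> real) f n.
     (\<forall>k x. a k x > 0) \<longrightarrow> n \<ge> 1 \<longrightarrow> (\<forall>x\<in>cube (4 * n). f x > 0) \<longrightarrow>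
     (\<forall>x. supnorm x < 4 * int n \<longrightarrow> gen a f x = 0) \<longrightarrow>
     card (cube n :: ('d \<Rightarrow> int) set) \<le> 2 * card {x \<in> cube n. f x \<ge> 1 / 2} \<longrightarrow>
     (\<forall>x\<in>cube n. - ln (2 * f x) \<le> V (enorm p (4 * n) a * enorm q (4 * n) (\<lambda>k x. inverse (a k x)))))"

section \<open>Counting bonds and comparing sums with averages\<close>

lemma edges_nonempty: "n \<ge> 1 \<Longrightarrow> edges n \<noteq> {}"
proof -
  assume "n \<ge> 1"
  then have "(k, \<lambda>_. 0) \<in> edges n" for k :: 'a by (simp add: edges_def cube_def)
  then show ?thesis by blast
qed

lemma card_edges_pos: "n \<ge> 1 \<Longrightarrow> card (edges n :: ('d::finite \<times> ('d \<Rightarrow> int)) set) > 0"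
  by (simp add: card_gt_0_iff edges_nonempty)

text \<open>At most \<open>CARD('d)\<close> bonds start at each point, and the side length satisfies
  \<open>8 * n + 1 \<le> 9 * n\<close>.\<close>

definition vol_const :: "'d::finite itself \<Rightarrow> real" where
  "vol_const _ = real CARD('d) * 9 ^ CARD('d)"

lemma vol_const_ge_1: "vol_const TYPE('d::finite) \<ge> 1"
proof -
  have "1 * 1 \<le> real CARD('d) * 9 ^ CARD('d)"
    by (intro mult_mono one_le_power) (auto simp: Suc_le_eq)
  then show ?thesis by (simp add: vol_const_def)
qed

lemma card_edges_le:
  assumes n: "n \<ge> 1"
  shows "real (card (edges (4 * n) :: ('d::finite \<times> ('d \<Rightarrow> int)) set)) \<le> vol_const TYPE('d) * real n ^ CARD('d)"
proof -
  have "card (edges (4 * n) :: ('d \<times> ('d \<Rightarrow> int)) set) \<le> card ((UNIV :: 'd set) \<times> (cube (4 * n) :: ('d \<Rightarrow> int) set))"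
    by (intro card_mono) (auto simp: edges_def)
  then have "real (card (edges (4 * n) :: ('d \<times> ('d \<Rightarrow> int)) set)) \<le> real CARD('d) * (2 * real (4 * n) + 1) ^ CARD('d)"
    unfolding card_cartesian_product card_cube by (simp flip: of_nat_le_iff[where 'a = real] add: add.commute)
  also have "\<dots> \<le> real CARD('d) * (9 * real n) ^ CARD('d)"
    using n by (intro mult_left_mono power_mono) auto
  finally show ?thesis by (simp add: vol_const_def power_mult_distrib)
qed

lemma enorm_pos:
  assumes "n \<ge> 1" "\<And>k x. b k x > 0"
  shows "enorm r n (b :: 'd::finite \<Rightarrow> ('d \<Rightarrow> int) \<Rightarrow> real) > 0"
proof -
  have "(\<Sum>(k, x)\<in>edges n. \<bar>b k x\<bar> powr r) > 0"
    using edges_nonempty[OF assms(1)] assms(2) by (intro sum_pos) (auto simp: less_imp_neq[symmetric])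
  then show ?thesis using edges_nonempty[OF assms(1), where 'a = 'd] unfolding enorm_def by simp
qed

lemma sum_powr_le_enorm:
  fixes b :: "'d::finite \<Rightarrow> ('d \<Rightarrow> int) \<Rightarrow> real"
  assumes n: "n \<ge> 1" and b: "\<And>k x. b k x > 0" and r: "r \<ge> 1"
  shows "(\<Sum>(k, x)\<in>edges (4 * n). b k x powr r) \<le> (vol_const TYPE('d) * enorm r (4 * n) b) powr r * real n powr CARD('d)"
proof -
  define S where "S = (\<Sum>(k, x)\<in>edges (4 * n). \<bar>b k x\<bar> powr r)"
  define N where "N = real (card (edges (4 * n) :: ('d \<times> ('d \<Rightarrow> int)) set))"
  let ?c = "vol_const TYPE('d)"
  have N: "N > 0" using card_edges_pos[of "4 * n", where 'd = 'd] n by (simp add: N_def)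
  have S: "S \<ge> 0" unfolding S_def by (auto intro!: sum_nonneg)
  have e: "enorm r (4 * n) b powr r = S / N"
    using r S N by (simp add: enorm_def powr_powr flip: S_def N_def)
  have "(\<Sum>(k, x)\<in>edges (4 * n). b k x powr r) = S"
    unfolding S_def using b by (intro sum.cong) (auto simp: less_imp_le)
  also have "S = N * (S / N)" using N by simp
  also have "\<dots> \<le> (?c * real n ^ CARD('d)) * (S / N)"
    using card_edges_le[OF n, where 'd = 'd] S N by (intro mult_right_mono) (auto simp: N_def)
  \<comment> \<open>As \<open>vol_const\<close> is at least 1 and \<open>r \<ge> 1\<close>, it may
    be put under the power; so it multiplies the norm itself, whatever \<open>r\<close> is.\<close>
  also have "\<dots> \<le> (?c powr r * real n ^ CARD('d)) * (S / N)"
    using powr_mono[OF r vol_const_ge_1[where 'd = 'd]] vol_const_ge_1[where 'd = 'd] S N by (intro mult_right_mono) auto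
  also have "\<dots> = (?c * enorm r (4 * n) b) powr r * real n powr CARD('d)"
    using n by (simp add: powr_mult e powr_realpow)
  finally show ?thesis .
qed

text \<open>Hoelder against the constant 1. It expresses the initial energy bound, which involves
  the plain sum of the coefficients, by the norm with exponent \<open>p\<close>.\<close>

lemma sum_le_enorm:
  fixes b :: "'d::finite \<Rightarrow> ('d \<Rightarrow> int) \<Rightarrow> real"
  assumes n: "n \<ge> 1" and b: "\<And>k x. b k x > 0" and r: "r > 1"
  shows "(\<Sum>(k, x)\<in>edges (4 * n). b k x) \<le> vol_const TYPE('d) * enorm r (4 * n) b * real n powr CARD('d)"
proof -
  define S where "S = (\<Sum>(k, x)\<in>edges (4 * n). \<bar>b k x\<bar> powr r)"
  define N where "N = real (card (edges (4 * n) :: ('d \<times> ('d \<Rightarrow> int)) set))"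
  have N: "N > 0" using card_edges_pos[of "4 * n", where 'd = 'd] n by (simp add: N_def)
  have S: "S \<ge> 0" unfolding S_def by (auto intro!: sum_nonneg)
  have "(\<Sum>(k, x)\<in>edges (4 * n). b k x) = (\<Sum>(k, x)\<in>edges (4 * n). (\<bar>b k x\<bar> powr r) powr (1 / r) * 1 powr (1 - 1 / r))"
    using b r by (intro sum.cong) (auto simp: powr_powr less_imp_le)
  also have "\<dots> \<le> S powr (1 / r) * (\<Sum>(k, x)\<in>(edges (4 * n) :: ('d \<times> ('d \<Rightarrow> int)) set). 1) powr (1 - 1 / r)"
    unfolding S_def case_prod_beta using r by (intro sum_powr_Holder) auto
  also have "\<dots> = S powr (1 / r) * N powr (1 - 1 / r)" by (simp add: N_def case_prod_beta)
  also have "\<dots> = N * enorm r (4 * n) b"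
    using N by (simp add: enorm_def powr_divide powr_diff flip: S_def N_def)
  also have "\<dots> \<le> (vol_const TYPE('d) * real n ^ CARD('d)) * enorm r (4 * n) b"
    using card_edges_le[OF n, where 'd = 'd] enorm_pos[of "4 * n" b r] n b by (intro mult_right_mono) (auto simp: N_def less_imp_le)
  finally show ?thesis using n by (simp add: powr_realpow mult_ac)
qed

text \<open>In two dimensions the factor \<open>n powr (- 2)\<close> of the initial energy cancels
  the number of bonds. Cauchy-Schwarz then bounds the gradient sum by roots of the two averages,
  whence the square root of their product.\<close>

lemma log_bound_planar:
  assumes d: "CARD('d::finite) = 2"
  shows "\<exists>c\<ge>0. log_bound TYPE('d) 1 1 (\<lambda>M. c * sqrt M)"
proof -
  define C where "C = vol_const TYPE('d)"
  have C1: "C \<ge> 1" unfolding C_def by (rule vol_const_ge_1)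
  show ?thesis
  proof (rule exI[of _ "18 * sqrt 5 * C"], intro conjI)
    show "18 * sqrt 5 * C \<ge> 0" using C1 by simp
    show "log_bound TYPE('d) 1 1 (\<lambda>M. 18 * sqrt 5 * C * sqrt M)"
      unfolding log_bound_def
    proof (intro allI impI ballI)
      fix a :: "'d \<Rightarrow> ('d \<Rightarrow> int) \<Rightarrow> real" and f n and z :: "'d \<Rightarrow> int"
      assume a: "\<forall>k x. a k x > 0" and n: "n \<ge> 1" and f: "\<forall>x\<in>cube (4 * n). f x > 0"
        and harm: "\<forall>x. supnorm x < 4 * int n \<longrightarrow> gen a f x = 0"
        and half: "card (cube n :: ('d \<Rightarrow> int) set) \<le> 2 * card {x \<in> cube n. f x \<ge> 1 / 2}" and z: "z \<in> cube n"
      define v where "v x = - ln (2 * f x)" for x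
      define w where "w x = max 0 (v x)" for x
      define N1 where "N1 = enorm 1 (4 * n) a"
      define N2 where "N2 = enorm 1 (4 * n) (\<lambda>k x. inverse (a k x))"
      define \<nu> where "\<nu> = real n"
      define E where "E = (\<Sum>(k, x)\<in>edges (2 * n). a k x * (fdiff w k x)^2)"
      have \<nu>: "\<nu> > 0" using n by (simp add: \<nu>_def)
      have N: "N1 > 0" "N2 > 0" unfolding N1_def N2_def using a n by (auto intro!: enorm_pos)
      have sub: "gen a v x \<ge> 0" if "supnorm x < 2 * int n" for x
        unfolding v_def using a f that harm by (intro gen_neg_ln[where R = "4 * n"]) (auto intro: less_imp_le)
      have "{x \<in> cube n. f x \<ge> 1 / 2} \<subseteq> {x \<in> cube n. v x \<le> 0}"
        by (auto simp: v_def)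
      then have "card {x \<in> cube n. f x \<ge> 1 / 2} \<le> card {x \<in> cube n. v x \<le> 0}"
        by (intro card_mono) auto
      with half have half': "card (cube n :: ('d \<Rightarrow> int) set) \<le> 2 * card {x \<in> cube n. v x \<le> 0}" by linarith
      have S1: "(\<Sum>(k, x)\<in>edges (4 * n). a k x) \<le> C * N1 * \<nu>^2"
        using sum_powr_le_enorm[OF n, of a 1] a C1 N d n
        by (simp add: C_def N1_def \<nu>_def powr_realpow less_imp_le abs_mult flip: powr_numeral)
      have S2: "(\<Sum>(k, x)\<in>edges (4 * n). inverse (a k x)) \<le> C * N2 * \<nu>^2"
        using sum_powr_le_enorm[OF n, of "\<lambda>k x. inverse (a k x)" 1] a C1 N d n
        by (simp add: C_def N2_def \<nu>_def powr_realpow less_imp_le abs_mult flip: powr_numeral)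
      have "E \<le> 5 / \<nu>^2 * (\<Sum>(k, x)\<in>edges (4 * n). a k x)"
        unfolding E_def w_def v_def \<nu>_def using a n f harm by (intro initial_energy) (auto intro: less_imp_le)
      also have "\<dots> \<le> 5 / \<nu>^2 * (C * N1 * \<nu>^2)" by (intro mult_left_mono S1) simp
      finally have E: "E \<le> 5 * C * N1" using \<nu> by (simp add: field_simps)
      have E0: "E \<ge> 0" unfolding E_def using a by (auto intro!: sum_nonneg mult_nonneg_nonneg simp: less_imp_le)
      have "(\<Sum>(k, x)\<in>edges (2 * n). \<bar>fdiff w k x\<bar>)
        = (\<Sum>(k, x)\<in>edges (2 * n). (a k x * (fdiff w k x)^2) powr (1 / 2) * inverse (a k x) powr (1 / 2))"
      proof (intro sum.cong refl, clarify)
        fix k x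
        have "(a k x * (fdiff w k x)^2) powr (1 / 2) * inverse (a k x) powr (1 / 2) = ((a k x * inverse (a k x)) * (fdiff w k x)^2) powr (1 / 2)"
          unfolding powr_mult[symmetric] by (simp add: mult_ac)
        also have "a k x * inverse (a k x) = 1" using a[rule_format, of k x] by simp
        finally show "\<bar>fdiff w k x\<bar> = (a k x * (fdiff w k x)^2) powr (1 / 2) * inverse (a k x) powr (1 / 2)"
          by (simp add: powr_half_sqrt)
      qed
      also have "\<dots> \<le> E powr (1 / 2) * (\<Sum>(k, x)\<in>edges (2 * n). inverse (a k x)) powr (1 / 2)"
        unfolding E_def case_prod_beta using a by (intro sum_powr_Holder) (auto intro!: mult_nonneg_nonneg simp: less_imp_le)
      also have "\<dots> \<le> (5 * C * N1) powr (1 / 2) * (C * N2 * \<nu>^2) powr (1 / 2)"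
      proof (intro mult_mono powr_mono2 E E0)
        have "(\<Sum>(k, x)\<in>edges (2 * n). inverse (a k x)) \<le> (\<Sum>(k, x)\<in>edges (4 * n). inverse (a k x))"
          using a edges_mono[of "2 * n" "4 * n"] by (intro sum_mono2) (auto simp: less_imp_le)
        then show "(\<Sum>(k, x)\<in>edges (2 * n). inverse (a k x)) \<le> C * N2 * \<nu>^2" using S2 by linarith
      qed (use a in \<open>auto intro!: sum_nonneg simp: less_imp_le\<close>)
      also have "\<dots> = sqrt ((5 * C * N1) * (C * N2 * \<nu>^2))"
        using C1 N \<nu> by (simp add: powr_half_sqrt real_sqrt_mult)
      also have "\<dots> = sqrt (5 * (C * \<nu>)^2 * (N1 * N2))" by (simp add: power2_eq_square mult_ac)
      also have "\<dots> = sqrt 5 * (C * \<nu>) * sqrt (N1 * N2)" using C1 \<nu> by (simp add: real_sqrt_mult)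
      finally have D: "(\<Sum>(k, x)\<in>edges (2 * n). \<bar>fdiff w k x\<bar>) \<le> sqrt 5 * (C * \<nu>) * sqrt (N1 * N2)" .
      have "v z \<le> 18 / \<nu> * (\<Sum>(k, x)\<in>edges (2 * n). \<bar>fdiff w k x\<bar>)"
        unfolding w_def \<nu>_def using a sub half' z by (intro planar_sup_bound[OF d _ n, of a v z]) auto
      also have "\<dots> \<le> 18 / \<nu> * (sqrt 5 * (C * \<nu>) * sqrt (N1 * N2))"
        using \<nu> by (intro mult_left_mono D) auto
      also have "\<dots> = 18 * sqrt 5 * C * sqrt (N1 * N2)" using \<nu> by simp
      finally show "- ln (2 * f z) \<le> 18 * sqrt 5 * C * sqrt (enorm 1 (4 * n) a * enorm 1 (4 * n) (\<lambda>k x. inverse (a k x)))"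
        by (simp add: v_def N1_def N2_def)
    qed
  qed
qed

text \<open>\<open>DeGiorgi_sup_bound\<close> with \<open>C0 = 5\<close> from
  \<open>initial_energy\<close>. \<open>\<Lambda>\<close> and \<open>\<mu>\<close> are the norms
  times the volume constant \<open>B\<close>, hence \<open>c = B^2\<close>.\<close>

lemma log_bound_high:
  fixes p q :: real
  assumes d: "CARD('d::finite) \<ge> 3" and pq: "p > 1" "q > 1" "1 / p + 1 / q < 2 / (real CARD('d) - 1)"
  shows "\<exists>C>0. \<exists>c>0. \<exists>\<kappa>>0. log_bound TYPE('d) p q (\<lambda>M. C * ((c * M) powr \<kappa> + (c * M) powr (1 / 2)))"
proof -
  have "(5::real) > 0" by simp
  from DeGiorgi_sup_bound[OF d pq this] obtain C \<kappa> where C: "C > 0" "\<kappa> > 0" and bnd: "\<forall>(a :: 'd \<Rightarrow> ('d \<Rightarrow> int) \<Rightarrow> real) v n \<Lambda> \<mu>.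
    (\<forall>k x. a k x > 0) \<longrightarrow> n \<ge> 1 \<longrightarrow> \<Lambda> > 0 \<longrightarrow> \<mu> > 0 \<longrightarrow>
    (\<Sum>(k, x)\<in>edges (2 * n). a k x powr p) \<le> \<Lambda> powr p * real n powr CARD('d) \<longrightarrow>
    (\<Sum>(k, x)\<in>edges (2 * n). a k x powr (- q)) \<le> \<mu> powr q * real n powr CARD('d) \<longrightarrow>
    (\<forall>x. supnorm x < 2 * int n \<longrightarrow> v x > 0 \<longrightarrow> gen a v x \<ge> 0) \<longrightarrow>
    card (cube n :: ('d \<Rightarrow> int) set) \<le> 2 * card {x \<in> cube n. v x \<le> 0} \<longrightarrow>
    (\<Sum>(k, x)\<in>edges (2 * n). a k x * (fdiff (\<lambda>x. max 0 (v x)) k x)^2) \<le> 5 * \<Lambda> * real n powr (real CARD('d) - 2) \<longrightarrow>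
    (\<forall>x\<in>cube n. v x \<le> C * ((\<Lambda> * \<mu>) powr \<kappa> + (\<Lambda> * \<mu>) powr (1 / 2)))"
    by (elim exE conjE) (rule that)
  define B where "B = vol_const TYPE('d)"
  have B1: "B \<ge> 1" unfolding B_def by (rule vol_const_ge_1)
  have "log_bound TYPE('d) p q (\<lambda>M. C * ((B^2 * M) powr \<kappa> + (B^2 * M) powr (1 / 2)))"
    unfolding log_bound_def
  proof (intro allI impI ballI)
    fix a :: "'d \<Rightarrow> ('d \<Rightarrow> int) \<Rightarrow> real" and f n and z :: "'d \<Rightarrow> int"
    assume a: "\<forall>k x. a k x > 0" and n: "n \<ge> 1" and f: "\<forall>x\<in>cube (4 * n). f x > 0"
      and harm: "\<forall>x. supnorm x < 4 * int n \<longrightarrow> gen a f x = 0"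
      and half: "card (cube n :: ('d \<Rightarrow> int) set) \<le> 2 * card {x \<in> cube n. f x \<ge> 1 / 2}" and z: "z \<in> cube n"
    define v where "v x = - ln (2 * f x)" for x
    define N1 where "N1 = enorm p (4 * n) a"
    define N2 where "N2 = enorm q (4 * n) (\<lambda>k x. inverse (a k x))"
    define \<nu> where "\<nu> = real n"
    have \<nu>: "\<nu> > 0" using n by (simp add: \<nu>_def)
    have N: "N1 > 0" "N2 > 0" unfolding N1_def N2_def using a n by (auto intro!: enorm_pos)
    have sub: "gen a v x \<ge> 0" if "supnorm x < 2 * int n" for x
      unfolding v_def using a f that harm by (intro gen_neg_ln[where R = "4 * n"]) (auto intro: less_imp_le)
    have "{x \<in> cube n. f x \<ge> 1 / 2} \<subseteq> {x \<in> cube n. v x \<le> 0}"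
      by (auto simp: v_def)
    then have "card {x \<in> cube n. f x \<ge> 1 / 2} \<le> card {x \<in> cube n. v x \<le> 0}"
      by (intro card_mono) auto
    with half have half': "card (cube n :: ('d \<Rightarrow> int) set) \<le> 2 * card {x \<in> cube n. v x \<le> 0}" by linarith
    have e24: "(\<Sum>(k, x)\<in>edges (2 * n). F k x) \<le> (\<Sum>(k, x)\<in>edges (4 * n). F k x)"
      if "\<And>k x. F k x \<ge> (0::real)" for F :: "'d \<Rightarrow> ('d \<Rightarrow> int) \<Rightarrow> real"
      using that edges_mono[of "2 * n" "4 * n"] by (intro sum_mono2) auto
    have S1: "(\<Sum>(k, x)\<in>edges (2 * n). a k x powr p) \<le> (B * N1) powr p * real n powr CARD('d)"
      using order_trans[OF e24 sum_powr_le_enorm[OF n, of a p]] a pq by (simp add: B_def N1_def)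
    have "(\<Sum>(k, x)\<in>edges (2 * n). inverse (a k x) powr q) \<le> (B * N2) powr q * real n powr CARD('d)"
      using order_trans[OF e24 sum_powr_le_enorm[OF n, of "\<lambda>k x. inverse (a k x)" q]] a pq by (simp add: B_def N2_def)
    then have S2: "(\<Sum>(k, x)\<in>edges (2 * n). a k x powr (- q)) \<le> (B * N2) powr q * real n powr CARD('d)"
      by (simp add: powr_minus inverse_powr)
    have "(\<Sum>(k, x)\<in>edges (2 * n). a k x * (fdiff (\<lambda>x. max 0 (v x)) k x)^2) \<le> 5 / \<nu>^2 * (\<Sum>(k, x)\<in>edges (4 * n). a k x)"
      unfolding v_def \<nu>_def using a n f harm by (intro initial_energy) (auto intro: less_imp_le)
    also have "\<dots> \<le> 5 / \<nu>^2 * (B * N1 * \<nu> powr CARD('d))"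
      unfolding B_def N1_def \<nu>_def using a pq by (intro mult_left_mono sum_le_enorm[OF n]) auto
    also have "\<dots> = 5 * (B * N1) * \<nu> powr (real CARD('d) - 2)"
      using \<nu> by (simp add: powr_diff)
    finally have E: "(\<Sum>(k, x)\<in>edges (2 * n). a k x * (fdiff (\<lambda>x. max 0 (v x)) k x)^2) \<le> 5 * (B * N1) * real n powr (real CARD('d) - 2)"
      by (simp add: \<nu>_def)
    have "v z \<le> C * (((B * N1) * (B * N2)) powr \<kappa> + ((B * N1) * (B * N2)) powr (1 / 2))"
      using a B1 N sub by (intro bnd[rule_format, OF _ n _ _ S1 S2 _ half' E z]) auto
    then show "- ln (2 * f z) \<le> C * ((B^2 * (enorm p (4 * n) a * enorm q (4 * n) (\<lambda>k x. inverse (a k x)))) powr \<kappa>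
        + (B^2 * (enorm p (4 * n) a * enorm q (4 * n) (\<lambda>k x. inverse (a k x)))) powr (1 / 2))"
      by (simp add: v_def N1_def N2_def power2_eq_square mult_ac)
  qed
  moreover have "B^2 > 0" using B1 by simp
  ultimately show ?thesis using C by blast
qed

section \<open>Decay of oscillation\<close>

lemma gen_affine:
  "gen a (\<lambda>x. c * U x + e) x = c * gen a U (x :: 'd::finite \<Rightarrow> int)"
  unfolding gen_def sum_distrib_left by (intro sum.cong refl) (simp add: algebra_simps)

text \<open>Adding \<open>e\<close> makes \<open>f\<close> strictly positive, as the logarithm
  requires, and preserves harmonicity and the half-box condition. The bound does not involve
  \<open>e\<close>, which may therefore tend to 0.\<close>

lemma log_bound_lower:
  fixes a :: "'d::finite \<Rightarrow> ('d \<Rightarrow> int) \<Rightarrow> real"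
  assumes V: "log_bound TYPE('d) p q V" and a: "\<And>k x. a k x > 0" and n: "n \<ge> 1"
    and f: "\<And>x. x \<in> cube (4 * n) \<Longrightarrow> f x \<ge> 0" and harm: "\<And>x. supnorm x < 4 * int n \<Longrightarrow> gen a f x = 0"
    and half: "card (cube n :: ('d \<Rightarrow> int) set) \<le> 2 * card {x \<in> cube n. f x \<ge> 1 / 2}"
    and z: "z \<in> cube n"
  shows "f z \<ge> exp (- V (enorm p (4 * n) a * enorm q (4 * n) (\<lambda>k x. inverse (a k x)))) / 2"
proof (rule field_le_epsilon)
  fix e :: real assume e: "e > 0"
  let ?M = "enorm p (4 * n) a * enorm q (4 * n) (\<lambda>k x. inverse (a k x))"
  define g where "g x = f x + e" for x
  have zc: "z \<in> cube (4 * n)" using z cube_mono[of n "4 * n"] by auto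
  have gp: "g x > 0" if "x \<in> cube (4 * n)" for x using f[OF that] e by (simp add: g_def)
  have gh: "gen a g x = 0" if "supnorm x < 4 * int n" for x
    using gen_affine[of a 1 f e x] harm[OF that] unfolding g_def by simp
  have "{x \<in> cube n. f x \<ge> 1 / 2} \<subseteq> {x \<in> cube n. g x \<ge> 1 / 2}" using e by (auto simp: g_def)
  then have "card {x \<in> cube n. f x \<ge> 1 / 2} \<le> card {x \<in> cube n. g x \<ge> 1 / 2}"
    by (intro card_mono) auto
  then have gc: "card (cube n :: ('d \<Rightarrow> int) set) \<le> 2 * card {x \<in> cube n. g x \<ge> 1 / 2}" using half by linarith
  have "- ln (2 * g z) \<le> V ?M"
    using V[unfolded log_bound_def, rule_format, of a n g z] a n gp gh gc z by blast
  then have "exp (- V ?M) \<le> exp (ln (2 * g z))" by simp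
  also have "\<dots> = 2 * g z" using gp[OF zc] by simp
  finally show "exp (- V ?M) / 2 \<le> f z + e" by (simp add: g_def)
qed

lemma log_bound_oscillation:
  fixes a :: "'d::finite \<Rightarrow> ('d \<Rightarrow> int) \<Rightarrow> real"
  assumes V: "log_bound TYPE('d) p q V" and a: "\<And>k x. a k x > 0" and n: "n \<ge> 1"
    and harm: "\<And>x. supnorm x < 4 * int n \<Longrightarrow> gen a U x = 0"
  shows "Max (U ` cube n) - Min (U ` cube n) \<le>
    (1 - exp (- V (enorm p (4 * n) a * enorm q (4 * n) (\<lambda>k x. inverse (a k x)))) / 2)
    * (Max (U ` cube (4 * n)) - Min (U ` cube (4 * n)))"
proof -
  let ?\<delta> = "exp (- V (enorm p (4 * n) a * enorm q (4 * n) (\<lambda>k x. inverse (a k x)))) / 2"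
  define lo where "lo = Min (U ` cube (4 * n))"
  define hi where "hi = Max (U ` cube (4 * n))"
  have ne: "cube m \<noteq> ({} :: ('d \<Rightarrow> int) set)" for m
    using card_cube[of m, where 'd = 'd] by auto
  have sub: "cube n \<subseteq> (cube (4 * n) :: ('d \<Rightarrow> int) set)" by (intro cube_mono) simp
  have lohi: "lo \<le> U x" "U x \<le> hi" if "x \<in> cube (4 * n)" for x
    using that by (auto simp: lo_def hi_def)
  have le: "Max (U ` cube n) \<le> y" if "\<And>x. x \<in> cube n \<Longrightarrow> U x \<le> y" for y
    using that ne by (subst Max_le_iff) auto
  have ge: "y \<le> Min (U ` cube n)" if "\<And>x. x \<in> cube n \<Longrightarrow> y \<le> U x" for y
    using that ne by (subst Min_ge_iff) auto
  have hi_n: "Max (U ` cube n) \<le> hi" using lohi sub by (intro le) auto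
  have lo_n: "lo \<le> Min (U ` cube n)" using lohi sub by (intro ge) auto
  have "lo \<le> hi" using lohi ne[of "4 * n"] by fastforce
  \<comment> \<open>The normalisation in the second case divides by the oscillation.\<close>
  then consider "hi - lo = 0" | "hi - lo > 0" by linarith
  then show ?thesis
  proof cases
    case 1
    have "(1 - ?\<delta>) * (hi - lo) = 0" unfolding 1 by simp
    then show ?thesis using hi_n lo_n 1 unfolding lo_def[symmetric] hi_def[symmetric] by linarith
  next
    case 2
    define D where "D = hi - lo"
    have D: "D > 0" using 2 by (simp add: D_def)
    define f where "f x = (1 / D) * U x + (- lo / D)" for x
    define g where "g x = (- 1 / D) * U x + hi / D" for x
    have fg: "g x = 1 - f x" for x
    proof -
      have "f x + g x = (hi - lo) / D" by (simp add: f_def g_def diff_divide_distrib)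
      also have "\<dots> = 1" using D unfolding D_def by simp
      finally show ?thesis by simp
    qed
    have f0: "f x \<ge> 0" "g x \<ge> 0" if "x \<in> cube (4 * n)" for x
      using lohi[OF that] D by (auto simp: f_def g_def field_simps)
    have h: "gen a f x = 0" "gen a g x = 0" if "supnorm x < 4 * int n" for x
      unfolding f_def g_def gen_affine harm[OF that] by simp_all
    have "cube n = {x \<in> cube n. f x \<ge> 1 / 2} \<union> {x \<in> cube n. g x \<ge> 1 / 2}" by (auto simp: fg)
    then have "card (cube n :: ('d \<Rightarrow> int) set) \<le> card {x \<in> cube n. f x \<ge> 1 / 2} + card {x \<in> cube n. g x \<ge> 1 / 2}"
      using card_Un_le[of "{x \<in> cube n. f x \<ge> 1 / 2}" "{x \<in> cube n. g x \<ge> 1 / 2}"] by simp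
    then consider "card (cube n :: ('d \<Rightarrow> int) set) \<le> 2 * card {x \<in> cube n. f x \<ge> 1 / 2}"
      | "card (cube n :: ('d \<Rightarrow> int) set) \<le> 2 * card {x \<in> cube n. g x \<ge> 1 / 2}" by linarith
    then have "Max (U ` cube n) - Min (U ` cube n) \<le> (1 - ?\<delta>) * D"
    proof cases
      case 1
      have "lo + ?\<delta> * D \<le> U x" if "x \<in> cube n" for x
        using log_bound_lower[OF V a n f0(1) h(1) 1 that] D by (simp add: f_def field_simps)
      from ge[OF this] hi_n show ?thesis by (simp add: D_def algebra_simps)
    next
      case 2
      have "U x \<le> hi - ?\<delta> * D" if "x \<in> cube n" for x
        using log_bound_lower[OF V a n f0(2) h(2) 2 that] D by (simp add: g_def field_simps)
      from le[OF this] lo_n show ?thesis by (simp add: D_def algebra_simps)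
    qed
    then show ?thesis by (simp add: D_def hi_def lo_def)
  qed
qed

section \<open>From coordinates centred at the box to bonds of the lattice\<close>

definition lat :: "('d::finite) lattice \<Rightarrow> ('d \<Rightarrow> int) \<Rightarrow> 'd lattice" where
  "lat x0 x = x0 + vec_lambda x"

lemma lat_nth [simp]: "lat x0 x $ i = x0 $ i + x i"
  by (simp add: lat_def)

lemma lat_eq_iff [simp]: "lat x0 x = lat x0 y \<longleftrightarrow> x = y"
  by (auto simp: vec_eq_iff fun_eq_iff)

lemma lat_surj: "\<exists>x. y = lat x0 x"
  by (intro exI[of _ "\<lambda>i. y $ i - x0 $ i"]) (simp add: vec_eq_iff)

lemma lat_upd: "lat x0 (x(k := x k + c)) = lat x0 x + axis k c"
  by (auto simp: vec_eq_iff axis_def)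

lemma lat_upd': "lat x0 (x(k := x k - 1)) = lat x0 x - axis k 1"
  by (auto simp: vec_eq_iff axis_def)

lemma lattice_box_lat: "lattice_box x0 (real R) = lat x0 ` cube R"
proof -
  have "lat x0 x \<in> lattice_box x0 (real R) \<longleftrightarrow> x \<in> cube R" for x
  proof -
    have "real_of_int (x i) \<in> {- real R..real R} \<longleftrightarrow> \<bar>x i\<bar> \<le> int R" for i by auto
    then show ?thesis by (simp only: lattice_box_def cube_def mem_Collect_eq vector_minus_component lat_nth add_diff_cancel_left')
  qed
  then show ?thesis using lat_surj[of _ x0] by (fastforce intro: image_eqI)
qed

text \<open>A nonzero integer has square at least 1, so only one coordinate can be nonzero. This
  turns the Euclidean condition on bonds into unit steps along an axis.\<close>

lemma sum_squares_eq_1: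
  fixes z :: "int ^ 'd::finite"
  shows "(\<Sum>i\<in>UNIV. (z $ i)^2) = 1 \<longleftrightarrow> (\<exists>k. z = axis k 1 \<or> z = - axis k 1)"
proof
  assume s: "(\<Sum>i\<in>UNIV. (z $ i)^2) = 1"
  then obtain k where k: "z $ k \<noteq> 0" by force
  then have k1: "(z $ k)^2 \<ge> 1" by (simp add: int_one_le_iff_zero_less)
  have "(z $ k)^2 + (\<Sum>i\<in>UNIV - {k}. (z $ i)^2) = 1"
    using s by (subst (asm) sum.remove[of _ k]) auto
  moreover have "(\<Sum>i\<in>UNIV - {k}. (z $ i)^2) \<ge> 0" by (intro sum_nonneg) simp
  ultimately have e: "(z $ k)^2 = 1" "(\<Sum>i\<in>UNIV - {k}. (z $ i)^2) = 0" using k1 by linarith+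
  then have "\<forall>i\<in>UNIV - {k}. (z $ i)^2 = 0" by (subst (asm) sum_nonneg_eq_0_iff) auto
  then have "z $ i = 0" if "i \<noteq> k" for i using that by auto
  moreover have "z $ k = 1 \<or> z $ k = - 1" using e(1) by (simp add: power2_eq_1_iff)
  ultimately show "\<exists>k. z = axis k 1 \<or> z = - axis k 1"
    by (intro exI[of _ k]) (auto simp: vec_eq_iff axis_def)
next
  assume "\<exists>k. z = axis k 1 \<or> z = - axis k 1"
  then obtain k where "z = axis k 1 \<or> z = - axis k 1" by blast
  then have "(\<Sum>i\<in>UNIV. (z $ i)^2) = (\<Sum>i\<in>UNIV. if i = k then 1 else 0)"
    by (intro sum.cong refl) (auto simp: axis_def)
  then show "(\<Sum>i\<in>UNIV. (z $ i)^2) = 1" by simp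
qed

lemma bonds_iff_axis: "{x, y} \<in> bonds \<longleftrightarrow> (\<exists>k. y = x + axis k 1 \<or> y = x - axis k 1)"
proof -
  have "norm (\<chi> i. real_of_int ((x - y) $ i)) = 1 \<longleftrightarrow> (\<Sum>i\<in>UNIV. (real_of_int ((x - y) $ i))^2) = 1"
    by (simp add: norm_vec_def L2_set_def real_sqrt_eq_1_iff)
  also have "(\<Sum>i\<in>UNIV. (real_of_int ((x - y) $ i))^2) = real_of_int (\<Sum>i\<in>UNIV. ((x - y) $ i)^2)" by simp
  also have "\<dots> = 1 \<longleftrightarrow> (\<Sum>i\<in>UNIV. ((x - y) $ i)^2) = 1" by (simp only: of_int_eq_1_iff)
  also have "\<dots> \<longleftrightarrow> (\<exists>k. y = x + axis k 1 \<or> y = x - axis k 1)"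
    unfolding sum_squares_eq_1 by (auto simp: algebra_simps)
  finally show ?thesis unfolding bond_in_iff .
qed

text \<open>Separates steps up from steps down: the two families of neighbours are disjoint, and a
  bond has only one lower endpoint.\<close>

lemma axis_sum_neq: "axis k (1::int) + axis j 1 \<noteq> (0 :: int ^ 'd::finite)"
proof
  assume "axis k (1::int) + axis j 1 = (0 :: int ^ 'd)"
  then have "(axis k (1::int) + axis j 1 :: int ^ 'd) $ k = 0" by simp
  then show False by (auto simp: axis_def split: if_splits)
qed

text \<open>Defined for any function on bonds, so that \<open>\<omega>\<close> and its reciprocal
  are transported alike.\<close>

definition edge_conductance :: "(('d::finite) bond \<Rightarrow> real) \<Rightarrow> 'd lattice \<Rightarrow> 'd \<Rightarrow> ('d \<Rightarrow> int) \<Rightarrow> real" where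
  "edge_conductance F x0 k x = F {lat x0 x, lat x0 (x(k := x k + 1))}"

lemma generator_lat:
  fixes x0 :: "'d::finite lattice"
  shows "generator \<omega> u (lat x0 x) = gen (edge_conductance \<omega> x0) (\<lambda>x. u (lat x0 x)) x"
proof -
  define z where "z = lat x0 x"
  let ?F = "\<lambda>y. \<omega> {z, y} * (u y - u z)"
  have set: "{y. {z, y} \<in> bonds} = range (\<lambda>k. z + axis k 1) \<union> range (\<lambda>k. z - axis k 1)"
    unfolding bonds_iff_axis by auto
  have inj1: "inj (\<lambda>k. z + axis k (1::int))" by (rule injI) (simp add: axis_eq_axis)
  have inj2: "inj (\<lambda>k. z - axis k (1::int))" by (rule injI) (simp add: axis_eq_axis)
  have disj: "range (\<lambda>k. z + axis k 1) \<inter> range (\<lambda>k. z - axis k 1) = {}"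
  proof -
    have "z + axis k 1 \<noteq> z - axis j 1" for k j
    proof
      assume "z + axis k 1 = z - axis j 1"
      then have "axis k (1::int) + axis j 1 = (0 :: int ^ 'd)" by (simp add: algebra_simps)
      then show False using axis_sum_neq by blast
    qed
    then show ?thesis by auto
  qed
  have "generator \<omega> u z = (\<Sum>k\<in>UNIV. ?F (z + axis k 1)) + (\<Sum>k\<in>UNIV. ?F (z - axis k 1))"
    unfolding generator_eq_sum set
    by (subst sum.union_disjoint) (use disj in \<open>auto simp: sum.reindex[OF inj1] sum.reindex[OF inj2]\<close>)
  also have "\<dots> = gen (edge_conductance \<omega> x0) (\<lambda>x. u (lat x0 x)) x"
    unfolding gen_def sum.distrib[symmetric] edge_conductance_def
    by (intro sum.cong refl) (simp add: lat_upd lat_upd' insert_commute flip: z_def)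
  finally show ?thesis by (simp add: z_def)
qed

text \<open>Injectivity is the point: if two representations of a bond had their endpoints swapped,
  two positive axis vectors would sum to 0.\<close>

lemma bij_betw_edges_bonds_in:
  "bij_betw (\<lambda>(k, x). {lat x0 x, lat x0 (x(k := x k + 1))}) (edges R) (bonds_in (lattice_box (x0 :: 'd::finite lattice) (real R)))"
  unfolding bij_betw_def
proof (intro conjI subset_antisym inj_onI subsetI)
  fix e e' :: "'d \<times> ('d \<Rightarrow> int)"
  assume "(\<lambda>(k, x). {lat x0 x, lat x0 (x(k := x k + 1))}) e = (\<lambda>(k, x). {lat x0 x, lat x0 (x(k := x k + 1))}) e'"
  moreover obtain k x j y where e: "e = (k, x)" "e' = (j, y)" by fastforce
  ultimately have "{lat x0 x, lat x0 x + axis k 1} = {lat x0 y, lat x0 y + axis j 1}" by (simp only: lat_upd prod.case)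
  then consider "lat x0 x = lat x0 y" "lat x0 x + axis k 1 = lat x0 y + axis j 1"
    | "lat x0 x = lat x0 y + axis j 1" "lat x0 x + axis k 1 = lat x0 y"
    unfolding doubleton_eq_iff by blast
  then show "e = e'"
  proof cases
    case 1
    then show ?thesis by (simp add: e axis_eq_axis)
  next
    case 2
    then have "lat x0 y + (axis j 1 + axis k 1) = lat x0 y" by (simp add: add.assoc)
    then have "axis j (1::int) + axis k 1 = (0 :: int ^ 'd)" by (simp only: add_cancel_left_right)
    then show ?thesis using axis_sum_neq by blast
  qed
next
  fix b assume "b \<in> (\<lambda>(k, x). {lat x0 x, lat x0 (x(k := x k + 1))}) ` edges R"
  then obtain k x where kx: "(k, x) \<in> edges R" "b = {lat x0 x, lat x0 (x(k := x k + 1))}" by auto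
  have "b \<in> bonds" unfolding kx lat_upd bonds_iff_axis by blast
  moreover have "b \<subseteq> lattice_box x0 (real R)" using edge_ends[OF kx(1)] unfolding kx lattice_box_lat by auto
  ultimately show "b \<in> bonds_in (lattice_box x0 (real R))" by (simp add: bonds_in_def)
next
  fix b assume b: "b \<in> bonds_in (lattice_box x0 (real R))"
  have up: "{lat x0 x, lat x0 y} \<in> (\<lambda>(k, x). {lat x0 x, lat x0 (x(k := x k + 1))}) ` edges R"
    if xy: "x \<in> cube R" "y \<in> cube R" "lat x0 y = lat x0 x + axis k 1" for x y k
  proof -
    have y: "y = x(k := x k + 1)" using xy(3) unfolding lat_upd[symmetric] by simp
    have "\<bar>y k\<bar> \<le> int R" using xy(2) by (simp add: cube_def)
    then have "(k, x) \<in> edges R" using xy(1) by (simp add: y edges_def)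
    then show ?thesis unfolding y by (intro image_eqI[of _ _ "(k, x)"]) simp_all
  qed
  obtain s t where st: "b = {s, t}" "{s, t} \<in> bonds" using b by (auto simp: bonds_in_def bonds_def)
  then have "s \<in> lattice_box x0 (real R)" "t \<in> lattice_box x0 (real R)" using b by (auto simp: bonds_in_def)
  then obtain x y where xy: "x \<in> cube R" "y \<in> cube R" "s = lat x0 x" "t = lat x0 y" unfolding lattice_box_lat by blast
  obtain k where "t = s + axis k 1 \<or> t = s - axis k 1" using st(2) unfolding bonds_iff_axis by blast
  then consider "t = s + axis k 1" | "s = t + axis k 1" by force
  then show "b \<in> (\<lambda>(k, x). {lat x0 x, lat x0 (x(k := x k + 1))}) ` edges R"
  proof cases
    case 1
    then show ?thesis using up[OF xy(1,2), of k] by (simp add: st xy)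
  next
    case 2
    then show ?thesis using up[OF xy(2,1), of k] by (simp add: st xy insert_commute)
  qed
qed

lemma avg_norm_eq_enorm:
  "avg_norm (ereal r) (lattice_box (x0 :: 'd::finite lattice) (real R)) F = enorm r R (edge_conductance F x0)"
proof -
  note bij = bij_betw_edges_bonds_in[of x0 R]
  have "(\<Sum>e\<in>bonds_in (lattice_box x0 (real R)). \<bar>F e\<bar> powr r) = (\<Sum>(k, x)\<in>edges R. \<bar>edge_conductance F x0 k x\<bar> powr r)"
    using sum.reindex_bij_betw[OF bij, of "\<lambda>e. \<bar>F e\<bar> powr r"] by (simp add: edge_conductance_def case_prod_beta)
  then show ?thesis unfolding avg_norm_def enorm_def bij_betw_same_card[OF bij, symmetric] by simp
qed

lemma bonds_in_box_finite_nonempty: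
  assumes "R \<ge> 1"
  shows "finite (bonds_in (lattice_box (x0 :: 'd::finite lattice) (real R)))" "bonds_in (lattice_box x0 (real R)) \<noteq> {}"
  using bij_betw_finite[OF bij_betw_edges_bonds_in[of x0 R]] bij_betw_imp_surj_on[OF bij_betw_edges_bonds_in[of x0 R]] edges_nonempty[OF assms, where 'a = 'd]
  by auto

text \<open>A power mean is at most the supremum. Combined with \<open>finite_exponents\<close>,
  this reduces infinite exponents to finite ones.\<close>

lemma avg_norm_le_infinity:
  assumes S: "finite (bonds_in S)" "bonds_in S \<noteq> {}" and r: "r > 0"
  shows "avg_norm (ereal r) S F \<le> avg_norm \<infinity> S F"
proof -
  define M where "M = (SUP e\<in>bonds_in S. \<bar>F e\<bar>)"
  have le: "\<bar>F e\<bar> \<le> M" if "e \<in> bonds_in S" for e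
    unfolding M_def using that S by (intro cSUP_upper) auto
  obtain e where "e \<in> bonds_in S" using S by blast
  then have M0: "M \<ge> 0" using le[of e] by linarith
  have "(\<Sum>e\<in>bonds_in S. \<bar>F e\<bar> powr r) \<le> (\<Sum>e\<in>bonds_in S. M powr r)"
    using le r by (intro sum_mono powr_mono2) auto
  then have "1 / real (card (bonds_in S)) * (\<Sum>e\<in>bonds_in S. \<bar>F e\<bar> powr r) \<le> M powr r"
    using S by (simp add: field_simps card_gt_0_iff)
  then have "(1 / real (card (bonds_in S)) * (\<Sum>e\<in>bonds_in S. \<bar>F e\<bar> powr r)) powr (1 / r) \<le> (M powr r) powr (1 / r)"
    using r by (intro powr_mono2) (auto intro!: divide_nonneg_nonneg sum_nonneg)
  also have "\<dots> = M" using r M0 by (simp add: powr_powr)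
  finally show ?thesis by (simp add: avg_norm_def M_def)
qed

lemma osc_lat: "osc u (lattice_box x0 (real R)) = Max ((\<lambda>x. u (lat x0 x)) ` cube R) - Min ((\<lambda>x. u (lat x0 x)) ` cube R)"
  unfolding osc_def lattice_box_lat image_image ..

lemma osc_nonneg: "osc u (lattice_box (x0 :: 'd::finite lattice) (real R)) \<ge> 0"
proof -
  have "(\<lambda>_. 0) \<in> (cube R :: ('d \<Rightarrow> int) set)" by (simp add: cube_def)
  then have "u (lat x0 (\<lambda>_. 0)) \<in> (\<lambda>x. u (lat x0 x)) ` cube R" by blast
  then have "Min ((\<lambda>x. u (lat x0 x)) ` cube R) \<le> u (lat x0 (\<lambda>_. 0))" "u (lat x0 (\<lambda>_. 0)) \<le> Max ((\<lambda>x. u (lat x0 x)) ` cube R)"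
    by auto
  then show ?thesis unfolding osc_lat by linarith
qed

text \<open>\<open>M1\<close> and \<open>M2\<close> are upper bounds instead of the norms, so that a
  norm with infinite exponent can be inserted into a bound proved for a finite one. The replacement
  uses that \<open>V\<close> increases and that the oscillation is nonnegative.\<close>

lemma log_bound_osc:
  fixes \<omega> :: "('d::finite) bond \<Rightarrow> real"
  assumes V: "log_bound TYPE('d) p q V" "mono_on {0..} V"
    and \<omega>: "\<omega> \<in> conductances" and n: "n \<ge> 1"
    and harm: "\<forall>x \<in> lattice_box x0 (4 * real n). generator \<omega> u x = 0"
    and M: "avg_norm (ereal p) (lattice_box x0 (4 * real n)) \<omega> \<le> M1"
      "avg_norm (ereal q) (lattice_box x0 (4 * real n)) (\<lambda>e. inverse (\<omega> e)) \<le> M2"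
  shows "osc u (lattice_box x0 (real n)) \<le> (1 - exp (- V (M1 * M2)) / 2) * osc u (lattice_box x0 (4 * real n))"
proof -
  let ?a = "edge_conductance \<omega> x0" and ?b = "edge_conductance (\<lambda>e. inverse (\<omega> e)) x0"
  have r4: "4 * real n = real (4 * n)" by simp
  have a: "?a k x > 0" for k x
  proof -
    have "{lat x0 x, lat x0 (x(k := x k + 1))} \<in> bonds" unfolding lat_upd bonds_iff_axis by blast
    then show ?thesis using \<omega> by (auto simp: edge_conductance_def conductances_def)
  qed
  have b: "?b = (\<lambda>k x. inverse (?a k x))" by (simp add: edge_conductance_def fun_eq_iff)
  have e: "enorm p (4 * n) ?a \<ge> 0" "enorm q (4 * n) ?b \<ge> 0" by (simp_all add: enorm_def)
  have M': "enorm p (4 * n) ?a \<le> M1" "enorm q (4 * n) ?b \<le> M2"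
    using M unfolding r4 avg_norm_eq_enorm by simp_all
  have h: "gen ?a (\<lambda>x. u (lat x0 x)) x = 0" if "supnorm x < 4 * int n" for x
  proof -
    have "x \<in> cube (4 * n)" using that by (simp add: cube_supnorm)
    then show ?thesis using harm unfolding r4 lattice_box_lat generator_lat[symmetric] by blast
  qed
  have "osc u (lattice_box x0 (real n)) \<le> (1 - exp (- V (enorm p (4 * n) ?a * enorm q (4 * n) ?b)) / 2) * osc u (lattice_box x0 (4 * real n))"
    unfolding r4 osc_lat b by (rule log_bound_oscillation[OF V(1) a n h])
  also have "\<dots> \<le> (1 - exp (- V (M1 * M2)) / 2) * osc u (lattice_box x0 (4 * real n))"
  proof (intro mult_right_mono)
    have "V (enorm p (4 * n) ?a * enorm q (4 * n) ?b) \<le> V (M1 * M2)"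
      using e M' by (intro mono_onD[OF V(2)] mult_mono) auto
    then show "1 - exp (- V (enorm p (4 * n) ?a * enorm q (4 * n) ?b)) / 2 \<le> 1 - exp (- V (M1 * M2)) / 2" by simp
  qed (unfold r4, rule osc_nonneg)
  finally show ?thesis .
qed

text \<open>The inequality is strict, so the reciprocal 0 of an infinite exponent can be replaced by
  a small positive number.\<close>

lemma finite_exponents:
  fixes p q :: ereal and d :: real
  assumes d: "d \<ge> 3" and pq: "1 < p" "1 < q" "1 / p + 1 / q < 2 / ereal (d - 1)"
  shows "\<exists>p0 q0. p0 > 1 \<and> q0 > 1 \<and> 1 / p0 + 1 / q0 < 2 / (d - 1) \<and> (p = ereal p0 \<or> p = \<infinity>) \<and> (q = ereal q0 \<or> q = \<infinity>)"
proof -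
  have near: "\<exists>r0>1. 1 / r0 < \<epsilon>" if "\<epsilon> > 0" for \<epsilon> :: real
  proof (intro exI[of _ "1 + 1 / \<epsilon>"] conjI)
    show "1 + 1 / \<epsilon> > 1" using that by simp
    have "\<epsilon> * (1 + 1 / \<epsilon>) = \<epsilon> + 1" using that by (simp add: distrib_left)
    then show "1 / (1 + 1 / \<epsilon>) < \<epsilon>" using that by (subst pos_divide_less_eq) (auto simp: add_pos_pos)
  qed
  have e2: "2 / ereal (d - 1) = ereal (2 / (d - 1))" using d ereal_divide[of 2 "d - 1"] by simp
  have d0: "2 / (d - 1) > 0" using d by simp
  consider r s where "p = ereal r" "q = ereal s" | r where "p = ereal r" "q = \<infinity>" | s where "p = \<infinity>" "q = ereal s" | "p = \<infinity>" "q = \<infinity>"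
    using pq(1,2) by (cases p; cases q) auto
  then show ?thesis
  proof cases
    case (1 r s)
    have "1 < r" "1 < s" using pq(1,2) by (simp_all add: 1 flip: one_ereal_def)
    moreover have "1 / r + 1 / s < 2 / (d - 1)"
      using pq(3) \<open>1 < r\<close> \<open>1 < s\<close> unfolding e2 1 by (simp add: one_ereal_def)
    ultimately show ?thesis using 1 by blast
  next
    case (2 r)
    have r: "1 < r" using pq(1) by (simp add: 2 flip: one_ereal_def)
    then have "2 / (d - 1) - 1 / r > 0" using pq(3) unfolding e2 2 by (simp add: one_ereal_def)
    from near[OF this] obtain r0 where "r0 > 1" "1 / r0 < 2 / (d - 1) - 1 / r" by blast
    then show ?thesis using r 2 by (intro exI[of _ r] exI[of _ r0]) auto
  next
    case (3 s)
    have s: "1 < s" using pq(2) by (simp add: 3 flip: one_ereal_def)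
    then have "2 / (d - 1) - 1 / s > 0" using pq(3) unfolding e2 3 by (simp add: one_ereal_def)
    from near[OF this] obtain r0 where "r0 > 1" "1 / r0 < 2 / (d - 1) - 1 / s" by blast
    then show ?thesis using s 3 by (intro exI[of _ r0] exI[of _ s]) auto
  next
    case 4
    from near[OF half_gt_zero[OF d0]] obtain r0 where r0: "r0 > 1" "1 / r0 < 2 / (d - 1) / 2" by blast
    have "x < y / 2 \<Longrightarrow> x + x < y" for x y :: real by linarith
    from this[OF r0(2)] have "1 / r0 + 1 / r0 < 2 / (d - 1)" .
    then show ?thesis using 4 r0(1) by blast
  qed
qed

lemma contraction_factor:
  fixes V :: "real \<Rightarrow> real"
  assumes "continuous_on {1..} V" "mono_on {0..} V" "\<And>M. M \<ge> 0 \<Longrightarrow> V M \<ge> 0"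
  defines "\<theta> \<equiv> \<lambda>M. 1 - exp (- V M) / 2"
  shows "continuous_on {1..} \<theta> \<and> mono_on {1..} \<theta> \<and> \<theta> \<in> {1..} \<rightarrow> {0<..<1}"
proof (intro conjI)
  show "continuous_on {1..} \<theta>" unfolding \<theta>_def by (intro continuous_intros assms) auto
  show "mono_on {1..} \<theta>"
  proof (rule mono_onI)
    fix r s :: real assume "r \<in> {1..}" "s \<in> {1..}" "r \<le> s"
    then have "V r \<le> V s" by (intro mono_onD[OF assms(2)]) auto
    then show "\<theta> r \<le> \<theta> s" by (simp add: \<theta>_def)
  qed
  show "\<theta> \<in> {1..} \<rightarrow> {0<..<1}"
  proof
    fix M :: real assume "M \<in> {1..}"
    then have "exp (- V M) \<le> 1" using assms(3)[of M] by simp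
    then have "exp (- V M) < 2" by linarith
    then show "\<theta> M \<in> {0<..<1}" by (simp add: \<theta>_def)
  qed
qed

theorem theorem2:
  fixes p q :: ereal
  assumes "CARD('d::finite) \<ge> 2"
    and "CARD('d) \<ge> 3 \<Longrightarrow> 1 < p \<and> 1 < q \<and> 1 / p + 1 / q < 2 / ereal (real CARD('d) - 1)"
  shows "\<exists>\<theta> :: real \<Rightarrow> real.
    continuous_on {1..} \<theta> \<and> mono_on {1..} \<theta> \<and> \<theta> \<in> {1..} \<rightarrow> {0<..<1} \<and>
    (\<forall>(\<omega> :: 'd bond \<Rightarrow> real) (x0 :: 'd lattice) (n :: nat) (u :: 'd lattice \<Rightarrow> real).
      \<omega> \<in> conductances \<longrightarrow> n \<ge> 1 \<longrightarrow>
      (\<forall>x \<in> lattice_box x0 (4 * real n). generator \<omega> u x = 0) \<longrightarrow>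
      osc u (lattice_box x0 (real n)) \<le>
        (if CARD('d) = 2
         then \<theta> (avg_norm 1 (lattice_box x0 (4 * real n)) \<omega> *
                 avg_norm 1 (lattice_box x0 (4 * real n)) (\<lambda>e. inverse (\<omega> e)))
         else \<theta> (avg_norm p (lattice_box x0 (4 * real n)) \<omega> *
                 avg_norm q (lattice_box x0 (4 * real n)) (\<lambda>e. inverse (\<omega> e))))
        * osc u (lattice_box x0 (4 * real n)))"
proof (cases "CARD('d) = 2")
  case True
  obtain c where c: "c \<ge> 0" "log_bound TYPE('d) 1 1 (\<lambda>M. c * sqrt M)"
    using log_bound_planar[OF True] by blast
  let ?V = "\<lambda>M. c * sqrt M"
  have V: "continuous_on {1..} ?V" "mono_on {0..} ?V" "\<And>M. M \<ge> 0 \<Longrightarrow> ?V M \<ge> 0"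
    using c(1) by (auto intro!: continuous_intros mono_onI mult_left_mono)
  show ?thesis
    unfolding if_P[OF True] using contraction_factor[OF V] log_bound_osc[OF c(2) V(2)]
    by (intro exI[of _ "\<lambda>M. 1 - exp (- ?V M) / 2"]) (auto simp: one_ereal_def)
next
  case False
  with assms(1) have d: "CARD('d) \<ge> 3" by simp
  then have "real CARD('d) \<ge> 3" by simp
  from finite_exponents[OF this] assms(2)[OF d] obtain p0 q0 where
    p0: "p0 > 1" "p = ereal p0 \<or> p = \<infinity>" and q0: "q0 > 1" "q = ereal q0 \<or> q = \<infinity>"
    and pq0: "1 / p0 + 1 / q0 < 2 / (real CARD('d) - 1)" by blast
  obtain C c \<kappa> where C: "C > 0" "c > 0" "\<kappa> > 0"
    and lb: "log_bound TYPE('d) p0 q0 (\<lambda>M. C * ((c * M) powr \<kappa> + (c * M) powr (1 / 2)))"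
    using log_bound_high[OF d p0(1) q0(1) pq0] by blast
  let ?V = "\<lambda>M. C * ((c * M) powr \<kappa> + (c * M) powr (1 / 2))"
  have V: "continuous_on {1..} ?V" "mono_on {0..} ?V" "\<And>M. M \<ge> 0 \<Longrightarrow> ?V M \<ge> 0"
    using C by (auto intro!: continuous_intros mono_onI mult_left_mono add_mono powr_mono2)
  \<comment> \<open>Passing to the finite exponents only decreases the norms, the right direction
    for an increasing \<open>?V\<close>.\<close>
  have le: "avg_norm (ereal r0) (lattice_box x0 (4 * real n)) F \<le> avg_norm r (lattice_box x0 (4 * real n)) F"
    if "r0 > 1" "r = ereal r0 \<or> r = \<infinity>" "n \<ge> 1" for r0 r n and x0 :: "'d lattice" and F
  proof -
    have "avg_norm (ereal r0) (lattice_box x0 (real (4 * n))) F \<le> avg_norm \<infinity> (lattice_box x0 (real (4 * n))) F"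
      using that bonds_in_box_finite_nonempty[of "4 * n" x0] by (intro avg_norm_le_infinity) auto
    then show ?thesis using that(2) by auto
  qed
  note cf = contraction_factor[OF V]
  show ?thesis
    unfolding if_not_P[OF False]
  proof (intro exI[of _ "\<lambda>M. 1 - exp (- ?V M) / 2"] conjI allI impI)
    fix \<omega> :: "'d bond \<Rightarrow> real" and x0 :: "'d lattice" and n and u :: "'d lattice \<Rightarrow> real"
    assume "\<omega> \<in> conductances" "n \<ge> 1" "\<forall>x \<in> lattice_box x0 (4 * real n). generator \<omega> u x = 0"
    then show "osc u (lattice_box x0 (real n)) \<le>
      (1 - exp (- ?V (avg_norm p (lattice_box x0 (4 * real n)) \<omega> * avg_norm q (lattice_box x0 (4 * real n)) (\<lambda>e. inverse (\<omega> e)))) / 2)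
      * osc u (lattice_box x0 (4 * real n))"
      using le[OF p0] le[OF q0] by (intro log_bound_osc[OF lb V(2)]) auto
  qed (use cf in blast)+
qed

end
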